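(* Let $\alpha\in(0,1]$, $\beta>0$, $\gamma\in(0,1)$ with $\beta\gamma$ not an integer. Let $\widetilde m\in C(\mathbb R^N\setminus\{0\})$ be bounded and let $n_j$, $j\in\mathbb Z$, be the functions associated with $\widetilde m$ as in the context. Suppose that $$\widetilde m(0,\dots,0,\xi_N)=0\quad\text{for all real }\xi_N\neq 0,$$ and that for some $\mu>0$ $$\int_{\mathbb R^N}\bigl(1+|x''|^{\gamma}+|x_{N-1}|^{\alpha\gamma}\bigr)\,|n_j(x)|\,dx\le\mu\qquad\text{for all } j\in\mathbb Z.$$ Let $u\in C^{\gamma,\alpha\gamma}_{x'',x_{N-1}}(\mathbb R^N)$ have compact support, so that in particular $\langle u\rangle^{(\gamma)}_{x'',\mathbb R^N}+\langle u\rangle^{(\alpha\gamma)}_{x_{N-1},\mathbb R^N}<\infty$, and put $v=F^{-1}(\widetilde m\,\widetilde u)$. Then $v$ satisfies Hölder conditions with respect to all variables and $$\langle v\rangle^{(\gamma)}_{x'',\mathbb R^N}+\langle v\rangle^{(\alpha\gamma)}_{x_{N-1},\mathbb R^N}+\langle v\rangle^{(\beta\gamma)}_{x_N,\mathbb R^N}\le C\mu\Bigl(\langle u\rangle^{(\gamma)}_{x'',\mathbb R^N}+\langle u\rangle^{(\alpha\gamma)}_{x_{N-1},\mathbb R^N}\Bigr),$$ where the constant $C$ depends only on the fixed data $N,\alpha,\beta,\gamma$ and the cut-off $\omega$ (not on $u$, $\widetilde m$ or $\mu$).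
   Context: Write $x=(x_1,\dots,x_N)\in\mathbb R^N$, $x''=(x_1,\dots,x_{N-2})$, $x'=(x_1,\dots,x_{N-1})$, and similarly for $\xi$. The Fourier transform is $\widetilde u(\xi)=F(u)(\xi)=\int_{\mathbb R^N}e^{-ix\cdot\xi}u(x)\,dx$ (extended to $L_2(\mathbb R^N)$), and $F^{-1}$ is its inverse. Anisotropic distance: $\rho(x)=\sum_{k=1}^{N-2}|x_k|+|x_{N-1}|^{\alpha}+|x_N|^{\beta}$. Fix a function $\omega\in C^\infty([0,\infty))$ with values in $[0,1]$, $\omega\equiv1$ on $[1/2,2]$ and $\omega\equiv0$ on $[0,1/4]\cup[4,\infty)$, and put $\chi(\xi)=\omega(\rho(\xi))$. For $j\in\mathbb Z$ let $$A_jx=(2^jx_1,\dots,2^jx_{N-2},2^{j/\alpha}x_{N-1},2^{j/\beta}x_N),\qquad a_j=\det A_j=2^{j(N-2)+j/\alpha+j/\beta}.$$ For a bounded $\widetilde m\in C(\mathbb R^N\setminus\{0\})$ put $\widetilde m_j(\xi)=\widetilde m(\xi)\chi(A_j^{-1}\xi)$, $m_j=F^{-1}(\widetilde m_j)$, and $n_j(x)=a_j^{-1}m_j(A_j^{-1}x)$. Seminorms: for a positive non-integer $l$, $$\langle u\rangle^{(l)}_{x_i,\mathbb R^N}=\sup_{x\in\mathbb R^N,\,h>0}\frac{|D^{[l]}_{x_i}u(x_1,\dots,x_i+h,\dots,x_N)-D^{[l]}_{x_i}u(x)|}{h^{l-[l]}},$$ where $[l]$ is the integer part of $l$ (equivalently,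 up to constants, $\sup_{x,h>0}|\Delta^k_{h,x_i}u(x)|h^{-l}$ with an integer $k>l$, $\Delta_{h,x_i}$ being the forward difference of step $h$ in $x_i$). Also $\langle u\rangle^{(\gamma)}_{x'',\mathbb R^N}=\sum_{i=1}^{N-2}\langle u\rangle^{(\gamma)}_{x_i,\mathbb R^N}$. The space $C^{\gamma,\alpha\gamma}_{x'',x_{N-1}}(\mathbb R^N)$ consists of the bounded continuous functions $u$ on $\mathbb R^N$ with $\langle u\rangle^{(\gamma)}_{x'',\mathbb R^N}+\langle u\rangle^{(\alpha\gamma)}_{x_{N-1},\mathbb R^N}<\infty$ (no Hölder condition in $x_N$). *)

theory Defs
  imports "HOL-Analysis.Analysis"
begin

text \<open>
  Points of $R^N$ are vectors of type \<^typ>\<open>real ^ 'n\<close>, with $N$ the cardinality of \<^typ>\<open>'n\<close>.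
  Two distinct indices \<open>p\<close> and \<open>q\<close> play the roles of $N-1$ and $N$; the remaining indices
  \<open>- {p, q}\<close> are those of $x''$.
\<close>

section \<open>Anisotropic dilations and cut-off\<close>

definition rho :: "real \<Rightarrow> real \<Rightarrow> 'n \<Rightarrow> 'n \<Rightarrow> real ^ 'n::finite \<Rightarrow> real" where
  "rho \<alpha> \<beta> p q x =
     (\<Sum>k\<in>- {p, q}. \<bar>x $ k\<bar>) + \<bar>x $ p\<bar> powr \<alpha> + \<bar>x $ q\<bar> powr \<beta>"

definition dil :: "real \<Rightarrow> real \<Rightarrow> 'n \<Rightarrow> 'n \<Rightarrow> int \<Rightarrow> real ^ 'n::finite \<Rightarrow> real ^ 'n" where
  "dil \<alpha> \<beta> p q j x =
     (\<chi> i. (if i = p then 2 powr (real_of_int j / \<alpha>)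
            else if i = q then 2 powr (real_of_int j / \<beta>)
            else 2 powr real_of_int j) * x $ i)"

definition dil_det :: "real \<Rightarrow> real \<Rightarrow> 'n::finite itself \<Rightarrow> int \<Rightarrow> real" where
  "dil_det \<alpha> \<beta> _ j =
     2 powr (real_of_int j * (real CARD('n) - 2) + real_of_int j / \<alpha> + real_of_int j / \<beta>)"

lemma dil_inverse: "dil \<alpha> \<beta> p q j (dil \<alpha> \<beta> p q (- j) x) = x"
  by (simp add: dil_def vec_eq_iff powr_minus)

lemma inv_dil: "inv (dil \<alpha> \<beta> p q j) = dil \<alpha> \<beta> p q (- j)"
  by (rule inv_equality) (use dil_inverse[of \<alpha> \<beta> p q "- j"] dil_inverse in auto)

lemma det_dil:
  fixes p q :: "'n::finite"
  assumes "p \<noteq> q"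
  shows "det (matrix (dil \<alpha> \<beta> p q j)) = dil_det \<alpha> \<beta> TYPE('n) j"
proof -
  define d where "d i = (if i = p then 2 powr (real_of_int j / \<alpha>)
            else if i = q then 2 powr (real_of_int j / \<beta>)
            else 2 powr real_of_int j)" for i
  have entry: "matrix (dil \<alpha> \<beta> p q j) $ i $ k = (if i = k then d i else 0)" for i k
    by (simp add: matrix_def dil_def d_def axis_def)
  have card: "card (- {p, q}) = CARD('n) - 2" "CARD('n) \<ge> 2"
    using assms card_mono[of UNIV "{p, q}"] by (simp_all add: card_Diff_subset Compl_eq_Diff_UNIV)
  have "det (matrix (dil \<alpha> \<beta> p q j)) = (\<Prod>i\<in>UNIV. d i)"
    by (subst det_diagonal) (simp_all add: entry)
  also have "UNIV = insert p (insert q (- {p, q}))"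
    by auto
  also have "(\<Prod>i\<in>\<dots>. d i) = d p * (d q * (\<Prod>i\<in>- {p, q}. d i))"
    using assms by (subst prod.insert; simp)+
  also have "(\<Prod>i\<in>- {p, q}. d i) = (2 powr real_of_int j) ^ (CARD('n) - 2)"
    unfolding card(1)[symmetric] by (subst prod_constant[symmetric], rule prod.cong) (auto simp: d_def)
  also have "\<dots> = 2 powr (real_of_int j * (real CARD('n) - 2))"
    using card(2) by (simp add: powr_realpow[symmetric] powr_powr of_nat_diff)
  finally show ?thesis
    using assms by (simp add: d_def dil_det_def powr_add)
qed

definition smooth_halfline :: "(real \<Rightarrow> real) \<Rightarrow> bool" where
  "smooth_halfline f \<longleftrightarrow>
     (\<exists>D. (\<forall>t\<ge>0. D 0 t = f t) \<and>
          (\<forall>k::nat. \<forall>t\<ge>0. (D k has_real_derivative D (Suc k) t) (at t within {0..})))"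

definition cutoff :: "(real \<Rightarrow> real) \<Rightarrow> bool" where
  "cutoff \<omega> \<longleftrightarrow>
     smooth_halfline \<omega> \<and> (\<forall>t\<ge>0. 0 \<le> \<omega> t \<and> \<omega> t \<le> 1) \<and>
     (\<forall>t\<in>{1/2..2}. \<omega> t = 1) \<and> (\<forall>t\<in>{0..1/4} \<union> {4..}. \<omega> t = 0)"

section \<open>Fourier transform\<close>

definition fourier :: "(real ^ 'n::finite \<Rightarrow> complex) \<Rightarrow> real ^ 'n \<Rightarrow> complex" where
  "fourier u \<xi> = (LINT x|lborel. exp (- \<i> * complex_of_real (x \<bullet> \<xi>)) * u x)"

definition inv_fourier :: "(real ^ 'n::finite \<Rightarrow> complex) \<Rightarrow> real ^ 'n \<Rightarrow> complex" where
  "inv_fourier g x = complex_of_real (1 / (2 * pi) ^ CARD('n)) *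
     (LINT \<xi>|lborel. exp (\<i> * complex_of_real (x \<bullet> \<xi>)) * g \<xi>)"

definition in_L2 :: "(real ^ 'n::finite \<Rightarrow> complex) \<Rightarrow> bool" where
  "in_L2 f \<longleftrightarrow> f \<in> borel_measurable lborel \<and> integrable lborel (\<lambda>x. (cmod (f x))\<^sup>2)"

definition tendsto_L2 ::
    "(nat \<Rightarrow> real ^ 'n::finite \<Rightarrow> complex) \<Rightarrow> (real ^ 'n \<Rightarrow> complex) \<Rightarrow> bool" where
  "tendsto_L2 F f \<longleftrightarrow> (\<lambda>k. \<integral>\<^sup>+x. ennreal ((cmod (F k x - f x))\<^sup>2) \<partial>lborel) \<longlonglongrightarrow> 0"

text \<open>
  \<open>inv_fourier_L2 g v\<close> says that \<open>v\<close> represents the value at \<open>g\<close> of the continuous extension of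
  the inverse Fourier transform from $L_1 \cap L_2$ to $L_2$. Elements of $L_2$ are classes
  modulo null sets, so this is a relation; it determines \<open>v\<close> almost everywhere, because \<open>g\<close> is the
  $L_2$-limit of its truncations.
\<close>

definition inv_fourier_L2 ::
    "(real ^ 'n::finite \<Rightarrow> complex) \<Rightarrow> (real ^ 'n \<Rightarrow> complex) \<Rightarrow> bool" where
  "inv_fourier_L2 g v \<longleftrightarrow>
     in_L2 g \<and> in_L2 v \<and>
     (\<forall>G. (\<forall>k. integrable lborel (G k) \<and> in_L2 (G k)) \<longrightarrow> tendsto_L2 G g \<longrightarrow>
          tendsto_L2 (\<lambda>k. inv_fourier (G k)) v)"

section \<open>Localised kernels\<close>

text \<open>By \<open>inv_dil\<close>, \<open>dil \<alpha> \<beta> p q (- j)\<close> is the inverse of \<open>dil \<alpha> \<beta> p q j\<close>.\<close>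

definition symbol_piece ::
    "real \<Rightarrow> real \<Rightarrow> 'n \<Rightarrow> 'n \<Rightarrow> (real \<Rightarrow> real) \<Rightarrow> (real ^ 'n::finite \<Rightarrow> complex) \<Rightarrow> int \<Rightarrow>
      real ^ 'n \<Rightarrow> complex" where
  "symbol_piece \<alpha> \<beta> p q \<omega> m j \<xi> =
     m \<xi> * complex_of_real (\<omega> (rho \<alpha> \<beta> p q (dil \<alpha> \<beta> p q (- j) \<xi>)))"

definition kernel ::
    "real \<Rightarrow> real \<Rightarrow> 'n \<Rightarrow> 'n \<Rightarrow> (real \<Rightarrow> real) \<Rightarrow> (real ^ 'n::finite \<Rightarrow> complex) \<Rightarrow> int \<Rightarrow>
      real ^ 'n \<Rightarrow> complex" where
  "kernel \<alpha> \<beta> p q \<omega> m j x =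
     complex_of_real (1 / dil_det \<alpha> \<beta> TYPE('n) j) *
     inv_fourier (symbol_piece \<alpha> \<beta> p q \<omega> m j) (dil \<alpha> \<beta> p q (- j) x)"

definition kernel_weight :: "real \<Rightarrow> real \<Rightarrow> 'n \<Rightarrow> 'n \<Rightarrow> real ^ 'n::finite \<Rightarrow> real" where
  "kernel_weight \<alpha> \<gamma> p q x =
     1 + sqrt (\<Sum>i\<in>- {p, q}. (x $ i)\<^sup>2) powr \<gamma> + \<bar>x $ p\<bar> powr (\<alpha> * \<gamma>)"

section \<open>Hoelder seminorms\<close>

definition partial_deriv ::
    "'n \<Rightarrow> (real ^ 'n::finite \<Rightarrow> complex) \<Rightarrow> real ^ 'n \<Rightarrow> complex" where
  "partial_deriv i u x = vector_derivative (\<lambda>t. u (x + t *\<^sub>R axis i 1)) (at 0)"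

definition partially_differentiable ::
    "nat \<Rightarrow> 'n \<Rightarrow> (real ^ 'n::finite \<Rightarrow> complex) \<Rightarrow> bool" where
  "partially_differentiable k i u \<longleftrightarrow>
     (\<forall>r<k. \<forall>x. (\<lambda>t. (partial_deriv i ^^ r) u (x + t *\<^sub>R axis i 1)) differentiable (at 0))"

text \<open>
  The seminorm is infinite if the derivative of order \<open>\<lfloor>l\<rfloor>\<close> does not exist everywhere, since
  \<^const>\<open>vector_derivative\<close> is unspecified in that case.
\<close>

definition holder_seminorm ::
    "real \<Rightarrow> 'n \<Rightarrow> (real ^ 'n::finite \<Rightarrow> complex) \<Rightarrow> ennreal" where
  "holder_seminorm l i u =
     (let k = nat \<lfloor>l\<rfloor>; w = (partial_deriv i ^^ k) u in
      if partially_differentiable k i u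
      then (SUP x. SUP h\<in>{0<..}.
              ennreal (cmod (w (x + h *\<^sub>R axis i 1) - w x) / h powr (l - real k)))
      else \<infinity>)"

definition holder_seminorm_dprime ::
    "real \<Rightarrow> 'n \<Rightarrow> 'n \<Rightarrow> (real ^ 'n::finite \<Rightarrow> complex) \<Rightarrow> ennreal" where
  "holder_seminorm_dprime \<gamma> p q u = (\<Sum>i\<in>- {p, q}. holder_seminorm \<gamma> i u)"

definition holder_space ::
    "real \<Rightarrow> real \<Rightarrow> 'n \<Rightarrow> 'n \<Rightarrow> (real ^ 'n::finite \<Rightarrow> complex) set" where
  "holder_space \<alpha> \<gamma> p q =
     {u. continuous_on UNIV u \<and> bounded (range u) \<and>
         holder_seminorm_dprime \<gamma> p q u + holder_seminorm (\<alpha> * \<gamma>) p u < \<infinity>}"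

end

theory Submission
  imports Defs "HOL-Probability.Characteristic_Functions" "HOL-Probability.Sinc_Integral"
begin

text \<open>
  The symbol is split by a Lipschitz anisotropic partition of unity into pieces, each of which lies in
  the region where one of the given cut-offs equals 1. As \<open>m\<close> vanishes on the \<open>q\<close>-axis, the kernel
  of a localised operator has zero mean over every hyperplane \<open>x $ q = const\<close>; hence the
  operator only sees increments of \<open>u\<close> in the other variables, and by the weighted kernel bound its
  output at scale \<open>j\<close> is at most \<open>2 powr (- j * \<gamma>)\<close> times \<open>\<mu>\<close> and the seminorm of \<open>u\<close>.
  Bernstein's inequality bounds the derivatives of the blocks in all directions, \<open>q\<close> included, and
  summing the blocks gives the Hoelder bounds. The partition is built from tent functions of single
  coordinates: multiplication by such a function averages translates on the other side of the
  Fourier transform, so no multivariate kernel estimates are needed.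
\<close>

subsection \<open>The Fourier integral\<close>

text \<open>The hypothesis sees \<open>m\<close> only through the dilated cut-offs, which overlap
  and do not sum to 1; hence a second partition, independent of \<open>\<omega>\<close>. On the
  support of \<open>annular s\<close> the gauge \<open>arho s\<close> can vary by more than the
  factor 4 on which one cut-off equals 1, so each annulus is divided further into finitely many
  cells, the same at every scale up to dilation. Tents suffice because no derivative of a symbol is
  taken: the transform of a tent is the Fejer kernel, nonnegative with total mass 2 \<pi>, so a tent
  is a sup-norm multiplier of norm 1. A difference of two tents is linear on an interval, which also
  gives Bernstein's inequality.

  The bound 2 powr (- j \<gamma>) explodes as j tends to minus infinity. A crude bound by the volume
  of the frequency box makes the blocks summable there; it depends on more of \<open>u\<close> than
  its seminorms, serves convergence only and stays out of the final constant. The blocks are summed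
  pointwise, whereas \<open>v\<close> is defined by \<open>L\<^sub>2\<close> limits; Plancherel's
  inequality and Fatou's lemma identify the two.\<close>

definition ft :: "('a::euclidean_space \<Rightarrow> complex) \<Rightarrow> 'a \<Rightarrow> complex" where
  "ft f x = (LINT \<xi>|lborel. iexp (x \<bullet> \<xi>) * f \<xi>)"

lemma integrable_iexp_mult:
  fixes f :: "'a::euclidean_space \<Rightarrow> complex"
  assumes "integrable lborel f"
  shows "integrable lborel (\<lambda>\<xi>. iexp (x \<bullet> \<xi>) * f \<xi>)"
  by (rule Bochner_Integration.integrable_bound[OF assms]) (use assms in \<open>auto simp: norm_mult\<close>)

lemma norm_ft_le: "norm (ft f x) \<le> (LINT \<xi>|lborel. norm (f \<xi>))"
  unfolding ft_def by (rule order_trans[OF integral_norm_bound]) (simp add: norm_mult)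

lemma ft_tendsto:
  assumes f: "integrable lborel f" and "X \<longlonglongrightarrow> x"
  shows "(\<lambda>n. ft f (X n)) \<longlonglongrightarrow> ft f x"
  unfolding ft_def
proof (rule integral_dominated_convergence[where w = "\<lambda>\<xi>. norm (f \<xi>)"])
  show "AE \<xi> in lborel. (\<lambda>n. iexp (X n \<bullet> \<xi>) * f \<xi>) \<longlonglongrightarrow> iexp (x \<bullet> \<xi>) * f \<xi>"
    by (intro AE_I2 tendsto_intros assms)
qed (use f in \<open>auto simp: norm_mult\<close>)

lemma continuous_ft:
  assumes "integrable lborel f" shows "continuous_on UNIV (ft f)"
  using ft_tendsto[OF assms] by (auto simp: continuous_on_sequentially comp_def)

lemma borel_measurable_ft:
  assumes "integrable lborel f" shows "ft f \<in> borel_measurable borel"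
  by (intro borel_measurable_continuous_onI continuous_ft assms)

lemma ft_add:
  assumes "integrable lborel f" "integrable lborel g"
  shows "ft (\<lambda>x. f x + g x) y = ft f y + ft g y"
  using integrable_iexp_mult[OF assms(1), of y] integrable_iexp_mult[OF assms(2), of y]
  by (simp add: ft_def ring_distribs)

lemma ft_diff:
  assumes "integrable lborel f" "integrable lborel g"
  shows "ft (\<lambda>x. f x - g x) y = ft f y - ft g y"
  using integrable_iexp_mult[OF assms(1), of y] integrable_iexp_mult[OF assms(2), of y]
  by (simp add: ft_def ring_distribs)

lemma ft_sum:
  assumes "\<And>i. i \<in> I \<Longrightarrow> integrable lborel (f i)"
  shows "ft (\<lambda>x. \<Sum>i\<in>I. f i x) y = (\<Sum>i\<in>I. ft (f i) y)"
  unfolding ft_def sum_distrib_left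
  by (rule Bochner_Integration.integral_sum) (rule integrable_iexp_mult[OF assms])

lemma ft_cmult: "ft (\<lambda>x. c * f x) y = c * ft f y"
  by (simp add: ft_def mult.left_commute[of _ c])

lemma ft_cong: "(\<And>x. f x = g x) \<Longrightarrow> ft f y = ft g y"
  by (simp add: ft_def)

lemma integrable_lborel_pair_mult:
  fixes f :: "'a::euclidean_space \<Rightarrow> complex" and g :: "'b::euclidean_space \<Rightarrow> complex"
  assumes f: "integrable lborel f" and g: "integrable lborel g"
    and k[measurable]: "case_prod k \<in> borel_measurable (lborel \<Otimes>\<^sub>M lborel)"
    and k1: "\<And>x y. norm (k x y) \<le> 1"
  shows "integrable (lborel \<Otimes>\<^sub>M lborel) (\<lambda>(x, y). f x * g y * k x y)"
proof -
  have [measurable]: "f \<in> borel_measurable lborel" "g \<in> borel_measurable lborel"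
    using f g by auto
  have "integrable (lborel \<Otimes>\<^sub>M lborel) (\<lambda>(x, y). f x * g y)"
  proof (rule lborel_pair.Fubini_integrable)
    show "integrable lborel (\<lambda>x. \<integral>y. norm (case (x, y) of (x, y) \<Rightarrow> f x * g y) \<partial>lborel)"
      using f by (simp add: norm_mult)
    show "AE x in lborel. integrable lborel (\<lambda>y. case (x, y) of (x, y) \<Rightarrow> f x * g y)"
      using g by simp
  qed measurable
  then show ?thesis
    by (rule Bochner_Integration.integrable_bound)
       (use k1 in \<open>auto simp: norm_mult mult_left_le\<close>)
qed

text \<open>Every exchange of Bochner integrals below has this shape, with a character as coupling
  kernel \<open>k\<close>. The bound on \<open>k\<close> reduces integrability on the product space
  to that of the two factors.\<close>

lemma lborel_Fubini_mult:
  fixes f :: "'a::euclidean_space \<Rightarrow> complex" and g :: "'b::euclidean_space \<Rightarrow> complex"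
  assumes f: "integrable lborel f" and g: "integrable lborel g"
    and k: "case_prod k \<in> borel_measurable (lborel \<Otimes>\<^sub>M lborel)"
    and k1: "\<And>x y. norm (k x y) \<le> 1"
  shows "(LINT x|lborel. f x * (LINT y|lborel. g y * k x y)) =
         (LINT y|lborel. g y * (LINT x|lborel. f x * k x y))"
proof -
  have "(LINT y|lborel. (LINT x|lborel. f x * g y * k x y)) =
        (LINT x|lborel. (LINT y|lborel. f x * g y * k x y))"
    by (rule lborel_pair.Fubini_integral) (use integrable_lborel_pair_mult[OF assms] in simp)
  moreover have "(LINT y|lborel. f x * g y * k x y) = f x * (LINT y|lborel. g y * k x y)" for x
    by (simp add: mult.assoc)
  moreover have "(LINT x|lborel. f x * g y * k x y) = g y * (LINT x|lborel. f x * k x y)" for y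
    by (simp add: mult.assoc mult.left_commute[of _ "g y"])
  ultimately show ?thesis by simp
qed

subsection \<open>Gaussian kernels\<close>

definition gauss :: "real \<Rightarrow> 'a::euclidean_space \<Rightarrow> real" where
  "gauss \<epsilon> x = (\<Prod>b\<in>Basis. normal_density 0 \<epsilon> (x \<bullet> b))"

text \<open>The dual Gaussian of \<open>gauss \<epsilon>\<close>: as \<epsilon> decreases to 0 this
  weight increases to 1, while its transform, a multiple of \<open>gauss \<epsilon>\<close>,
  concentrates at the origin.\<close>

definition gauss_weight :: "real \<Rightarrow> 'a::euclidean_space \<Rightarrow> real" where
  "gauss_weight \<epsilon> x = (\<Prod>b\<in>Basis. exp (- ((\<epsilon> * (x \<bullet> b))\<^sup>2 / 2)))"

lemma gauss_nonneg: "0 \<le> gauss \<epsilon> x"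
  by (simp add: gauss_def prod_nonneg)

lemma gauss_weight_bounds: "0 \<le> gauss_weight \<epsilon> x" "gauss_weight \<epsilon> x \<le> 1"
  by (auto simp: gauss_weight_def prod_nonneg intro!: prod_le_1)

lemma borel_measurable_gauss[measurable]: "gauss \<epsilon> \<in> borel_measurable borel"
  unfolding gauss_def by measurable

lemma borel_measurable_gauss_weight[measurable]: "gauss_weight \<epsilon> \<in> borel_measurable borel"
  unfolding gauss_weight_def by measurable

lemma nn_integral_gauss:
  assumes "0 < \<epsilon>"
  shows "(\<integral>\<^sup>+x. ennreal (gauss \<epsilon> (x :: 'a::euclidean_space)) \<partial>lborel) = 1"
proof -
  have 1: "(\<integral>\<^sup>+x. ennreal (normal_density 0 \<epsilon> x) \<partial>lborel) = 1"
    using assms by (subst nn_integral_eq_integral) (auto simp: integrable_normal_density)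
  have "(\<integral>\<^sup>+x. ennreal (gauss \<epsilon> (x :: 'a::euclidean_space)) \<partial>lborel) =
      (\<integral>\<^sup>+x. (\<Prod>b\<in>Basis. ennreal (normal_density 0 \<epsilon> (x \<bullet> b))) \<partial>(lborel :: 'a measure))"
    unfolding gauss_def by (subst prod_ennreal) auto
  also have "\<dots> = (\<Prod>b\<in>(Basis :: 'a set). (\<integral>\<^sup>+x. ennreal (normal_density 0 \<epsilon> x) \<partial>lborel))"
    by (rule nn_integral_lborel_prod) auto
  finally show ?thesis by (simp add: 1)
qed

lemma integrable_gauss:
  assumes "0 < \<epsilon>" shows "integrable lborel (gauss \<epsilon> :: 'a::euclidean_space \<Rightarrow> real)"
  by (rule integrableI_nonneg) (use nn_integral_gauss[OF assms, where 'a = 'a] in \<open>auto simp: gauss_nonneg\<close>)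

lemma integral_lborel_prod:
  fixes f :: "'a::euclidean_space \<Rightarrow> real \<Rightarrow> complex"
  assumes f: "\<And>b. b \<in> Basis \<Longrightarrow> integrable lborel (f b)"
  shows "(LINT x|lborel. (\<Prod>b\<in>Basis. f b (x \<bullet> b))) = (\<Prod>b\<in>Basis. (LINT t|lborel. f b t))"
proof -
  interpret product_sigma_finite "\<lambda>_::'a. lborel :: real measure" ..
  have [measurable]: "b \<in> Basis \<Longrightarrow> f b \<in> borel_measurable borel" for b
    using f by (auto dest: borel_measurable_integrable)
  have "(LINT x|lborel. (\<Prod>b\<in>Basis. f b (x \<bullet> b))) =
     (LINT x|(\<Pi>\<^sub>M b\<in>Basis. lborel). (\<Prod>b\<in>Basis. f b ((\<Sum>c\<in>Basis. x c *\<^sub>R c) \<bullet> b)))"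
    by (subst lborel_eq, rule integral_distr) measurable
  also have "\<dots> = (LINT x|(\<Pi>\<^sub>M b\<in>Basis. lborel). (\<Prod>b\<in>Basis. f b (x b)))"
    by (simp add: inner_sum_left inner_Basis if_distrib cong: if_cong)
  also have "\<dots> = (\<Prod>b\<in>Basis. (LINT t|lborel. f b t))"
    by (rule product_integral_prod) (use f in auto)
  finally show ?thesis .
qed

lemma integrable_gauss_weight_real:
  assumes "0 < \<epsilon>"
  shows "integrable lborel (\<lambda>x::real. exp (- ((\<epsilon> * x)\<^sup>2 / 2)))"
proof -
  have "integrable lborel (\<lambda>x. sqrt (2 * pi) / \<epsilon> * normal_density 0 (1 / \<epsilon>) x)"
    using assms by (intro integrable_mult_right integrable_normal_density) auto
  also have "(\<lambda>x. sqrt (2 * pi) / \<epsilon> * normal_density 0 (1 / \<epsilon>) x) = (\<lambda>x. exp (- ((\<epsilon> * x)\<^sup>2 / 2)))"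
    using assms by (auto simp: normal_density_def field_simps real_sqrt_mult real_sqrt_divide)
  finally show ?thesis .
qed

lemma integrable_gauss_weight:
  assumes "0 < \<epsilon>"
  shows "integrable lborel (gauss_weight \<epsilon> :: 'a::euclidean_space \<Rightarrow> real)"
proof (rule integrableI_nonneg)
  have "(\<integral>\<^sup>+x. ennreal (gauss_weight \<epsilon> (x :: 'a)) \<partial>lborel) =
      (\<integral>\<^sup>+x. (\<Prod>b\<in>Basis. ennreal (exp (- ((\<epsilon> * (x \<bullet> b))\<^sup>2 / 2)))) \<partial>(lborel :: 'a measure))"
    unfolding gauss_weight_def by (subst prod_ennreal) auto
  also have "\<dots> = (\<Prod>b\<in>(Basis :: 'a set). (\<integral>\<^sup>+x. ennreal (exp (- ((\<epsilon> * x)\<^sup>2 / 2))) \<partial>lborel))"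
    by (rule nn_integral_lborel_prod) auto
  also have "\<dots> < \<infinity>"
    using integrable_gauss_weight_real[OF assms]
    by (subst nn_integral_eq_integral) (auto simp: ennreal_power)
  finally show "(\<integral>\<^sup>+x. ennreal (gauss_weight \<epsilon> (x :: 'a)) \<partial>lborel) < \<infinity>" .
qed (auto simp: gauss_weight_bounds)

lemma integral_iexp_gauss_weight_real:
  assumes "0 < \<epsilon>"
  shows "(LINT x|lborel. iexp (t * x) * exp (- ((\<epsilon> * x)\<^sup>2 / 2))) = 2 * pi * normal_density 0 \<epsilon> t"
proof -
  \<comment> \<open>The characteristic function of the standard normal law is taken at t /
    \<epsilon>, so that the substitution by the factor \<epsilon> restores the frequency t.\<close>
  have "complex_of_real (exp (- ((t / \<epsilon>)\<^sup>2) / 2)) = (CLINT x|std_normal_distribution. iexp (t / \<epsilon> * x))"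
    using char_std_normal_distribution by (metis char_def)
  also have "\<dots> = (LINT x|lborel. std_normal_density x *\<^sub>R iexp (t / \<epsilon> * x))"
    by (rule integral_density) auto
  also have "\<dots> = \<bar>\<epsilon>\<bar> *\<^sub>R (LINT x|lborel. std_normal_density (0 + \<epsilon> * x) *\<^sub>R iexp (t / \<epsilon> * (0 + \<epsilon> * x)))"
    by (rule lborel_integral_real_affine) (use assms in auto)
  also have "\<dots> = (\<epsilon> / sqrt (2 * pi)) * (LINT x|lborel. iexp (t * x) * exp (- ((\<epsilon> * x)\<^sup>2 / 2)))"
    using assms by (simp add: std_normal_density_def scaleR_conv_of_real mult.commute
        flip: integral_mult_right_zero integral_divide_zero)
  finally have "(LINT x|lborel. iexp (t * x) * exp (- ((\<epsilon> * x)\<^sup>2 / 2))) =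
     complex_of_real (sqrt (2 * pi) / \<epsilon> * exp (- ((t / \<epsilon>)\<^sup>2) / 2))"
    using assms by (simp add: field_simps)
  also have "sqrt (2 * pi) / \<epsilon> * exp (- ((t / \<epsilon>)\<^sup>2) / 2) = 2 * pi * normal_density 0 \<epsilon> t"
  proof -
    have "2 * pi = sqrt (2 * pi) * sqrt (2 * pi)" by simp
    then show ?thesis
      using assms by (simp add: normal_density_def real_sqrt_mult field_simps)
  qed
  finally show ?thesis by simp
qed

lemma ft_gauss_weight:
  fixes z :: "'a::euclidean_space"
  assumes "0 < \<epsilon>"
  shows "ft (\<lambda>x. complex_of_real (gauss_weight \<epsilon> x)) z = (2 * pi) ^ DIM('a) * gauss \<epsilon> z"
proof -
  have *: "iexp (z \<bullet> x) * gauss_weight \<epsilon> x =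
      (\<Prod>b\<in>Basis. iexp ((z \<bullet> b) * (x \<bullet> b)) * exp (- ((\<epsilon> * (x \<bullet> b))\<^sup>2 / 2)))" for x :: 'a
    by (subst euclidean_inner)
       (simp add: gauss_weight_def prod.distrib exp_sum sum_distrib_left)
  have "ft (\<lambda>x. complex_of_real (gauss_weight \<epsilon> x)) z =
     (\<Prod>b\<in>(Basis::'a set). (LINT t|lborel. iexp ((z \<bullet> b) * t) * exp (- ((\<epsilon> * t)\<^sup>2 / 2))))"
    unfolding ft_def *
  proof (rule integral_lborel_prod)
    fix b :: 'a
    show "integrable lborel (\<lambda>t. iexp ((z \<bullet> b) * t) * complex_of_real (exp (- ((\<epsilon> * t)\<^sup>2 / 2))))"
      using integrable_iexp_mult[OF integrable_of_real[OF integrable_gauss_weight_real[OF assms]], of "z \<bullet> b"]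
      by simp
  qed
  also have "\<dots> = (\<Prod>b\<in>(Basis::'a set). complex_of_real (2 * pi * normal_density 0 \<epsilon> (z \<bullet> b)))"
    by (intro prod.cong refl integral_iexp_gauss_weight_real assms)
  also have "\<dots> = (2 * pi) ^ DIM('a) * gauss \<epsilon> z"
    by (simp add: prod.distrib gauss_def power_mult_distrib)
  finally show ?thesis .
qed

lemma gauss_minus_commute: "gauss \<epsilon> (x - y) = gauss \<epsilon> (y - x)"
  by (simp add: gauss_def normal_density_def inner_diff_left power2_commute)

text \<open>The Gaussian factor makes Fubini legitimate although \<open>ft f\<close> need not be
  integrable. Inversion, the Plancherel inequality and the vanishing of marginals all start from
  this identity.\<close>

lemma ft_regularized:
  fixes f :: "'a::euclidean_space \<Rightarrow> complex"
  assumes "0 < \<epsilon>" and f: "integrable lborel f"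
  shows "(LINT x|lborel. gauss_weight \<epsilon> x * (iexp (- (x \<bullet> \<xi>)) * ft f x)) =
         (2 * pi) ^ DIM('a) * (LINT \<eta>|lborel. f \<eta> * gauss \<epsilon> (\<eta> - \<xi>))"
proof -
  have *: "iexp (- (x \<bullet> \<xi>)) * ft f x = (LINT \<eta>|lborel. f \<eta> * iexp (x \<bullet> (\<eta> - \<xi>)))" for x
    unfolding ft_def by (subst integral_mult_right_zero[symmetric], rule Bochner_Integration.integral_cong)
       (auto simp: inner_diff_right exp_diff exp_minus field_simps of_real_diff)
  have "(LINT x|lborel. gauss_weight \<epsilon> x * (iexp (- (x \<bullet> \<xi>)) * ft f x)) =
        (LINT \<eta>|lborel. f \<eta> * (LINT x|lborel. gauss_weight \<epsilon> x * iexp (x \<bullet> (\<eta> - \<xi>))))"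
    unfolding * by (rule lborel_Fubini_mult) (use assms in \<open>auto intro!: integrable_of_real integrable_gauss_weight\<close>)
  also have "(\<lambda>\<eta>. (LINT x|lborel. gauss_weight \<epsilon> x * iexp (x \<bullet> (\<eta> - \<xi>)))) =
     (\<lambda>\<eta>. (2 * pi) ^ DIM('a) * complex_of_real (gauss \<epsilon> (\<eta> - \<xi>)))"
    using ft_gauss_weight[OF assms(1), where 'a = 'a]
    by (simp add: ft_def mult.commute inner_commute[of _ "_ - \<xi>"])
  finally show ?thesis
    by (simp add: mult.left_commute[of "f _"])
qed


lemma integral_lborel_affine:
  fixes f :: "'a::euclidean_space \<Rightarrow> 'b::{banach, second_countable_topology}"
  assumes "c \<noteq> 0" and [measurable]: "f \<in> borel_measurable borel"
  shows "(LINT x|lborel. f x) = \<bar>c\<bar> ^ DIM('a) *\<^sub>R (LINT x|lborel. f (t + c *\<^sub>R x))"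
  by (subst lborel_affine[OF assms(1), of t]) (simp add: integral_density integral_distr)

lemma integral_lborel_reflect:
  fixes f :: "'a::euclidean_space \<Rightarrow> 'b::{banach, second_countable_topology}"
  assumes "f \<in> borel_measurable borel"
  shows "(LINT x|lborel. f (t - x)) = (LINT x|lborel. f x)"
  using integral_lborel_affine[of "-1" f t] assms by simp

lemma gauss_scaleR:
  assumes "0 < \<epsilon>"
  shows "\<epsilon> ^ DIM('a) * gauss \<epsilon> (\<epsilon> *\<^sub>R z :: 'a::euclidean_space) = gauss 1 z"
proof -
  have "\<epsilon> * normal_density 0 \<epsilon> (\<epsilon> * t) = normal_density 0 1 t" for t
    using assms by (simp add: normal_density_def real_sqrt_mult field_simps power_mult_distrib)
  then show ?thesis
    unfolding gauss_def prod_constant[symmetric] prod.distrib[symmetric] by simp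
qed

text \<open>Rescaling moves the parameter from the Gaussian into the argument of \<open>f\<close>,
  where continuity gives the limit and a multiple of \<open>gauss 1\<close> dominates.\<close>

lemma gauss_mollify_tendsto:
  fixes f :: "'a::euclidean_space \<Rightarrow> complex"
  assumes f: "continuous_on UNIV f" and bdd: "\<And>x. norm (f x) \<le> B"
  shows "(\<lambda>n. LINT \<eta>|lborel. f \<eta> * gauss (1 / real (Suc n)) (\<eta> - \<xi>)) \<longlonglongrightarrow> f \<xi>"
proof -
  have [measurable]: "f \<in> borel_measurable borel"
    by (rule borel_measurable_continuous_onI[OF f])
  have *: "(LINT \<eta>|lborel. f \<eta> * gauss \<epsilon> (\<eta> - \<xi>)) = (LINT z|lborel. f (\<xi> + \<epsilon> *\<^sub>R z) * gauss 1 z)"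
    if "0 < \<epsilon>" for \<epsilon>
  proof -
    have "(LINT \<eta>|lborel. f \<eta> * gauss \<epsilon> (\<eta> - \<xi>)) =
       (LINT z|lborel. \<epsilon> ^ DIM('a) *\<^sub>R (f (\<xi> + \<epsilon> *\<^sub>R z) * gauss \<epsilon> (\<epsilon> *\<^sub>R z)))"
      using that by (subst integral_lborel_affine[of \<epsilon> _ \<xi>]) auto
    also have "\<dots> = (LINT z|lborel. f (\<xi> + \<epsilon> *\<^sub>R z) * gauss 1 z)"
      unfolding gauss_scaleR[OF that, symmetric] by (simp add: scaleR_conv_of_real mult.left_commute)
    finally show ?thesis .
  qed
  have "(\<lambda>n. LINT z|lborel. f (\<xi> + (1 / real (Suc n)) *\<^sub>R z) * gauss 1 z) \<longlonglongrightarrow>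
      (LINT z|lborel. f \<xi> * gauss 1 (z :: 'a))"
  proof (rule integral_dominated_convergence[where w = "\<lambda>z. B * gauss 1 z"])
    show "integrable lborel (\<lambda>z. B * gauss 1 (z :: 'a))"
      by (simp add: integrable_gauss)
    show "AE z in lborel. (\<lambda>n. f (\<xi> + (1 / real (Suc n)) *\<^sub>R z) * gauss 1 z) \<longlonglongrightarrow> f \<xi> * gauss 1 z"
    proof (intro AE_I2 tendsto_mult_right)
      fix z
      have "(\<lambda>n. \<xi> + (1 / real (Suc n)) *\<^sub>R z) \<longlonglongrightarrow> \<xi> + 0 *\<^sub>R z"
        by (intro tendsto_intros LIMSEQ_Suc lim_1_over_n)
      then show "(\<lambda>n. f (\<xi> + (1 / real (Suc n)) *\<^sub>R z)) \<longlonglongrightarrow> f \<xi>"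
        using f by (simp add: continuous_on_sequentially comp_def)
    qed
  qed (use bdd in \<open>auto simp: norm_mult gauss_nonneg intro!: mult_right_mono\<close>)
  also have "(LINT z|lborel. f \<xi> * gauss 1 (z :: 'a)) = f \<xi>"
  proof -
    have "(LINT z|lborel. gauss 1 (z :: 'a)) = 1"
      by (subst integral_eq_nn_integral) (auto simp: gauss_nonneg nn_integral_gauss)
    then show ?thesis by simp
  qed
  finally show ?thesis by (simp add: *)
qed

lemma gauss_weight_tendsto: "(\<lambda>n. gauss_weight (1 / real (Suc n)) x) \<longlonglongrightarrow> 1"
proof -
  have "(\<lambda>n. gauss_weight (1 / real (Suc n)) x) \<longlonglongrightarrow> (\<Prod>b\<in>Basis. exp (- ((0 * (x \<bullet> b))\<^sup>2 / 2)))"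
    unfolding gauss_weight_def by (intro tendsto_intros LIMSEQ_Suc lim_1_over_n) auto
  then show ?thesis by simp
qed

text \<open>The two sides of \<open>ft_regularized\<close> are followed along \<epsilon> = 1 / (n +
  1): integrability of \<open>ft f\<close> controls the damped integrals, continuity and boundedness
  of \<open>f\<close> control the mollifications.\<close>

theorem ft_inversion:
  fixes f :: "'a::euclidean_space \<Rightarrow> complex"
  assumes cont: "continuous_on UNIV f" and bdd: "\<And>x. norm (f x) \<le> B"
    and f: "integrable lborel f" and ft: "integrable lborel (ft f)"
  shows "ft (ft f) (- \<xi>) = (2 * pi) ^ DIM('a) * f \<xi>"
proof (rule LIMSEQ_unique)
  let ?I = "\<lambda>n. LINT x|lborel. gauss_weight (1 / real (Suc n)) x * (iexp (- (x \<bullet> \<xi>)) * ft f x)"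
  have "?I \<longlonglongrightarrow> (LINT x|lborel. iexp (- (x \<bullet> \<xi>)) * ft f x)"
  proof (rule integral_dominated_convergence[where w = "\<lambda>x. norm (ft f x)"])
    show "AE x in lborel. (\<lambda>n. gauss_weight (1 / real (Suc n)) x * (iexp (- (x \<bullet> \<xi>)) * ft f x))
        \<longlonglongrightarrow> iexp (- (x \<bullet> \<xi>)) * ft f x"
    proof (rule AE_I2)
      fix x
      have "(\<lambda>n. complex_of_real (gauss_weight (1 / real (Suc n)) x) * (iexp (- (x \<bullet> \<xi>)) * ft f x))
        \<longlonglongrightarrow> complex_of_real 1 * (iexp (- (x \<bullet> \<xi>)) * ft f x)"
        by (intro tendsto_intros gauss_weight_tendsto)
      then show "(\<lambda>n. complex_of_real (gauss_weight (1 / real (Suc n)) x) * (iexp (- (x \<bullet> \<xi>)) * ft f x))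
        \<longlonglongrightarrow> iexp (- (x \<bullet> \<xi>)) * ft f x" by simp
    qed
  qed (use ft in \<open>auto simp: norm_mult gauss_weight_bounds mult_left_le_one_le\<close>)
  also have "(LINT x|lborel. iexp (- (x \<bullet> \<xi>)) * ft f x) = ft (ft f) (- \<xi>)"
    by (simp add: ft_def[of "ft f"] inner_commute)
  finally show "?I \<longlonglongrightarrow> ft (ft f) (- \<xi>)" .
  have "?I = (\<lambda>n. (2 * pi) ^ DIM('a) * (LINT \<eta>|lborel. f \<eta> * gauss (1 / real (Suc n)) (\<eta> - \<xi>)))"
    by (subst ft_regularized) (use f in auto)
  then show "?I \<longlonglongrightarrow> (2 * pi) ^ DIM('a) * f \<xi>"
    by (simp only:) (intro tendsto_mult_left gauss_mollify_tendsto[OF cont bdd])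
qed

subsection \<open>Plancherel inequality\<close>

lemma integral_norm_bound_nn_integral: "ennreal (norm (integral\<^sup>L M f)) \<le> (\<integral>\<^sup>+x. ennreal (norm (f x)) \<partial>M)"
  by (cases "integrable M f") (auto simp: integral_norm_bound_ennreal not_integrable_integral_eq)

lemma ennreal_mult_le_squares: "ennreal (a * b) \<le> ennreal (a\<^sup>2) / 2 + ennreal (b\<^sup>2) / 2"
proof -
  have "a * b \<le> a\<^sup>2 / 2 + b\<^sup>2 / 2"
    using sum_squares_bound[of a b] by simp
  then have "ennreal (a * b) \<le> ennreal (a\<^sup>2 / 2 + b\<^sup>2 / 2)" by (rule ennreal_leI)
  also have "\<dots> = ennreal (a\<^sup>2) / 2 + ennreal (b\<^sup>2) / 2"
    by (simp add: ennreal_plus flip: divide_ennreal)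
  finally show ?thesis .
qed

lemma nn_integral_gauss_translate:
  assumes "0 < \<epsilon>"
  shows "(\<integral>\<^sup>+x. ennreal (gauss \<epsilon> (x - y :: 'a::euclidean_space)) \<partial>lborel) = 1"
proof -
  have "(\<integral>\<^sup>+x. ennreal (gauss \<epsilon> (x - y)) \<partial>lborel) =
      (\<integral>\<^sup>+x. ennreal (gauss \<epsilon> (x - y)) \<partial>distr lborel borel ((+) y))"
    by (simp add: lborel_distr_plus)
  also have "\<dots> = 1"
    using nn_integral_gauss[OF assms, where 'a = 'a] by (subst nn_integral_distr) auto
  finally show ?thesis .
qed

text \<open>Schur's test in its simplest form: the arithmetic-geometric inequality separates the two
  factors, and the Gaussian has mass 1 in either variable.\<close>

lemma nn_integral_gauss_convolution_le:
  fixes f :: "'a::euclidean_space \<Rightarrow> complex"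
  assumes "0 < \<epsilon>" and [measurable]: "f \<in> borel_measurable borel"
  shows "(\<integral>\<^sup>+\<xi>. \<integral>\<^sup>+\<eta>. ennreal (norm (f \<xi>) * norm (f \<eta>)) * ennreal (gauss \<epsilon> (\<eta> - \<xi>)) \<partial>lborel \<partial>lborel)
     \<le> (\<integral>\<^sup>+\<xi>. ennreal ((norm (f \<xi>))\<^sup>2) \<partial>lborel)"
proof -
  let ?a = "\<lambda>\<xi>. ennreal ((norm (f \<xi>))\<^sup>2) / 2" and ?g = "\<lambda>\<eta> \<xi> :: 'a. ennreal (gauss \<epsilon> (\<eta> - \<xi>))"
  have "(\<integral>\<^sup>+\<xi>. \<integral>\<^sup>+\<eta>. ennreal (norm (f \<xi>) * norm (f \<eta>)) * ?g \<eta> \<xi> \<partial>lborel \<partial>lborel) \<le>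
     (\<integral>\<^sup>+\<xi>. \<integral>\<^sup>+\<eta>. ?a \<xi> * ?g \<eta> \<xi> + ?a \<eta> * ?g \<eta> \<xi> \<partial>lborel \<partial>lborel)"
    unfolding distrib_right[symmetric] by (intro nn_integral_mono mult_right_mono ennreal_mult_le_squares) auto
  also have "\<dots> = (\<integral>\<^sup>+\<xi>. \<integral>\<^sup>+\<eta>. ?a \<xi> * ?g \<eta> \<xi> \<partial>lborel \<partial>lborel) + (\<integral>\<^sup>+\<xi>. \<integral>\<^sup>+\<eta>. ?a \<eta> * ?g \<eta> \<xi> \<partial>lborel \<partial>lborel)"
    by (simp add: nn_integral_add)
  also have "(\<integral>\<^sup>+\<xi>. \<integral>\<^sup>+\<eta>. ?a \<eta> * ?g \<eta> \<xi> \<partial>lborel \<partial>lborel) = (\<integral>\<^sup>+\<eta>. \<integral>\<^sup>+\<xi>. ?a \<eta> * ?g \<eta> \<xi> \<partial>lborel \<partial>lborel)"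
    by (rule lborel_pair.Fubini') measurable
  also have "(\<integral>\<^sup>+\<xi>. \<integral>\<^sup>+\<eta>. ?a \<xi> * ?g \<eta> \<xi> \<partial>lborel \<partial>lborel) = (\<integral>\<^sup>+\<xi>. ?a \<xi> \<partial>lborel)"
    using assms(1) by (simp add: nn_integral_cmult nn_integral_gauss_translate)
  also have "(\<integral>\<^sup>+\<eta>. \<integral>\<^sup>+\<xi>. ?a \<eta> * ?g \<eta> \<xi> \<partial>lborel \<partial>lborel) = (\<integral>\<^sup>+\<eta>. ?a \<eta> \<partial>lborel)"
    using assms(1) by (subst gauss_minus_commute) (simp add: nn_integral_cmult nn_integral_gauss_translate)
  also have "(\<integral>\<^sup>+\<xi>. ?a \<xi> \<partial>lborel) + (\<integral>\<^sup>+\<xi>. ?a \<xi> \<partial>lborel) = (\<integral>\<^sup>+\<xi>. ennreal ((norm (f \<xi>))\<^sup>2) \<partial>lborel)"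
    by (subst nn_integral_add[symmetric])
       (auto simp: ennreal_divide_numeral simp flip: ennreal_plus intro!: nn_integral_cong)
  finally show ?thesis .
qed

text \<open>The square is written as \<open>ft f\<close> times its conjugate and one factor is
  expanded. After Fubini the inner integral is the conjugate of the one in
  \<open>ft_regularized\<close>, that is, a mollification of \<open>f\<close>.\<close>

lemma nn_integral_ft_regularized_le:
  fixes f :: "'a::euclidean_space \<Rightarrow> complex"
  assumes "0 < \<epsilon>" and f: "integrable lborel f"
  shows "(\<integral>\<^sup>+x. ennreal (gauss_weight \<epsilon> x * (norm (ft f x))\<^sup>2) \<partial>lborel)
     \<le> ennreal ((2 * pi) ^ DIM('a)) * (\<integral>\<^sup>+\<xi>. ennreal ((norm (f \<xi>))\<^sup>2) \<partial>lborel)"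
proof -
  let ?w = "\<lambda>x :: 'a. complex_of_real (gauss_weight \<epsilon> x)" and ?c = "(2 * pi) ^ DIM('a)"
  let ?B = "LINT \<xi>|lborel. norm (f \<xi>)"
  have [measurable]: "f \<in> borel_measurable borel" "ft f \<in> borel_measurable borel"
    using f borel_measurable_ft by auto
  have [measurable]: "(\<lambda>x. cnj (ft f x)) \<in> borel_measurable borel"
    by (intro borel_measurable_continuous_onI continuous_on_cnj continuous_ft f)
  have B: "norm (ft f x) \<le> ?B" for x
    by (rule norm_ft_le)
  then have B0: "0 \<le> ?B"
    using norm_ge_zero order_trans by blast
  have int1: "integrable lborel (\<lambda>x. ?w x * cnj (ft f x))"
    by (rule Bochner_Integration.integrable_bound[OF integrable_mult_right[OF integrable_gauss_weight[OF assms(1)], of ?B]])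
       (auto simp: norm_mult gauss_weight_bounds abs_mult B0 mult.commute[of ?B] intro!: mult_left_mono B)
  have int2: "integrable lborel (\<lambda>x. gauss_weight \<epsilon> x * (norm (ft f x))\<^sup>2)"
  proof (rule Bochner_Integration.integrable_bound[OF integrable_mult_right[OF integrable_gauss_weight[OF assms(1)], of "?B\<^sup>2"]])
    show "AE x in lborel. norm (gauss_weight \<epsilon> x * (norm (ft f x))\<^sup>2) \<le> norm (?B\<^sup>2 * gauss_weight \<epsilon> x)"
      by (auto simp: gauss_weight_bounds abs_mult mult.commute[of "?B\<^sup>2"] intro!: mult_left_mono power_mono B)
  qed measurable
  have "complex_of_real (LINT x|lborel. gauss_weight \<epsilon> x * (norm (ft f x))\<^sup>2) =
     (LINT x|lborel. ?w x * cnj (ft f x) * (LINT \<xi>|lborel. f \<xi> * iexp (x \<bullet> \<xi>)))"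
    unfolding integral_complex_of_real[symmetric]
    by (simp only: of_real_mult complex_norm_square mult_ac ft_def)
  also have "\<dots> = (LINT \<xi>|lborel. f \<xi> * (LINT x|lborel. ?w x * cnj (ft f x) * iexp (x \<bullet> \<xi>)))"
    by (rule lborel_Fubini_mult[OF int1 f]) auto
  also have "(\<lambda>\<xi>. LINT x|lborel. ?w x * cnj (ft f x) * iexp (x \<bullet> \<xi>)) =
     (\<lambda>\<xi>. cnj (LINT x|lborel. ?w x * (iexp (- (x \<bullet> \<xi>)) * ft f x)))"
    by (simp add: exp_cnj mult_ac flip: Bochner_Integration.integral_cnj)
  also have "\<dots> = (\<lambda>\<xi>. ?c * cnj (LINT \<eta>|lborel. f \<eta> * gauss \<epsilon> (\<eta> - \<xi>)))"
    unfolding ft_regularized[OF assms] by simp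
  finally have eq: "complex_of_real (LINT x|lborel. gauss_weight \<epsilon> x * (norm (ft f x))\<^sup>2) =
     (LINT \<xi>|lborel. f \<xi> * (?c * cnj (LINT \<eta>|lborel. f \<eta> * gauss \<epsilon> (\<eta> - \<xi>))))" .
  have "(\<integral>\<^sup>+x. ennreal (gauss_weight \<epsilon> x * (norm (ft f x))\<^sup>2) \<partial>lborel) =
     ennreal (LINT x|lborel. gauss_weight \<epsilon> x * (norm (ft f x))\<^sup>2)"
    by (rule nn_integral_eq_integral[OF int2]) (simp add: gauss_weight_bounds)
  also have "\<dots> \<le> ennreal (norm (LINT \<xi>|lborel. f \<xi> * (?c * cnj (LINT \<eta>|lborel. f \<eta> * gauss \<epsilon> (\<eta> - \<xi>)))))"
    unfolding eq[symmetric] by (simp add: ennreal_leI)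
  also have "\<dots> \<le> (\<integral>\<^sup>+\<xi>. ennreal (norm (f \<xi> * (?c * cnj (LINT \<eta>|lborel. f \<eta> * gauss \<epsilon> (\<eta> - \<xi>))))) \<partial>lborel)"
    by (rule integral_norm_bound_nn_integral)
  also have "\<dots> \<le> (\<integral>\<^sup>+\<xi>. ennreal ?c * (\<integral>\<^sup>+\<eta>. ennreal (norm (f \<xi>) * norm (f \<eta>)) * ennreal (gauss \<epsilon> (\<eta> - \<xi>)) \<partial>lborel) \<partial>lborel)"
  proof (rule nn_integral_mono)
    fix \<xi>
    have "ennreal (norm (f \<xi> * (?c * cnj (LINT \<eta>|lborel. f \<eta> * gauss \<epsilon> (\<eta> - \<xi>))))) =
       ennreal ?c * (ennreal (norm (f \<xi>)) * ennreal (norm (LINT \<eta>|lborel. f \<eta> * gauss \<epsilon> (\<eta> - \<xi>))))"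
      by (simp add: norm_mult norm_power power_mult_distrib mult.left_commute ennreal_mult' flip: ennreal_mult')
    also have "ennreal (norm (LINT \<eta>|lborel. f \<eta> * gauss \<epsilon> (\<eta> - \<xi>))) \<le>
       (\<integral>\<^sup>+\<eta>. ennreal (norm (f \<eta> * gauss \<epsilon> (\<eta> - \<xi>))) \<partial>lborel)"
      by (rule integral_norm_bound_nn_integral)
    also have "ennreal (norm (f \<xi>)) * \<dots> = (\<integral>\<^sup>+\<eta>. ennreal (norm (f \<xi>) * norm (f \<eta>)) * ennreal (gauss \<epsilon> (\<eta> - \<xi>)) \<partial>lborel)"
      by (subst nn_integral_cmult[symmetric]) (auto simp: norm_mult gauss_nonneg ennreal_mult' mult.assoc)
    finally show "ennreal (norm (f \<xi> * (?c * cnj (LINT \<eta>|lborel. f \<eta> * gauss \<epsilon> (\<eta> - \<xi>))))) \<le>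
      ennreal ?c * (\<integral>\<^sup>+\<eta>. ennreal (norm (f \<xi>) * norm (f \<eta>)) * ennreal (gauss \<epsilon> (\<eta> - \<xi>)) \<partial>lborel)"
      by (simp add: mult_left_mono)
  qed
  also have "\<dots> = ennreal ?c * (\<integral>\<^sup>+\<xi>. \<integral>\<^sup>+\<eta>. ennreal (norm (f \<xi>) * norm (f \<eta>)) * ennreal (gauss \<epsilon> (\<eta> - \<xi>)) \<partial>lborel \<partial>lborel)"
    by (rule nn_integral_cmult) measurable
  also have "\<dots> \<le> ennreal ?c * (\<integral>\<^sup>+\<xi>. ennreal ((norm (f \<xi>))\<^sup>2) \<partial>lborel)"
    by (intro mult_left_mono nn_integral_gauss_convolution_le assms) auto
  finally show ?thesis .
qed

text \<open>Fatou's lemma removes the Gaussian weight. The inequality is exactly the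
  \<open>L\<^sub>2\<close> continuity that the later limit arguments require.\<close>

theorem Plancherel_le:
  fixes f :: "'a::euclidean_space \<Rightarrow> complex"
  assumes f: "integrable lborel f"
  shows "(\<integral>\<^sup>+x. ennreal ((norm (ft f x))\<^sup>2) \<partial>lborel)
     \<le> ennreal ((2 * pi) ^ DIM('a)) * (\<integral>\<^sup>+\<xi>. ennreal ((norm (f \<xi>))\<^sup>2) \<partial>lborel)"
proof -
  let ?h = "\<lambda>n x. ennreal (gauss_weight (1 / real (Suc n)) x * (norm (ft f x))\<^sup>2)"
  have [measurable]: "ft f \<in> borel_measurable borel"
    using f borel_measurable_ft by auto
  have "liminf (\<lambda>n. ?h n x) = ennreal ((norm (ft f x))\<^sup>2)" for x
  proof (rule lim_imp_Liminf)
    have "(\<lambda>n. ?h n x) \<longlonglongrightarrow> ennreal (1 * (norm (ft f x))\<^sup>2)"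
      by (intro tendsto_intros gauss_weight_tendsto)
    then show "(\<lambda>n. ?h n x) \<longlonglongrightarrow> ennreal ((norm (ft f x))\<^sup>2)" by simp
  qed simp
  then have "(\<integral>\<^sup>+x. ennreal ((norm (ft f x))\<^sup>2) \<partial>lborel) = (\<integral>\<^sup>+x. liminf (\<lambda>n. ?h n x) \<partial>lborel)"
    by simp
  also have "\<dots> \<le> liminf (\<lambda>n. \<integral>\<^sup>+x. ?h n x \<partial>lborel)"
    by (rule nn_integral_liminf) measurable
  also have "\<dots> \<le> liminf (\<lambda>n. ennreal ((2 * pi) ^ DIM('a)) * (\<integral>\<^sup>+\<xi>. ennreal ((norm (f \<xi>))\<^sup>2) \<partial>lborel))"
    by (intro Liminf_mono always_eventually allI nn_integral_ft_regularized_le f) simp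
  finally show ?thesis by (simp add: Liminf_const)
qed

lemma norm_diff_square_le: "(norm (a - b :: complex))\<^sup>2 \<le> 2 * (norm (a - c))\<^sup>2 + 2 * (norm (c - b))\<^sup>2"
proof -
  have "(norm (a - b))\<^sup>2 \<le> (norm (a - c) + norm (c - b))\<^sup>2"
    using norm_triangle_ineq[of "a - c" "c - b"] by (intro power_mono) auto
  also have "\<dots> \<le> 2 * (norm (a - c))\<^sup>2 + 2 * (norm (c - b))\<^sup>2"
    using sum_squares_bound[of "norm (a - c)" "norm (c - b)"] by (simp add: power2_sum)
  finally show ?thesis .
qed

text \<open>Plancherel applies to \<open>G - F n\<close>, and Fatou passes to the limit in
  \<open>n\<close> on the left. This is how a pointwise limit of transforms is recognised as an
  \<open>L\<^sub>2\<close> transform.\<close>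

lemma ft_L2_limit:
  fixes g :: "'a::euclidean_space \<Rightarrow> complex"
  assumes G: "integrable lborel G" and g: "g \<in> borel_measurable borel"
    and F: "\<And>n. integrable lborel (F n)"
    and lim: "(\<lambda>n. \<integral>\<^sup>+x. ennreal ((norm (g x - F n x))\<^sup>2) \<partial>lborel) \<longlonglongrightarrow> 0"
    and v: "\<And>x. (\<lambda>n. ft (F n) x) \<longlonglongrightarrow> v x"
  shows "(\<integral>\<^sup>+x. ennreal ((norm (ft G x - v x))\<^sup>2) \<partial>lborel)
     \<le> ennreal ((2 * pi) ^ DIM('a)) * (2 * (\<integral>\<^sup>+x. ennreal ((norm (G x - g x))\<^sup>2) \<partial>lborel))"
proof -
  let ?c = "ennreal ((2 * pi) ^ DIM('a))"
  have [measurable]: "G \<in> borel_measurable borel" "F n \<in> borel_measurable borel" for n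
    using G F[of n] by auto
  note [measurable] = g
  have [measurable]: "ft (\<lambda>x. G x - F n x) \<in> borel_measurable borel" for n
    using G F[of n] by (intro borel_measurable_ft) auto
  have "liminf (\<lambda>n. ennreal ((norm (ft (\<lambda>x. G x - F n x) x))\<^sup>2)) = ennreal ((norm (ft G x - v x))\<^sup>2)" for x
  proof (rule lim_imp_Liminf)
    show "(\<lambda>n. ennreal ((norm (ft (\<lambda>x. G x - F n x) x))\<^sup>2)) \<longlonglongrightarrow> ennreal ((norm (ft G x - v x))\<^sup>2)"
      by (subst ft_diff[OF G F]) (intro tendsto_intros v)
  qed simp
  then have "(\<integral>\<^sup>+x. ennreal ((norm (ft G x - v x))\<^sup>2) \<partial>lborel) =
      (\<integral>\<^sup>+x. liminf (\<lambda>n. ennreal ((norm (ft (\<lambda>x. G x - F n x) x))\<^sup>2)) \<partial>lborel)"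
    by simp
  also have "\<dots> \<le> liminf (\<lambda>n. \<integral>\<^sup>+x. ennreal ((norm (ft (\<lambda>x. G x - F n x) x))\<^sup>2) \<partial>lborel)"
    by (rule nn_integral_liminf) measurable
  also have "\<dots> \<le> liminf (\<lambda>n. ?c * (2 * (\<integral>\<^sup>+x. ennreal ((norm (G x - g x))\<^sup>2) \<partial>lborel)
        + 2 * (\<integral>\<^sup>+x. ennreal ((norm (g x - F n x))\<^sup>2) \<partial>lborel)))"
  proof (intro Liminf_mono always_eventually allI)
    fix n
    have "(\<integral>\<^sup>+x. ennreal ((norm (ft (\<lambda>x. G x - F n x) x))\<^sup>2) \<partial>lborel) \<le>
       ?c * (\<integral>\<^sup>+x. ennreal ((norm (G x - F n x))\<^sup>2) \<partial>lborel)"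
      using G F[of n] by (intro Plancherel_le) auto
    also have "(\<integral>\<^sup>+x. ennreal ((norm (G x - F n x))\<^sup>2) \<partial>lborel) \<le>
       (\<integral>\<^sup>+x. 2 * ennreal ((norm (G x - g x))\<^sup>2) + 2 * ennreal ((norm (g x - F n x))\<^sup>2) \<partial>lborel)"
    proof (rule nn_integral_mono)
      fix x
      have "ennreal ((norm (G x - F n x))\<^sup>2) \<le> ennreal (2 * (norm (G x - g x))\<^sup>2 + 2 * (norm (g x - F n x))\<^sup>2)"
        by (intro ennreal_leI norm_diff_square_le)
      then show "ennreal ((norm (G x - F n x))\<^sup>2) \<le> 2 * ennreal ((norm (G x - g x))\<^sup>2) + 2 * ennreal ((norm (g x - F n x))\<^sup>2)"
        by (simp add: ennreal_plus ennreal_mult')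
    qed
    also have "\<dots> = 2 * (\<integral>\<^sup>+x. ennreal ((norm (G x - g x))\<^sup>2) \<partial>lborel)
        + 2 * (\<integral>\<^sup>+x. ennreal ((norm (g x - F n x))\<^sup>2) \<partial>lborel)"
      by (simp add: nn_integral_add nn_integral_cmult)
    finally show "(\<integral>\<^sup>+x. ennreal ((norm (ft (\<lambda>x. G x - F n x) x))\<^sup>2) \<partial>lborel) \<le>
       ?c * (2 * (\<integral>\<^sup>+x. ennreal ((norm (G x - g x))\<^sup>2) \<partial>lborel)
        + 2 * (\<integral>\<^sup>+x. ennreal ((norm (g x - F n x))\<^sup>2) \<partial>lborel))"
      by (simp add: mult_left_mono)
  qed
  also have "\<dots> = ?c * (2 * (\<integral>\<^sup>+x. ennreal ((norm (G x - g x))\<^sup>2) \<partial>lborel) + 2 * 0)"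
    by (intro lim_imp_Liminf ennreal_tendsto_cmult tendsto_add tendsto_const lim) auto
  finally show ?thesis by simp
qed

subsection \<open>Fourier multipliers for the supremum norm\<close>

text \<open>For the transform of a finite measure the total variation is an admissible
  \<open>C\<close>. Testing on integrable \<open>W\<close> keeps all transforms pointwise defined;
  measurability and boundedness of \<open>f\<close> keep \<open>f \<xi> * W \<xi>\<close>
  integrable, so that multipliers can be composed.\<close>

definition ft_mult :: "real \<Rightarrow> ('a::euclidean_space \<Rightarrow> complex) \<Rightarrow> bool" where
  "ft_mult C f \<longleftrightarrow> f \<in> borel_measurable borel \<and> bounded (range f) \<and>
     (\<forall>W B. integrable lborel W \<longrightarrow> (\<forall>x. norm (ft W x) \<le> B) \<longrightarrow>
        (\<forall>x. norm (ft (\<lambda>\<xi>. f \<xi> * W \<xi>) x) \<le> C * B))"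

lemma ft_multD:
  "ft_mult C f \<Longrightarrow> integrable lborel W \<Longrightarrow> (\<And>x. norm (ft W x) \<le> B) \<Longrightarrow>
     norm (ft (\<lambda>\<xi>. f \<xi> * W \<xi>) x) \<le> C * B"
  by (auto simp: ft_mult_def)

lemma integrable_bounded_mult:
  fixes f :: "'a::euclidean_space \<Rightarrow> complex"
  assumes f: "f \<in> borel_measurable borel" "bounded (range f)" and W: "integrable lborel W"
  shows "integrable lborel (\<lambda>\<xi>. f \<xi> * W \<xi>)"
proof -
  obtain B where B: "norm (f \<xi>) \<le> B" for \<xi>
    using f(2) by (auto simp: bounded_iff)
  show ?thesis
  proof (rule Bochner_Integration.integrable_bound)
    show "integrable lborel (\<lambda>\<xi>. B * norm (W \<xi>))"
      using W by simp
    show "AE \<xi> in lborel. norm (f \<xi> * W \<xi>) \<le> norm (B * norm (W \<xi>))"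
      using B by (auto simp: norm_mult abs_mult intro!: mult_right_mono order_trans[OF B] )
  qed (use f W in auto)
qed

lemma ft_mult_integrable:
  "ft_mult C f \<Longrightarrow> integrable lborel W \<Longrightarrow> integrable lborel (\<lambda>\<xi>. f \<xi> * W \<xi>)"
  unfolding ft_mult_def by (intro integrable_bounded_mult) auto

lemma ft_mult_const: "ft_mult (norm c) (\<lambda>_. c)"
  by (auto simp: ft_mult_def ft_cmult norm_mult intro: mult_left_mono)

lemma ft_mult_mult:
  assumes "ft_mult C f" "ft_mult D g"
  shows "ft_mult (C * D) (\<lambda>\<xi>. f \<xi> * g \<xi>)"
proof -
  obtain K L where "norm (f \<xi>) \<le> K" "norm (g \<xi>) \<le> L" for \<xi>
    using assms by (auto simp: ft_mult_def bounded_iff)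
  then have "norm (f \<xi> * g \<xi>) \<le> K * L" for \<xi>
    unfolding norm_mult by (intro mult_mono) (auto intro: order_trans[OF norm_ge_zero])
  moreover have "norm (ft (\<lambda>\<xi>. f \<xi> * g \<xi> * W \<xi>) x) \<le> C * D * B"
    if "integrable lborel W" "\<And>x. norm (ft W x) \<le> B" for W B x
    using ft_multD[OF assms(1) ft_mult_integrable[OF assms(2) that(1)] ft_multD[OF assms(2) that]]
    by (simp add: mult.assoc)
  ultimately show ?thesis
    using assms by (auto simp: ft_mult_def bounded_iff)
qed

lemma ft_mult_add:
  assumes "ft_mult C f" "ft_mult D g"
  shows "ft_mult (C + D) (\<lambda>\<xi>. f \<xi> + g \<xi>)"
proof -
  obtain K L where "norm (f \<xi>) \<le> K" "norm (g \<xi>) \<le> L" for \<xi>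
    using assms by (auto simp: ft_mult_def bounded_iff)
  then have "norm (f \<xi> + g \<xi>) \<le> K + L" for \<xi>
    by (rule norm_triangle_mono)
  moreover have "norm (ft (\<lambda>\<xi>. (f \<xi> + g \<xi>) * W \<xi>) x) \<le> (C + D) * B"
    if "integrable lborel W" "\<And>x. norm (ft W x) \<le> B" for W B x
    unfolding ring_distribs
    by (subst ft_add[OF ft_mult_integrable[OF assms(1) that(1)] ft_mult_integrable[OF assms(2) that(1)]])
       (intro norm_triangle_mono ft_multD[OF assms(1) that] ft_multD[OF assms(2) that])
  ultimately show ?thesis
    using assms by (auto simp: ft_mult_def bounded_iff)
qed

lemma ft_mult_cmult: "ft_mult C f \<Longrightarrow> ft_mult (norm c * C) (\<lambda>\<xi>. c * f \<xi>)"
  by (rule ft_mult_mult[OF ft_mult_const])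

lemma ft_mult_diff:
  assumes "ft_mult C f" "ft_mult D g"
  shows "ft_mult (C + D) (\<lambda>\<xi>. f \<xi> - g \<xi>)"
  using ft_mult_add[OF assms(1) ft_mult_cmult[OF assms(2), of "-1"]] by simp

lemma ft_mult_sum:
  assumes "finite I" "\<And>i. i \<in> I \<Longrightarrow> ft_mult (C i) (f i)"
  shows "ft_mult (\<Sum>i\<in>I. C i) (\<lambda>\<xi>. \<Sum>i\<in>I. f i \<xi>)"
  using assms
proof (induction I rule: finite_induct)
  case empty
  then show ?case using ft_mult_const[of 0] by simp
qed (simp add: ft_mult_add)

lemma ft_mult_prod:
  assumes "finite I" "\<And>i. i \<in> I \<Longrightarrow> ft_mult (C i) (f i)"
  shows "ft_mult (\<Prod>i\<in>I. C i) (\<lambda>\<xi>. \<Prod>i\<in>I. f i \<xi>)"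
  using assms
proof (induction I rule: finite_induct)
  case empty
  then show ?case using ft_mult_const[of 1] by simp
qed (simp add: ft_mult_mult)

text \<open>Multiplication by the Fourier transform of an \<open>L\<^sub>1\<close> function of one linear form averages translates.\<close>

lemma ft_mult_ft:
  fixes g :: "real \<Rightarrow> complex" and b :: "'a::euclidean_space"
  assumes g: "integrable lborel g"
  shows "ft_mult (LINT s|lborel. norm (g s)) (\<lambda>\<xi>. ft g (\<xi> \<bullet> b + a))"
proof -
  have [measurable]: "ft g \<in> borel_measurable borel"
    by (rule borel_measurable_ft[OF g])
  have "norm (ft (\<lambda>\<xi>. ft g (\<xi> \<bullet> b + a) * W \<xi>) x) \<le> (LINT s|lborel. norm (g s)) * B"
    if W: "integrable lborel W" and B: "\<And>x. norm (ft W x) \<le> B" for W B x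
  proof -
    have "ft (\<lambda>\<xi>. ft g (\<xi> \<bullet> b + a) * W \<xi>) x =
       (LINT \<xi>|lborel. W \<xi> * (LINT s|lborel. g s * iexp ((\<xi> \<bullet> b + a) * s + x \<bullet> \<xi>)))"
      unfolding ft_def
    proof (rule Bochner_Integration.integral_cong[OF refl])
      fix \<xi>
      have "iexp (x \<bullet> \<xi>) * (LINT s|lborel. iexp ((\<xi> \<bullet> b + a) \<bullet> s) * g s) =
         (LINT s|lborel. g s * iexp ((\<xi> \<bullet> b + a) * s + x \<bullet> \<xi>))"
        by (subst integral_mult_right_zero[symmetric]) (simp add: distrib_left exp_add mult_ac)
      then show "iexp (x \<bullet> \<xi>) * ((LINT s|lborel. iexp ((\<xi> \<bullet> b + a) \<bullet> s) * g s) * W \<xi>) =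
         W \<xi> * (LINT s|lborel. g s * iexp ((\<xi> \<bullet> b + a) * s + x \<bullet> \<xi>))"
        by (simp add: mult_ac)
    qed
    also have "\<dots> = (LINT s|lborel. g s * (LINT \<xi>|lborel. W \<xi> * iexp ((\<xi> \<bullet> b + a) * s + x \<bullet> \<xi>)))"
    proof (rule lborel_Fubini_mult[OF W g])
      show "(\<lambda>(\<xi>, s). iexp ((\<xi> \<bullet> b + a) * s + x \<bullet> \<xi>)) \<in> borel_measurable (lborel \<Otimes>\<^sub>M lborel)"
        unfolding split_beta' by measurable
    qed (simp only: norm_exp_i_times order_refl)
    also have "(\<lambda>s. LINT \<xi>|lborel. W \<xi> * iexp ((\<xi> \<bullet> b + a) * s + x \<bullet> \<xi>)) = (\<lambda>s. iexp (a * s) * ft W (x + s *\<^sub>R b))"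
      unfolding ft_def
      by (subst integral_mult_right_zero[symmetric])
         (auto simp: inner_add_left inner_commute[of b] ring_distribs exp_add mult_ac)
    finally have eq: "ft (\<lambda>\<xi>. ft g (\<xi> \<bullet> b + a) * W \<xi>) x = (LINT s|lborel. g s * (iexp (a * s) * ft W (x + s *\<^sub>R b)))" .
    have "norm (ft (\<lambda>\<xi>. ft g (\<xi> \<bullet> b + a) * W \<xi>) x) \<le> (LINT s|lborel. norm (g s) * B)"
      unfolding eq
    proof (rule Bochner_Integration.integral_norm_bound_integral)
      have [measurable]: "ft W \<in> borel_measurable borel"
        by (rule borel_measurable_ft[OF W])
      show "integrable lborel (\<lambda>s. g s * (iexp (a * s) * ft W (x + s *\<^sub>R b)))"
      proof (rule Bochner_Integration.integrable_bound)
        show "AE s in lborel. norm (g s * (iexp (a * s) * ft W (x + s *\<^sub>R b))) \<le> norm (norm (g s) * B)"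
          using B by (auto simp: norm_mult abs_mult intro!: mult_left_mono order_trans[OF B])
      qed (use g in auto)
    qed (use g B in \<open>auto simp: norm_mult intro!: mult_left_mono\<close>)
    then show ?thesis by simp
  qed
  moreover have "bounded (range (\<lambda>\<xi>. ft g (\<xi> \<bullet> b + a)))"
    using norm_ft_le[of g] by (auto simp: bounded_iff)
  ultimately show ?thesis
    by (simp add: ft_mult_def)
qed

section \<open>Tent functions and the Fejer kernel\<close>

definition tent :: "real \<Rightarrow> real" where
  "tent t = max 0 (1 - \<bar>t\<bar>)"

lemma tent_bounds: "0 \<le> tent t" "tent t \<le> 1"
  by (auto simp: tent_def)

lemma continuous_on_tent: "continuous_on S tent"
  unfolding tent_def[abs_def] by (intro continuous_intros)

lemma borel_measurable_tent[measurable]: "tent \<in> borel_measurable borel"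
  by (intro borel_measurable_continuous_onI continuous_on_tent)

lemma integrable_tent: "integrable lborel tent"
proof (rule Bochner_Integration.integrable_bound)
  show "integrable lborel (indicator {-1..1} :: real \<Rightarrow> real)" by simp
  show "AE t in lborel. norm (tent t) \<le> norm (indicator {-1..1} t :: real)"
    by (auto simp: tent_def indicator_def)
qed simp

lemma ft_tent:
  assumes "s \<noteq> 0"
  shows "ft (\<lambda>t. complex_of_real (tent t)) s = complex_of_real (2 * (1 - cos s) / s\<^sup>2)"
proof -
  let ?a = "\<i> * complex_of_real s"
  \<comment> \<open>\<open>F\<close> and \<open>G\<close> are antiderivatives of the integrand on
    the two linear pieces of the tent, obtained by partial integration.\<close>
  define F where "F t = exp (?a * complex_of_real t) * ((1 - complex_of_real t) / ?a + 1 / ?a\<^sup>2)" for t :: real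
  define G where "G t = exp (?a * complex_of_real t) * ((1 + complex_of_real t) / ?a - 1 / ?a\<^sup>2)" for t :: real
  have a: "?a \<noteq> 0" using assms by simp
  have F: "(F has_vector_derivative exp (?a * t) * (1 - t)) (at t within S)" for t S
  proof -
    have "((\<lambda>z. exp (?a * z) * ((1 - z) / ?a + 1 / ?a\<^sup>2)) has_field_derivative exp (?a * t) * (1 - t)) (at (complex_of_real t))"
      using a by (auto intro!: derivative_eq_intros simp: field_simps power2_eq_square)
    from has_vector_derivative_real_field[OF this] show ?thesis
      by (simp add: F_def[abs_def] comp_def has_vector_derivative_at_within)
  qed
  have G: "(G has_vector_derivative exp (?a * t) * (1 + t)) (at t within S)" for t S
  proof -
    have "((\<lambda>z. exp (?a * z) * ((1 + z) / ?a - 1 / ?a\<^sup>2)) has_field_derivative exp (?a * t) * (1 + t)) (at (complex_of_real t))"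
      using a by (auto intro!: derivative_eq_intros simp: field_simps power2_eq_square)
    from has_vector_derivative_real_field[OF this] show ?thesis
      by (simp add: G_def[abs_def] comp_def has_vector_derivative_at_within)
  qed
  have 1: "has_bochner_integral lborel (\<lambda>t. indicator {0..1} t *\<^sub>R (exp (?a * of_real t) * (1 - of_real t))) (F 1 - F 0)"
    by (rule has_bochner_integral_FTC_Icc[OF _ F]) (auto intro!: continuous_intros)
  have 2: "has_bochner_integral lborel (\<lambda>t. indicator {-1..0} t *\<^sub>R (exp (?a * of_real t) * (1 + of_real t))) (G 0 - G (-1))"
    by (rule has_bochner_integral_FTC_Icc[OF _ G]) (auto intro!: continuous_intros)
  have "AE t in lborel. (t :: real) \<noteq> 0"
    by (rule AE_lborel_singleton)
  then have "ft (\<lambda>t. complex_of_real (tent t)) s =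
     (LINT t|lborel. indicator {0..1} t *\<^sub>R (exp (?a * of_real t) * (1 - of_real t)) + indicator {-1..0} t *\<^sub>R (exp (?a * of_real t) * (1 + of_real t)))"
    unfolding ft_def by (intro integral_cong_AE) (auto simp: tent_def indicator_def mult.assoc)
  also have "\<dots> = (F 1 - F 0) + (G 0 - G (-1))"
    using has_bochner_integral_add[OF 1 2] by (rule has_bochner_integral_integral_eq)
  also have "\<dots> = complex_of_real (2 * (1 - cos s) / s\<^sup>2)"
    using assms by (simp add: F_def G_def exp_minus field_simps cos_exp_eq power2_eq_square cos_of_real[symmetric])
  finally show ?thesis .
qed

lemma integrable_ft_tent: "integrable lborel (ft (\<lambda>t. complex_of_real (tent t)))"
proof (rule Bochner_Integration.integrable_bound)
  let ?f = "ft (\<lambda>t. complex_of_real (tent t))" and ?K = "LINT t|lborel. norm (complex_of_real (tent t))"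
  show "?f \<in> borel_measurable lborel"
    using borel_measurable_ft[OF integrable_of_real[OF integrable_tent]] by simp
  \<comment> \<open>The majorant adds two bounds: the transform is at most \<open>?K\<close>
    everywhere, and its product with the square of \<open>s\<close> is at most 4 by the closed
    formula.\<close>
  show "integrable lborel (\<lambda>s. (?K + 4) * inverse (1 + s\<^sup>2))"
    using integrable_inverse_1_plus_square
    by (intro integrable_mult_right) (simp add: set_integrable_def)
  show "AE s in lborel. norm (?f s) \<le> norm ((?K + 4) * inverse (1 + s\<^sup>2))"
  proof (rule AE_I2)
    fix s :: real
    have K: "norm (?f s) \<le> ?K" by (rule norm_ft_le)
    have "s\<^sup>2 * norm (?f s) \<le> 4"
    proof (cases "s = 0")
      case False
      then have "norm (?f s) = \<bar>2 * (1 - cos s) / s\<^sup>2\<bar>"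
        by (simp only: ft_tent[OF False] norm_of_real)
      also have "\<dots> \<le> 4 / s\<^sup>2"
      proof -
        have "\<bar>2 * (1 - c)\<bar> \<le> 4" if "- 1 \<le> c" "c \<le> 1" for c :: real
          using that by simp
        from this[of "cos s"] have "\<bar>2 * (1 - cos s)\<bar> \<le> 4"
          by (simp only: cos_ge_minus_one cos_le_one)
        then show ?thesis by (simp only: abs_divide abs_power2 divide_right_mono zero_le_power2)
      qed
      finally show ?thesis using False by (simp add: field_simps)
    qed simp
    with K have "norm (?f s) * (1 + s\<^sup>2) \<le> ?K + 4"
      by (simp add: algebra_simps)
    moreover have "0 < 1 + s\<^sup>2"
      by (simp add: add_pos_nonneg)
    moreover have "0 \<le> ?K" by simp
    ultimately show "norm (?f s) \<le> norm ((?K + 4) * inverse (1 + s\<^sup>2))"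
      by (simp add: field_simps abs_mult)
  qed
qed

text \<open>By inversion \<open>tent\<close> is the transform of the normalised Fejer kernel. That
  kernel is nonnegative, so its \<open>L\<^sub>1\<close> norm equals its integral, which is the
  value of \<open>tent\<close> at 0.\<close>

lemma ft_mult_tent:
  fixes b :: "'a::euclidean_space"
  shows "ft_mult 1 (\<lambda>\<xi>. complex_of_real (tent (\<xi> \<bullet> b + a)))"
proof -
  let ?f = "ft (\<lambda>t. complex_of_real (tent t))"
  define g where "g s = complex_of_real (1 / (2 * pi)) * ?f s" for s
  have g: "integrable lborel g"
    unfolding g_def using integrable_ft_tent by simp
  have inv: "ft g (- t) = tent t" for t
  proof -
    have "ft ?f (- t) = (2 * pi) ^ DIM(real) * complex_of_real (tent t)"
      by (rule ft_inversion[where B = 1])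
         (auto simp: tent_bounds integrable_ft_tent integrable_tent intro!: continuous_intros continuous_on_tent)
    moreover have "ft g (- t) = complex_of_real (1 / (2 * pi)) * ft ?f (- t)"
      unfolding g_def by (rule ft_cmult)
    ultimately show ?thesis by simp
  qed
  have "AE s in lborel. (s :: real) \<noteq> 0"
    by (rule AE_lborel_singleton)
  then have "AE s in lborel. complex_of_real (norm (g s)) = g s"
  proof eventually_elim
    case (elim s)
    have "g s = complex_of_real (1 / (2 * pi) * (2 * (1 - cos s) / s\<^sup>2))"
      unfolding g_def ft_tent[OF elim] of_real_mult ..
    moreover have "0 \<le> 1 / (2 * pi) * (2 * (1 - cos s) / s\<^sup>2)"
      using cos_le_one[of s] by (intro mult_nonneg_nonneg divide_nonneg_nonneg) auto
    ultimately show ?case by (simp only: norm_of_real abs_of_nonneg)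
  qed
  then have "(LINT s|lborel. complex_of_real (norm (g s))) = (LINT s|lborel. g s)"
    using g by (intro integral_cong_AE) auto
  also have "\<dots> = ft g (- 0)"
    by (simp add: ft_def)
  also have "\<dots> = 1"
    unfolding inv by (simp add: tent_def)
  finally have "(LINT s|lborel. norm (g s)) = 1"
    by simp
  \<comment> \<open>Inversion produces \<open>tent t\<close> at the argument \<open>- t\<close>, so
    \<open>ft_mult_ft\<close> is applied to the negated affine form.\<close>
  moreover have "ft g (\<xi> \<bullet> (- b) + (- a)) = tent (\<xi> \<bullet> b + a)" for \<xi>
    using inv[of "\<xi> \<bullet> b + a"] by (simp add: algebra_simps)
  ultimately show ?thesis
    using ft_mult_ft[OF g, of "- b" "- a"] by simp
qed

text \<open>The two scaled tents have half-width R and are centred at R and at -R; the first carries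
  the positive half of the identity function, the second the negative half. On a bounded frequency
  range, differentiation is thus a multiplier of norm at most 2 R.\<close>

lemma tent_saw:
  assumes "0 < R" "\<bar>t\<bar> \<le> R"
  shows "R * tent (t / R - 1) - R * tent (t / R + 1) = t"
proof -
  have "\<bar>t / R\<bar> \<le> 1" using assms by simp
  then have "tent (t / R - 1) - tent (t / R + 1) = t / R"
    unfolding tent_def by linarith
  then show ?thesis using assms by (simp flip: right_diff_distrib)
qed

lemma Bernstein_step:
  fixes V :: "'a::euclidean_space \<Rightarrow> complex"
  assumes "0 < R" and V: "integrable lborel V" and supp: "\<And>\<xi>. V \<xi> \<noteq> 0 \<Longrightarrow> \<bar>\<xi> \<bullet> b\<bar> \<le> R"
  shows "integrable lborel (\<lambda>\<xi>. (\<i> * (\<xi> \<bullet> b)) * V \<xi>)"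
    and "(\<And>x. norm (ft V x) \<le> B) \<Longrightarrow> norm (ft (\<lambda>\<xi>. (\<i> * (\<xi> \<bullet> b)) * V \<xi>) x) \<le> 2 * R * B"
proof -
  define f where "f \<xi> = \<i> * R * complex_of_real (tent (\<xi> \<bullet> (b /\<^sub>R R) + (-1))) -
     \<i> * R * complex_of_real (tent (\<xi> \<bullet> (b /\<^sub>R R) + 1))" for \<xi> :: 'a
  have f: "ft_mult (norm (\<i> * R) * 1 + norm (\<i> * R) * 1) f"
    unfolding f_def by (intro ft_mult_diff ft_mult_cmult ft_mult_tent)
  have eq: "(\<lambda>\<xi>. (\<i> * (\<xi> \<bullet> b)) * V \<xi>) = (\<lambda>\<xi>. f \<xi> * V \<xi>)"
  proof
    fix \<xi>
    show "(\<i> * (\<xi> \<bullet> b)) * V \<xi> = f \<xi> * V \<xi>"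
    proof (cases "V \<xi> = 0")
      case False
      have "f \<xi> = \<i> * complex_of_real (R * tent (\<xi> \<bullet> b / R - 1) - R * tent (\<xi> \<bullet> b / R + 1))"
        by (simp add: f_def ring_distribs divide_inverse mult_ac)
      then show ?thesis
        using tent_saw[OF assms(1) supp[OF False]] by simp
    qed simp
  qed
  show "integrable lborel (\<lambda>\<xi>. (\<i> * (\<xi> \<bullet> b)) * V \<xi>)"
    unfolding eq by (rule ft_mult_integrable[OF f V])
  show "norm (ft (\<lambda>\<xi>. (\<i> * (\<xi> \<bullet> b)) * V \<xi>) x) \<le> 2 * R * B" if "\<And>x. norm (ft V x) \<le> B"
    unfolding eq using ft_multD[OF f V that, of x] assms(1) by (simp add: norm_mult)
qed

text \<open>Multiplying by the linear form does not enlarge the support, so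
  \<open>Bernstein_step\<close> iterates with the same \<open>R\<close>. The sharp constant is R per
  derivative; the sawtooth costs a harmless factor 2.\<close>

lemma Bernstein:
  fixes V :: "'a::euclidean_space \<Rightarrow> complex"
  assumes "0 < R" and V: "integrable lborel V" and supp: "\<And>\<xi>. V \<xi> \<noteq> 0 \<Longrightarrow> \<bar>\<xi> \<bullet> b\<bar> \<le> R"
  shows "integrable lborel (\<lambda>\<xi>. (\<i> * (\<xi> \<bullet> b)) ^ r * V \<xi>) \<and>
     ((\<forall>x. norm (ft V x) \<le> B) \<longrightarrow> (\<forall>x. norm (ft (\<lambda>\<xi>. (\<i> * (\<xi> \<bullet> b)) ^ r * V \<xi>) x) \<le> (2 * R) ^ r * B))"
proof (induction r)
  case (Suc r)
  let ?V = "\<lambda>\<xi>. (\<i> * (\<xi> \<bullet> b)) ^ r * V \<xi>"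
  have supp': "?V \<xi> \<noteq> 0 \<Longrightarrow> \<bar>\<xi> \<bullet> b\<bar> \<le> R" for \<xi>
    using supp by auto
  have I: "integrable lborel ?V"
    using Suc by blast
  have eq: "(\<lambda>\<xi>. (\<i> * (\<xi> \<bullet> b)) ^ Suc r * V \<xi>) = (\<lambda>\<xi>. (\<i> * (\<xi> \<bullet> b)) * ?V \<xi>)"
    by (simp add: mult.assoc)
  have "norm (ft (\<lambda>\<xi>. (\<i> * (\<xi> \<bullet> b)) * ?V \<xi>) x) \<le> (2 * R) ^ Suc r * B" if "\<forall>x. norm (ft V x) \<le> B" for x
    using Bernstein_step(2)[OF assms(1) I supp', of "(2 * R) ^ r * B" x] Suc that by (simp add: mult.assoc)
  moreover have "integrable lborel (\<lambda>\<xi>. (\<i> * (\<xi> \<bullet> b)) * ?V \<xi>)"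
    by (rule Bernstein_step(1)[OF assms(1) I supp'])
  ultimately show ?case unfolding eq by blast
qed (use V in simp)

text \<open>The error of the linear approximation is the second-order remainder of the exponential,
  and the bound \<open>R\<close> on the frequencies in direction \<open>b\<close> makes it quadratic
  in \<open>u - t\<close> uniformly in \<xi>.\<close>

lemma ft_has_vector_derivative:
  fixes V :: "'a::euclidean_space \<Rightarrow> complex"
  assumes "0 < R" and V: "integrable lborel V" and supp: "\<And>\<xi>. V \<xi> \<noteq> 0 \<Longrightarrow> \<bar>\<xi> \<bullet> b\<bar> \<le> R"
  shows "((\<lambda>t. ft V (x + t *\<^sub>R b)) has_vector_derivative ft (\<lambda>\<xi>. (\<i> * (\<xi> \<bullet> b)) * V \<xi>) (x + t *\<^sub>R b)) (at t)"
  unfolding has_vector_derivative_def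
proof (rule has_derivativeI_sandwich[of 1])
  let ?W = "\<lambda>\<xi>. (\<i> * (\<xi> \<bullet> b)) * V \<xi>"
  let ?K = "R\<^sup>2 * (LINT \<xi>|lborel. norm (V \<xi>))"
  have W: "integrable lborel ?W"
    by (rule Bernstein_step[OF assms])
  show "norm (ft V (x + u *\<^sub>R b) - ft V (x + t *\<^sub>R b) - (u - t) *\<^sub>R ft ?W (x + t *\<^sub>R b)) / norm (u - t) \<le> ?K * \<bar>u - t\<bar>"
    if "u \<noteq> t" for u
  proof -
    have lin: "(LINT \<xi>|lborel. f \<xi> - g \<xi> - c *\<^sub>R h \<xi>) = (LINT \<xi>|lborel. f \<xi>) - (LINT \<xi>|lborel. g \<xi>) - c *\<^sub>R (LINT \<xi>|lborel. h \<xi>)"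
      if "integrable lborel f" "integrable lborel g" "integrable lborel h" for f g h :: "'a \<Rightarrow> complex" and c
      by (simp add: that)
    have "ft V (x + u *\<^sub>R b) - ft V (x + t *\<^sub>R b) - (u - t) *\<^sub>R ft ?W (x + t *\<^sub>R b) =
      (LINT \<xi>|lborel. iexp ((x + u *\<^sub>R b) \<bullet> \<xi>) * V \<xi> - iexp ((x + t *\<^sub>R b) \<bullet> \<xi>) * V \<xi> - (u - t) *\<^sub>R (iexp ((x + t *\<^sub>R b) \<bullet> \<xi>) * ?W \<xi>))"
      unfolding ft_def by (rule lin[symmetric]) (intro integrable_iexp_mult V W)+
    also have "norm \<dots> \<le> (LINT \<xi>|lborel. (\<bar>u - t\<bar> * R)\<^sup>2 * norm (V \<xi>))"
    proof (rule Bochner_Integration.integral_norm_bound_integral)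
      fix \<xi>
      let ?d = "(u - t) * (\<xi> \<bullet> b)"
      have "iexp ((x + u *\<^sub>R b) \<bullet> \<xi>) = iexp ((x + t *\<^sub>R b) \<bullet> \<xi>) * iexp ?d"
        by (simp add: exp_add[symmetric] algebra_simps inner_commute[of b])
      then have "iexp ((x + u *\<^sub>R b) \<bullet> \<xi>) * V \<xi> - iexp ((x + t *\<^sub>R b) \<bullet> \<xi>) * V \<xi> - (u - t) *\<^sub>R (iexp ((x + t *\<^sub>R b) \<bullet> \<xi>) * ?W \<xi>) =
         iexp ((x + t *\<^sub>R b) \<bullet> \<xi>) * V \<xi> * (iexp ?d - (1 + \<i> * ?d))"
        by (simp add: algebra_simps scaleR_conv_of_real)
      also have "norm \<dots> = norm (V \<xi>) * norm (iexp ?d - (1 + \<i> * ?d))"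
        by (simp add: norm_mult)
      also have "\<dots> \<le> norm (V \<xi>) * (\<bar>u - t\<bar> * R)\<^sup>2"
      proof (cases "V \<xi> = 0")
        case False
        have "norm (iexp ?d - (1 + \<i> * ?d)) \<le> \<bar>?d\<bar>\<^sup>2 / 2"
          using iexp_approx1[of ?d 1] by (simp add: power2_eq_square)
        also have "\<dots> \<le> \<bar>?d\<bar>\<^sup>2" by simp
        also have "\<bar>?d\<bar>\<^sup>2 \<le> (\<bar>u - t\<bar> * R)\<^sup>2"
          unfolding abs_mult using supp[OF False] by (intro power_mono mult_left_mono) auto
        finally show ?thesis by (intro mult_left_mono) auto
      qed simp
      finally show "norm (iexp ((x + u *\<^sub>R b) \<bullet> \<xi>) * V \<xi> - iexp ((x + t *\<^sub>R b) \<bullet> \<xi>) * V \<xi> - (u - t) *\<^sub>R (iexp ((x + t *\<^sub>R b) \<bullet> \<xi>) * ?W \<xi>))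
        \<le> (\<bar>u - t\<bar> * R)\<^sup>2 * norm (V \<xi>)"
        by (simp add: mult.commute)
    qed (use V W in \<open>auto intro!: Bochner_Integration.integrable_diff integrable_scaleR_right integrable_iexp_mult\<close>)
    also have "\<dots> = ?K * \<bar>u - t\<bar> * \<bar>u - t\<bar>"
      by (simp add: power2_eq_square)
    finally show ?thesis
      using that by (simp add: field_simps)
  qed
  have "((\<lambda>u. ?K * \<bar>u - t\<bar>) \<longlongrightarrow> ?K * \<bar>t - t\<bar>) (at t)"
    by (intro tendsto_intros)
  then show "((\<lambda>u. ?K * \<bar>u - t\<bar>) \<longlongrightarrow> 0) (at t)" by simp
qed (auto intro: bounded_linear_scaleR_left)

subsection \<open>An anisotropic dyadic partition of unity\<close>

text \<open>A vector \<open>s\<close> of exponents treats all coordinates alike, so partition and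
  summation never distinguish \<open>p\<close> and \<open>q\<close>; \<open>dscale\<close> recovers
  \<open>dil\<close> and \<open>rho\<close>. The reciprocals in \<open>arho\<close> make it
  homogeneous of degree 1 under \<open>adil s\<close>.\<close>

definition adil :: "('n::finite \<Rightarrow> real) \<Rightarrow> int \<Rightarrow> real ^ 'n \<Rightarrow> real ^ 'n" where
  "adil s j x = (\<chi> i. 2 powr (j * s i) * x $ i)"

definition arho :: "('n::finite \<Rightarrow> real) \<Rightarrow> real ^ 'n \<Rightarrow> real" where
  "arho s x = (\<Sum>i\<in>UNIV. \<bar>x $ i\<bar> powr (1 / s i))"

lemma adil_nth [simp]: "adil s j x $ i = 2 powr (j * s i) * x $ i"
  by (simp add: adil_def)

lemma adil_adil [simp]: "adil s j (adil s k x) = adil s (j + k) x"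
  by (simp add: vec_eq_iff powr_add ring_distribs)

lemma adil_0 [simp]: "adil s 0 x = x"
  by (simp add: vec_eq_iff)

lemma continuous_on_adil: "continuous_on S (adil s j)"
  unfolding adil_def by (intro continuous_intros)

lemma borel_measurable_adil [measurable]: "adil s j \<in> borel_measurable borel"
  by (intro borel_measurable_continuous_onI continuous_on_adil)

lemma continuous_on_arho:
  assumes "\<And>i. 0 < s i" shows "continuous_on S (arho s)"
  unfolding arho_def by (intro continuous_intros continuous_on_powr') (use assms in auto)

lemma arho_nonneg: "0 \<le> arho s x"
  by (simp add: arho_def sum_nonneg)

lemma arho_adil:
  assumes "\<And>i. 0 < s i"
  shows "arho s (adil s j x) = 2 powr j * arho s x"
  using assms unfolding arho_def sum_distrib_left
  by (intro sum.cong refl) (simp add: abs_mult powr_mult powr_powr less_imp_neq[symmetric])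

lemma tent_partition:
  fixes K :: int and t :: real
  assumes "\<bar>t\<bar> \<le> K"
  shows "(\<Sum>k\<in>{- K..K}. tent (t - real_of_int k)) = 1"
proof -
  \<comment> \<open>The index K + 1 adds a zero term only; it makes room for the integer after the
    floor of \<open>t\<close> when t = K.\<close>
  have "(\<Sum>k\<in>{- K..K}. tent (t - real_of_int k)) = (\<Sum>k\<in>{- K..K + 1}. tent (t - real_of_int k))"
    using assms by (intro sum.mono_neutral_left) (auto simp: tent_def)
  also have "\<dots> = (\<Sum>k\<in>{\<lfloor>t\<rfloor>, \<lfloor>t\<rfloor> + 1}. tent (t - real_of_int k))"
  proof (intro sum.mono_neutral_right ballI)
    show "{\<lfloor>t\<rfloor>, \<lfloor>t\<rfloor> + 1} \<subseteq> {- K..K + 1}"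
      using assms by (auto; linarith)
    fix k assume "k \<in> {- K..K + 1} - {\<lfloor>t\<rfloor>, \<lfloor>t\<rfloor> + 1}"
    then have "k \<le> \<lfloor>t\<rfloor> - 1 \<or> \<lfloor>t\<rfloor> + 2 \<le> k" by auto
    then have "1 \<le> \<bar>t - k\<bar>" by linarith
    then show "tent (t - real_of_int k) = 0" by (simp add: tent_def)
  qed simp
  also have "\<dots> = 1"
    using floor_correct[of t] by (simp add: tent_def) linarith
  finally show ?thesis .
qed

text \<open>A trapezoid, equal to 1 on [-1, 1] and to 0 outside (-2, 2). Being a sum of three tents
  it has multiplier norm at most 3, the origin of the powers of 3 in later constants.\<close>

definition plateau :: "real \<Rightarrow> real" where
  "plateau t = (\<Sum>k\<in>{-1..1::int}. tent (t - real_of_int k))"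

lemma plateau_eq_1: "\<bar>t\<bar> \<le> 1 \<Longrightarrow> plateau t = 1"
  using tent_partition[of t 1] by (simp add: plateau_def)

lemma plateau_eq_0: "2 \<le> \<bar>t\<bar> \<Longrightarrow> plateau t = 0"
  unfolding plateau_def by (intro sum.neutral) (auto simp: tent_def)

lemma plateau_bound: "\<bar>plateau t\<bar> \<le> 3"
proof -
  have "\<bar>plateau t\<bar> \<le> (\<Sum>k\<in>{-1..1::int}. \<bar>tent (t - real_of_int k)\<bar>)"
    unfolding plateau_def by (rule sum_abs)
  also have "\<dots> \<le> (\<Sum>k\<in>{-1..1::int}. 1)"
    using tent_bounds by (intro sum_mono) auto
  finally show ?thesis by simp
qed

definition low_pass :: "real ^ 'n::finite \<Rightarrow> real" where
  "low_pass x = (\<Prod>i\<in>UNIV. plateau (x $ i))"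

text \<open>As a difference of successive dilates it telescopes over the scales, which yields a
  partition of unity off the origin without any normalising division.\<close>

definition annular :: "('n::finite \<Rightarrow> real) \<Rightarrow> real ^ 'n \<Rightarrow> real" where
  "annular s x = low_pass x - low_pass (adil s 1 x)"

definition cell :: "int \<Rightarrow> ('n::finite \<Rightarrow> int) \<Rightarrow> real ^ 'n \<Rightarrow> real" where
  "cell M k x = (\<Prod>i\<in>UNIV. tent (M * x $ i - k i))"

lemma low_pass_eq_1: "(\<And>i. \<bar>x $ i\<bar> \<le> 1) \<Longrightarrow> low_pass x = 1"
  by (simp add: low_pass_def plateau_eq_1)

lemma low_pass_neq_0: "low_pass x \<noteq> 0 \<Longrightarrow> \<bar>x $ i\<bar> \<le> 2"
  using plateau_eq_0[of "x $ i"] by (force simp: low_pass_def)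

lemma low_pass_bound: "\<bar>low_pass (x :: real ^ 'n::finite)\<bar> \<le> 3 ^ CARD('n)"
proof -
  have "\<bar>low_pass x\<bar> \<le> (\<Prod>i\<in>(UNIV::'n set). 3)"
    unfolding low_pass_def abs_prod by (intro prod_mono) (auto simp: plateau_bound)
  then show ?thesis by simp
qed

lemma annular_neq_0:
  assumes s: "\<And>i. 0 < s i" and x: "annular s x \<noteq> 0"
  shows "\<bar>x $ i\<bar> \<le> 2" and "1 / 2 \<le> arho s x"
proof -
  have ge: "\<bar>x $ i\<bar> \<le> \<bar>adil s 1 x $ i\<bar>" for i
    using s[of i] mult_right_mono[of 1 "2 powr s i" "\<bar>x $ i\<bar>"] by (simp add: abs_mult ge_one_powr_ge_zero)
  show "\<bar>x $ i\<bar> \<le> 2"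
  proof (cases "low_pass x = 0")
    case True
    then have "low_pass (adil s 1 x) \<noteq> 0" using x by (simp add: annular_def)
    from low_pass_neq_0[OF this, of i] ge[of i] show ?thesis by simp
  qed (rule low_pass_neq_0)
  \<comment> \<open>Dilation by a positive power of 2 expands. If all dilated coordinates were at
    most 1, so would be the original ones, and the two low-pass values, both 1, would
    cancel.\<close>
  have "\<exists>i. 1 < \<bar>adil s 1 x $ i\<bar>"
  proof (rule ccontr)
    assume "\<not> ?thesis"
    then have "\<bar>adil s 1 x $ i\<bar> \<le> 1" for i by (meson not_le)
    moreover from this have "\<bar>x $ i\<bar> \<le> 1" for i using ge[of i] order_trans by blast
    ultimately show False using x by (simp only: annular_def low_pass_eq_1)
  qed
  then obtain i where i: "1 < \<bar>adil s 1 x $ i\<bar>" ..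
  have "1 \<le> \<bar>adil s 1 x $ i\<bar> powr (1 / s i)"
    using i s[of i] by (intro ge_one_powr_ge_zero) auto
  also have "\<dots> \<le> arho s (adil s 1 x)"
    unfolding arho_def by (rule member_le_sum) auto
  finally show "1 / 2 \<le> arho s x"
    using arho_adil[of s, OF s, where x = x and j = 1] by simp
qed

lemma ft_mult_tent_coord:
  fixes i :: "'n::finite"
  shows "ft_mult 1 (\<lambda>x :: real ^ 'n. complex_of_real (tent (c * adil s j x $ i - a)))"
  using ft_mult_tent[of "(c * 2 powr (j * s i)) *\<^sub>R axis i 1 :: real ^ 'n" "- a"]
  by (simp add: inner_axis mult_ac inner_real_def)

lemma ft_mult_low_pass:
  "ft_mult (3 ^ CARD('n)) (\<lambda>x :: real ^ 'n::finite. complex_of_real (low_pass (adil s j x)))"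
proof -
  have "ft_mult (\<Sum>k\<in>{-1..1::int}. 1) (\<lambda>x :: real ^ 'n. \<Sum>k\<in>{-1..1::int}. complex_of_real (tent (1 * adil s j x $ i - k)))" for i
    by (intro ft_mult_sum ft_mult_tent_coord) auto
  then have "ft_mult (\<Prod>i\<in>(UNIV :: 'n set). 3) (\<lambda>x. \<Prod>i\<in>UNIV. complex_of_real (plateau (adil s j x $ i)))"
    by (intro ft_mult_prod) (simp_all add: plateau_def)
  then show ?thesis by (simp add: low_pass_def)
qed

lemma ft_mult_annular:
  "ft_mult (2 * 3 ^ CARD('n)) (\<lambda>x :: real ^ 'n::finite. complex_of_real (annular s (adil s j x)))"
  using ft_mult_diff[OF ft_mult_low_pass[of s j] ft_mult_low_pass[of s "1 + j"]]
  by (simp add: annular_def)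

lemma ft_mult_cell: "ft_mult 1 (\<lambda>x :: real ^ 'n::finite. complex_of_real (cell M k (adil s j x)))"
proof -
  have "ft_mult (\<Prod>i\<in>(UNIV :: 'n set). 1) (\<lambda>x. \<Prod>i\<in>UNIV. complex_of_real (tent (real_of_int M * adil s j x $ i - real_of_int (k i))))"
    by (intro ft_mult_prod ft_mult_tent_coord) auto
  then show ?thesis by (simp add: cell_def)
qed

lemma sum_cell:
  fixes x :: "real ^ 'n::finite"
  assumes "0 < M" "\<And>i. \<bar>x $ i\<bar> \<le> 2"
  shows "(\<Sum>k\<in>PiE UNIV (\<lambda>_. {- (2 * M)..2 * M}). cell M k x) = 1"
proof -
  have "\<bar>M * x $ i\<bar> \<le> (2 * M :: int)" for i
    using assms mult_left_mono[OF assms(2)[of i], of M] by (simp add: abs_mult)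
  then have "(\<Prod>i\<in>(UNIV :: 'n set). \<Sum>k\<in>{- (2 * M)..2 * M}. tent (M * x $ i - k)) = 1"
    using tent_partition by (intro prod.neutral ballI) blast
  then show ?thesis
    unfolding cell_def by (subst (asm) prod_sum_PiE) auto
qed

lemma annular_telescope:
  "(\<Sum>j\<in>{- int n..<int n}. annular s (adil s (- j) x)) =
     low_pass (adil s (1 - int n) x) - low_pass (adil s (1 + int n) x)"
proof (induction n)
  case (Suc n)
  have "{- int (Suc n)..<int (Suc n)} = insert (- int (Suc n)) (insert (int n) {- int n..<int n})"
    by auto
  then show ?case
    using Suc by (simp add: annular_def algebra_simps)
qed simp

lemma adil_eventually:
  assumes s: "\<And>i. 0 < s i"
  shows "(\<lambda>n. adil s (1 - int n) x $ i) \<longlonglongrightarrow> 0"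
    and "x $ i \<noteq> 0 \<Longrightarrow> filterlim (\<lambda>n. \<bar>adil s (1 + int n) x $ i\<bar>) at_top sequentially"
proof -
  have "(\<lambda>n. 2 powr s i * x $ i * (2 powr (- s i)) ^ n) \<longlonglongrightarrow> 2 powr s i * x $ i * 0"
    using s[of i] by (intro tendsto_mult_left LIMSEQ_realpow_zero) (auto simp: powr_less_one)
  moreover have eq: "adil s (1 - int n) x $ i = 2 powr s i * x $ i * (2 powr (- s i)) ^ n" for n
    by (simp add: powr_add[symmetric] powr_realpow[symmetric] powr_powr algebra_simps)
  ultimately show "(\<lambda>n. adil s (1 - int n) x $ i) \<longlonglongrightarrow> 0" unfolding eq by simp
  assume x: "x $ i \<noteq> 0"
  have "filterlim (\<lambda>n. 2 powr s i * \<bar>x $ i\<bar> * (2 powr s i) ^ n) at_top sequentially"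
    using s[of i] x
    using filterlim_realpow_sequentially_gt1[of "2 powr s i"]
    by (intro filterlim_tendsto_pos_mult_at_top[OF tendsto_const])
       (auto simp: filterlim_at_infinity_conv_norm_at_top norm_power)
  moreover have eq: "\<bar>adil s (1 + int n) x $ i\<bar> = 2 powr s i * \<bar>x $ i\<bar> * (2 powr s i) ^ n" for n
    by (simp add: abs_mult powr_add[symmetric] powr_realpow[symmetric] powr_powr algebra_simps)
  ultimately show "filterlim (\<lambda>n. \<bar>adil s (1 + int n) x $ i\<bar>) at_top sequentially" unfolding eq by simp
qed

text \<open>After telescoping two dilates remain: one shrinks to the origin, where
  \<open>low_pass\<close> is 1, and the other leaves the support of \<open>low_pass\<close> through
  a nonzero coordinate.\<close>

lemma annular_sum_eventually:
  fixes x :: "real ^ 'n::finite"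
  assumes s: "\<And>i. 0 < s i" and "x \<noteq> 0"
  shows "\<forall>\<^sub>F n in sequentially. (\<Sum>j\<in>{- int n..<int n}. annular s (adil s (- j) x)) = 1"
proof -
  obtain i where i: "x $ i \<noteq> 0" using assms(2) by (auto simp: vec_eq_iff)
  have "\<forall>\<^sub>F n in sequentially. 3 \<le> \<bar>adil s (1 + int n) x $ i\<bar>"
    using adil_eventually(2)[of s, OF s, where x = x and i = i] i unfolding filterlim_at_top by blast
  moreover have "\<forall>\<^sub>F n in sequentially. \<forall>i. \<bar>adil s (1 - int n) x $ i\<bar> < 1"
    using order_tendstoD(2)[OF tendsto_rabs_zero[OF adil_eventually(1)[of s x, OF s]], of 1]
    by (intro eventually_all_finite) auto
  ultimately show ?thesis
  proof eventually_elim
    case (elim n)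
    have "low_pass (adil s (1 - int n) x) = 1"
      using elim(2) by (intro low_pass_eq_1) (simp add: less_imp_le)
    moreover have "low_pass (adil s (1 + int n) x) = 0"
      using low_pass_neq_0[of "adil s (1 + int n) x" i] elim(1) by force
    ultimately show ?case by (simp add: annular_telescope)
  qed
qed

text \<open>The cells of a sufficiently fine grid meet the annulus in sets on which \<open>arho\<close> is nearly
  constant, so each piece sees a single localised symbol.\<close>

lemma cell_localized:
  fixes s :: "'n::finite \<Rightarrow> real"
  assumes s: "\<And>i. 0 < s i"
  shows "\<exists>M>0. \<exists>l. \<forall>k x. annular s x * cell M k x \<noteq> 0 \<longrightarrow>
     2 powr (real_of_int (l k) - 1) \<le> arho s x \<and> arho s x \<le> 2 powr (real_of_int (l k) + 1)"
proof -
  let ?S = "cbox (\<chi> i. - 2) (\<chi> i. 2) :: (real ^ 'n) set"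
  have "uniformly_continuous_on ?S (arho s)"
    by (intro compact_uniformly_continuous continuous_on_arho s compact_cbox)
  then obtain d where d: "d > 0" "\<And>x y. x \<in> ?S \<Longrightarrow> y \<in> ?S \<Longrightarrow> dist y x < d \<Longrightarrow> dist (arho s y) (arho s x) < 1 / 8"
    unfolding uniformly_continuous_on_def by (metis zero_less_divide_1_iff zero_less_numeral)
  \<comment> \<open>Two points of one cell differ by at most 2 / M in each coordinate, hence by at
    most 2 \<open>CARD('n)\<close> / M in norm.\<close>
  obtain M0 :: nat where M0: "2 * CARD('n) / d < M0"
    using reals_Archimedean2 by blast
  define M where "M = int M0"
  have "0 < real M0"
    using d(1) by (intro le_less_trans[OF _ M0]) auto
  then have M: "0 < M" "2 * CARD('n) / M < d"
    using M0 d(1) by (simp_all add: M_def field_simps)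
  have near: "\<bar>arho s y - arho s x\<bar> < 1 / 8"
    if x: "annular s x * cell M k x \<noteq> 0" and y: "annular s y * cell M k y \<noteq> 0" for x y k
  proof -
    have S: "x \<in> ?S" "y \<in> ?S"
      using annular_neq_0(1)[of s x, OF s] annular_neq_0(1)[of s y, OF s] x y
      by (auto simp: mem_box_cart abs_le_iff minus_le_iff)
    have "\<bar>(y - x) $ i\<bar> \<le> 2 / M" for i
    proof -
      have "tent (M * x $ i - k i) \<noteq> 0" "tent (M * y $ i - k i) \<noteq> 0"
        using x y by (auto simp: cell_def)
      then have "\<bar>M * x $ i - k i\<bar> \<le> 1" "\<bar>M * y $ i - k i\<bar> \<le> 1"
        by (auto simp: tent_def)
      then have "\<bar>M * y $ i - M * x $ i\<bar> \<le> 2" by linarith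
      moreover have "M * y $ i - M * x $ i = M * (y - x) $ i" by (simp add: algebra_simps)
      ultimately have "\<bar>M * (y - x) $ i\<bar> \<le> 2" by simp
      then show ?thesis using M(1) by (simp add: abs_mult field_simps del: vector_minus_component)
    qed
    then have "(\<Sum>i\<in>UNIV. \<bar>(y - x) $ i\<bar>) \<le> (\<Sum>i\<in>(UNIV :: 'n set). 2 / M)"
      by (intro sum_mono)
    then have "norm (y - x) \<le> 2 * CARD('n) / M"
      using norm_le_l1_cart[of "y - x"] by (simp add: mult.commute)
    then have "dist y x < d" using M(2) by (simp add: dist_norm)
    from d(2)[OF S this] show ?thesis by (simp add: dist_real_def)
  qed
  have "\<exists>l :: int. \<forall>x. annular s x * cell M k x \<noteq> 0 \<longrightarrow>
     2 powr (real_of_int l - 1) \<le> arho s x \<and> arho s x \<le> 2 powr (real_of_int l + 1)" for k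
  proof (cases "\<exists>x. annular s x * cell M k x \<noteq> 0")
    case True
    then obtain x0 where x0: "annular s x0 * cell M k x0 \<noteq> 0" ..
    define r where "r = arho s x0"
    have r: "1 / 2 \<le> r"
      unfolding r_def using x0 by (intro annular_neq_0[of s, OF s]) auto
    \<comment> \<open>As r is at least 1/2, the oscillation 1/8 is at most r / 4, so the gauge stays
      in [3 r / 4, 5 r / 4]. With 3 r / 4 between 2 powr (l - 1) and 2 powr l, this interval fits
      into the window of ratio 4 on which one cut-off equals 1.\<close>
    define l where "l = \<lfloor>log 2 (3 * r / 4)\<rfloor> + 1"
    have "2 powr (real_of_int l - 1) \<le> 2 powr (log 2 (3 * r / 4))"
      unfolding l_def by (intro powr_mono) auto
    moreover have "2 powr (log 2 (3 * r / 4)) \<le> 2 powr real_of_int l"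
      unfolding l_def by (intro powr_mono) linarith+
    ultimately have l: "2 powr (real_of_int l - 1) \<le> 3 * r / 4" "3 * r / 4 \<le> 2 powr real_of_int l"
      using r by (simp_all add: powr_log_cancel)
    have "2 powr (real_of_int l - 1) \<le> arho s x \<and> arho s x \<le> 2 powr (real_of_int l + 1)"
      if "annular s x * cell M k x \<noteq> 0" for x
    proof -
      have "2 powr (real_of_int l + 1) = 2 * 2 powr real_of_int l" by (simp add: powr_add)
      moreover have "\<bar>arho s x - r\<bar> < 1 / 8" using near[OF x0 that] by (simp add: r_def)
      ultimately show ?thesis using l r by linarith
    qed
    then show ?thesis by blast
  qed auto
  then have "\<exists>l :: ('n \<Rightarrow> int) \<Rightarrow> int. \<forall>k x. annular s x * cell M k x \<noteq> 0 \<longrightarrow>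
     2 powr (real_of_int (l k) - 1) \<le> arho s x \<and> arho s x \<le> 2 powr (real_of_int (l k) + 1)"
    by metis
  then show ?thesis using M(1) by blast
qed

subsection \<open>Localised operators\<close>

lemma inv_fourier_eq_ft:
  "inv_fourier g (x :: real ^ 'n::finite) = complex_of_real (1 / (2 * pi) ^ CARD('n)) * ft g x"
  by (simp add: inv_fourier_def ft_def)

lemma fourier_eq_ft: "fourier u \<xi> = ft u (- \<xi>)"
  by (simp add: fourier_def ft_def inner_commute)

lemma ft_mult_fourier:
  fixes S u :: "real ^ 'n::finite \<Rightarrow> complex"
  assumes S: "integrable lborel S" and u: "integrable lborel u"
  shows "ft (\<lambda>\<xi>. S \<xi> * fourier u \<xi>) x = (LINT y|lborel. ft S y * u (x - y))"
proof -
  have [measurable]: "u \<in> borel_measurable borel" "ft S \<in> borel_measurable borel"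
    using u borel_measurable_ft[OF S] by auto
  have "ft (\<lambda>\<xi>. S \<xi> * fourier u \<xi>) x = (LINT \<xi>|lborel. S \<xi> * (LINT z|lborel. u z * iexp ((x - z) \<bullet> \<xi>)))"
    unfolding ft_def
  proof (rule Bochner_Integration.integral_cong[OF refl])
    fix \<xi>
    have "iexp (x \<bullet> \<xi>) * fourier u \<xi> = (LINT z|lborel. u z * iexp ((x - z) \<bullet> \<xi>))"
      unfolding fourier_def
      by (subst integral_mult_right_zero[symmetric])
         (simp add: inner_diff_left right_diff_distrib exp_diff exp_minus field_simps)
    then show "iexp (x \<bullet> \<xi>) * (S \<xi> * fourier u \<xi>) = S \<xi> * (LINT z|lborel. u z * iexp ((x - z) \<bullet> \<xi>))"
      by (simp add: mult.left_commute)
  qed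
  also have "\<dots> = (LINT z|lborel. u z * (LINT \<xi>|lborel. S \<xi> * iexp ((x - z) \<bullet> \<xi>)))"
    by (rule lborel_Fubini_mult[OF S u]) auto
  also have "\<dots> = (LINT z|lborel. u (x - (x - z)) * ft S (x - z))"
    by (simp add: ft_def mult.commute)
  also have "\<dots> = (LINT y|lborel. u (x - y) * ft S y)"
    by (rule integral_lborel_reflect) measurable
  finally show ?thesis by (simp add: mult.commute)
qed

text \<open>The transform of the marginal of \<open>K\<close> along \<open>b\<close> vanishes, hence so does the marginal; this is
  tested against \<open>g\<close> through its Gaussian mollifications, which are superpositions of characters.\<close>

lemma integral_marginal_eq_0:
  fixes K :: "'a::euclidean_space \<Rightarrow> complex" and g :: "real \<Rightarrow> complex"
  assumes K: "integrable lborel K" and zero: "\<And>t. ft K (- (t *\<^sub>R b)) = 0"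
    and g: "continuous_on UNIV g" "integrable lborel g" and B: "\<And>t. norm (g t) \<le> B"
  shows "(LINT y|lborel. K y * g (y \<bullet> b)) = 0"
proof -
  let ?\<epsilon> = "\<lambda>n. 1 / real (Suc n)"
  let ?G = "\<lambda>n t. LINT r|lborel. g r * gauss (?\<epsilon> n) (r - t)"
  have [measurable]: "g \<in> borel_measurable borel" "ft g \<in> borel_measurable borel"
    using g borel_measurable_ft[OF g(2)] by auto
  have K': "K \<in> borel_measurable borel" using K by auto
  \<comment> \<open>The mollified \<open>g\<close> becomes a superposition of characters with an
    integrable density.\<close>
  have rep: "complex_of_real (2 * pi) * ?G n t =
      (LINT x|lborel. gauss_weight (?\<epsilon> n) x * ft g x * iexp (- (x * t)))" for n t
    using ft_regularized[of "?\<epsilon> n" g t] g(2) by (simp add: mult_ac)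
  have int: "integrable lborel (\<lambda>x. gauss_weight \<epsilon> x * ft g x)" if "0 < \<epsilon>" for \<epsilon>
    using integrable_bounded_mult[of "ft g" "\<lambda>x. complex_of_real (gauss_weight \<epsilon> x)"]
      norm_ft_le[of g] integrable_of_real[OF integrable_gauss_weight[OF that]]
    by (auto simp: bounded_iff mult.commute)
  have cont: "continuous_on UNIV (?G n)" for n
  proof -
    have "?G n = (\<lambda>t. complex_of_real (1 / (2 * pi)) * ft (\<lambda>x. gauss_weight (?\<epsilon> n) x * ft g x) (- t))"
    proof
      fix t
      have "?G n t = complex_of_real (1 / (2 * pi)) * (complex_of_real (2 * pi) * ?G n t)" by simp
      also have "\<dots> = complex_of_real (1 / (2 * pi)) * ft (\<lambda>x. gauss_weight (?\<epsilon> n) x * ft g x) (- t)"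
        unfolding rep by (simp add: ft_def mult_ac)
      finally show "?G n t = complex_of_real (1 / (2 * pi)) * ft (\<lambda>x. gauss_weight (?\<epsilon> n) x * ft g x) (- t)" .
    qed
    then show ?thesis
      using int[of "?\<epsilon> n"]
      by (simp only:) (intro continuous_intros continuous_on_compose2[OF continuous_ft]; simp)
  qed
  then have [measurable]: "?G n \<in> borel_measurable borel" for n
    by (rule borel_measurable_continuous_onI)
  \<comment> \<open>Fubini reduces the pairing to the pairings of \<open>K\<close> with characters
    along \<open>b\<close>, which are the vanishing values of \<open>ft K\<close>.\<close>
  have "(LINT y|lborel. K y * ?G n (y \<bullet> b)) = 0" for n
  proof -
    have "complex_of_real (2 * pi) * (LINT y|lborel. K y * ?G n (y \<bullet> b)) =
        (LINT y|lborel. K y * (LINT x|lborel. gauss_weight (?\<epsilon> n) x * ft g x * iexp (- (x * (y \<bullet> b)))))"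
      unfolding rep[symmetric] by (subst integral_mult_right_zero[symmetric]) (simp only: mult.left_commute)
    also have "\<dots> = (LINT x|lborel. gauss_weight (?\<epsilon> n) x * ft g x * (LINT y|lborel. K y * iexp (- (x * (y \<bullet> b)))))"
      by (rule lborel_Fubini_mult[OF K int]) auto
    also have "(\<lambda>x. LINT y|lborel. K y * iexp (- (x * (y \<bullet> b)))) = (\<lambda>x. ft K (- (x *\<^sub>R b)))"
      by (simp add: ft_def mult.commute inner_commute[of b])
    finally show ?thesis by (simp add: zero)
  qed
  moreover have "(\<lambda>n. LINT y|lborel. K y * ?G n (y \<bullet> b)) \<longlonglongrightarrow> (LINT y|lborel. K y * g (y \<bullet> b))"
  proof (rule integral_dominated_convergence[where w = "\<lambda>y. norm (K y) * B"])
    show "AE y in lborel. (\<lambda>n. K y * ?G n (y \<bullet> b)) \<longlonglongrightarrow> K y * g (y \<bullet> b)"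
      by (intro AE_I2 tendsto_mult_left gauss_mollify_tendsto[OF g(1) B])
    have "norm (?G n t) \<le> B" for n t
    proof -
      have "0 \<le> B" using B[of 0] norm_ge_zero order_trans by blast
      have "ennreal (norm (?G n t)) \<le> (\<integral>\<^sup>+r. ennreal (norm (g r * gauss (?\<epsilon> n) (r - t))) \<partial>lborel)"
        by (rule integral_norm_bound_nn_integral)
      also have "\<dots> \<le> (\<integral>\<^sup>+r. ennreal B * ennreal (gauss (?\<epsilon> n) (r - t)) \<partial>lborel)"
        using \<open>0 \<le> B\<close>
        by (intro nn_integral_mono) (auto simp: norm_mult gauss_nonneg ennreal_mult[symmetric] intro!: ennreal_leI mult_right_mono B)
      also have "\<dots> = ennreal B"
        by (subst nn_integral_cmult) (auto simp: nn_integral_gauss_translate)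
      finally show ?thesis using \<open>0 \<le> B\<close> by simp
    qed
    then show "AE y in lborel. norm (K y * ?G n (y \<bullet> b)) \<le> norm (K y) * B" for n
      unfolding norm_mult by (intro AE_I2 mult_left_mono) auto
  qed (use K K' in \<open>auto intro!: borel_measurable_times\<close>)
  ultimately show ?thesis by (simp add: LIMSEQ_const_iff)
qed

section \<open>Change of variables and the rescaled kernel bound\<close>

definition dscale :: "real \<Rightarrow> real \<Rightarrow> 'n \<Rightarrow> 'n \<Rightarrow> 'n \<Rightarrow> real" where
  "dscale \<alpha> \<beta> p q i = (if i = p then 1 / \<alpha> else if i = q then 1 / \<beta> else 1)"

lemma dscale_pos: "0 < \<alpha> \<Longrightarrow> 0 < \<beta> \<Longrightarrow> 0 < dscale \<alpha> \<beta> p q i"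
  by (simp add: dscale_def)

lemma dil_eq_adil: "dil \<alpha> \<beta> p q = adil (dscale \<alpha> \<beta> p q)"
  by (simp add: fun_eq_iff vec_eq_iff dil_def dscale_def)

lemma sum_UNIV_split_pq:
  fixes f :: "'n::finite \<Rightarrow> 'b::comm_monoid_add"
  assumes "p \<noteq> q"
  shows "(\<Sum>i\<in>UNIV. f i) = f p + (f q + (\<Sum>i\<in>- {p, q}. f i))"
proof -
  have "UNIV = insert p (insert q (- {p, q}))" by auto
  then have "(\<Sum>i\<in>UNIV. f i) = (\<Sum>i\<in>insert p (insert q (- {p, q})). f i)" by simp
  then show ?thesis using assms by simp
qed

lemma rho_eq_arho:
  assumes "p \<noteq> q" shows "rho \<alpha> \<beta> p q = arho (dscale \<alpha> \<beta> p q)"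
proof
  fix x :: "real ^ 'a"
  have "(\<Sum>k\<in>- {p, q}. \<bar>x $ k\<bar> powr (1 / dscale \<alpha> \<beta> p q k)) = (\<Sum>k\<in>- {p, q}. \<bar>x $ k\<bar>)"
    by (intro sum.cong) (auto simp: dscale_def)
  then show "rho \<alpha> \<beta> p q x = arho (dscale \<alpha> \<beta> p q) x"
    unfolding rho_def arho_def sum_UNIV_split_pq[OF assms] using assms
    by (simp add: dscale_def)
qed

lemma prod_Basis_vec: "(\<Prod>b\<in>Basis. f b) = (\<Prod>i\<in>UNIV. f (axis i 1 :: real ^ 'n::finite))"
proof -
  have B: "(Basis :: (real ^ 'n) set) = range (\<lambda>i. axis i 1)"
    by (auto simp: Basis_vec_def)
  have inj: "inj (\<lambda>i :: 'n. axis i 1 :: real ^ 'n)"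
    by (auto simp: inj_on_def axis_eq_axis)
  show ?thesis unfolding B prod.reindex[OF inj] by simp
qed

lemma lborel_adil:
  fixes s :: "'n::finite \<Rightarrow> real"
  shows "lborel = density (distr lborel borel (adil s j)) (\<lambda>_. ennreal (\<Prod>i\<in>UNIV. 2 powr (j * s i)))"
proof -
  have diag: "adil s j b \<bullet> b \<noteq> 0" if "b \<in> Basis" for b :: "real ^ 'n"
    using that by (auto simp: Basis_vec_def inner_axis)
  have "adil s j x = 0 + (\<Sum>b\<in>Basis. ((adil s j b \<bullet> b) * (x \<bullet> b)) *\<^sub>R b)" for x :: "real ^ 'n"
  proof (rule euclidean_eqI)
    fix b :: "real ^ 'n" assume b: "b \<in> Basis"
    then have "adil s j x \<bullet> b = (adil s j b \<bullet> b) * (x \<bullet> b)"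
      by (auto simp: Basis_vec_def inner_axis)
    then show "adil s j x \<bullet> b = (0 + (\<Sum>b\<in>Basis. ((adil s j b \<bullet> b) * (x \<bullet> b)) *\<^sub>R b)) \<bullet> b"
      using b by simp
  qed
  then have "adil s j = (\<lambda>x. 0 + (\<Sum>b\<in>Basis. ((adil s j b \<bullet> b) * (x \<bullet> b)) *\<^sub>R b))" by blast
  moreover have "(\<Prod>b\<in>Basis. \<bar>adil s j (b :: real ^ 'n) \<bullet> b\<bar>) = (\<Prod>i\<in>UNIV. 2 powr (j * s i))"
    by (simp add: prod_Basis_vec inner_axis)
  ultimately show ?thesis
    using lborel_affine_euclidean[of "\<lambda>b. adil s j b \<bullet> b" 0] diag by simp
qed

lemma nn_integral_adil:
  fixes f :: "real ^ 'n::finite \<Rightarrow> ennreal"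
  assumes [measurable]: "f \<in> borel_measurable borel"
  shows "(\<integral>\<^sup>+x. f x \<partial>lborel) = ennreal (\<Prod>i\<in>UNIV. 2 powr (real_of_int j * s i)) * (\<integral>\<^sup>+x. f (adil s j x) \<partial>lborel)"
  by (subst lborel_adil[of s j]) (simp add: nn_integral_density nn_integral_distr nn_integral_cmult)

lemma dil_det_eq_prod:
  fixes p q :: "'n::finite"
  assumes "p \<noteq> q"
  shows "dil_det \<alpha> \<beta> TYPE('n) j = (\<Prod>i\<in>UNIV. 2 powr (real_of_int j * dscale \<alpha> \<beta> p q i))"
proof -
  have "card {p, q} \<le> CARD('n)"
    by (rule card_mono) auto
  then have "2 \<le> CARD('n)" using assms by simp
  moreover have "card (- {p, q}) = CARD('n) - 2"
    using assms by (simp add: card_Diff_subset Compl_eq_Diff_UNIV)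
  moreover have "(\<Sum>i\<in>- {p, q}. dscale \<alpha> \<beta> p q i) = (\<Sum>i\<in>- {p, q}. 1)"
    by (intro sum.cong) (auto simp: dscale_def)
  ultimately have "(\<Sum>i\<in>UNIV. dscale \<alpha> \<beta> p q i) = 1 / \<alpha> + (1 / \<beta> + (real CARD('n) - 2))"
    unfolding sum_UNIV_split_pq[OF assms] using assms by (simp add: dscale_def of_nat_diff)
  then have "real_of_int j * (real CARD('n) - 2) + real_of_int j / \<alpha> + real_of_int j / \<beta> =
      (\<Sum>i\<in>UNIV. real_of_int j * dscale \<alpha> \<beta> p q i)"
    by (simp add: sum_distrib_left[symmetric] distrib_left)
  then show ?thesis
    by (simp only: dil_det_def powr_sum)
qed

text \<open>The homogeneous part of \<open>kernel_weight\<close>. It scales by 2 powr (j \<gamma>)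
  under dilation and at the same time controls increments of functions in
  \<open>holder_space\<close> that leave \<open>x $ q\<close> fixed.\<close>

definition aniso_modulus :: "real \<Rightarrow> real \<Rightarrow> 'n \<Rightarrow> 'n \<Rightarrow> real ^ 'n::finite \<Rightarrow> real" where
  "aniso_modulus \<alpha> \<gamma> p q x = sqrt (\<Sum>i\<in>- {p, q}. (x $ i)\<^sup>2) powr \<gamma> + \<bar>x $ p\<bar> powr (\<alpha> * \<gamma>)"

lemma aniso_modulus_nonneg: "0 \<le> aniso_modulus \<alpha> \<gamma> p q x"
  by (simp add: aniso_modulus_def)

lemma borel_measurable_aniso_modulus [measurable]: "aniso_modulus \<alpha> \<gamma> p q \<in> borel_measurable borel"
  unfolding aniso_modulus_def by measurable

lemma kernel_weight_eq: "kernel_weight \<alpha> \<gamma> p q x = 1 + aniso_modulus \<alpha> \<gamma> p q x"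
  by (simp add: kernel_weight_def aniso_modulus_def)

lemma aniso_modulus_adil:
  assumes "0 < \<alpha>"
  shows "aniso_modulus \<alpha> \<gamma> p q (adil (dscale \<alpha> \<beta> p q) j x) = 2 powr (real_of_int j * \<gamma>) * aniso_modulus \<alpha> \<gamma> p q x"
proof -
  have "(\<Sum>i\<in>- {p, q}. (adil (dscale \<alpha> \<beta> p q) j x $ i)\<^sup>2) = (2 powr j)\<^sup>2 * (\<Sum>i\<in>- {p, q}. (x $ i)\<^sup>2)"
    unfolding sum_distrib_left by (intro sum.cong) (auto simp: dscale_def power_mult_distrib)
  then have "sqrt (\<Sum>i\<in>- {p, q}. (adil (dscale \<alpha> \<beta> p q) j x $ i)\<^sup>2) = 2 powr j * sqrt (\<Sum>i\<in>- {p, q}. (x $ i)\<^sup>2)"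
    by (simp only: real_sqrt_mult real_sqrt_abs) simp
  then show ?thesis
    using assms by (simp add: aniso_modulus_def dscale_def abs_mult powr_mult powr_powr sum_nonneg distrib_left)
qed

text \<open>Substituting the dilated variable cancels the determinant in \<open>kernel\<close> and
  multiplies the homogeneous part of the weight by 2 powr (j \<gamma>). The summand 1 of the weight
  gives integrability of the unscaled kernel, the homogeneous part gives the gain in the
  scale.\<close>

lemma kernel_bound_rescaled:
  fixes m :: "real ^ 'n::finite \<Rightarrow> complex" and \<alpha> \<beta> \<gamma> \<mu> :: real and p q :: 'n
    and \<omega> :: "real \<Rightarrow> real" and j :: int
  defines "K \<equiv> inv_fourier (symbol_piece \<alpha> \<beta> p q \<omega> m j)"
  assumes "p \<noteq> q" "0 < \<alpha>" and K[measurable]: "K \<in> borel_measurable borel"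
    and bound: "(\<integral>\<^sup>+x. ennreal (kernel_weight \<alpha> \<gamma> p q x * cmod (kernel \<alpha> \<beta> p q \<omega> m j x)) \<partial>lborel) \<le> ennreal \<mu>"
  shows "integrable lborel K"
    and "(\<integral>\<^sup>+y. ennreal (aniso_modulus \<alpha> \<gamma> p q y * cmod (K y)) \<partial>lborel) \<le> ennreal (2 powr (- (j * \<gamma>)) * \<mu>)"
proof -
  let ?s = "dscale \<alpha> \<beta> p q" and ?A = "aniso_modulus \<alpha> \<gamma> p q"
  define a where "a = dil_det \<alpha> \<beta> TYPE('n) j"
  have a: "0 < a" by (simp add: a_def dil_det_def)
  have ker: "kernel \<alpha> \<beta> p q \<omega> m j x = complex_of_real (1 / a) * K (adil ?s (- j) x)" for x
    by (simp add: kernel_def K_def a_def dil_eq_adil)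
  have eq: "(\<integral>\<^sup>+x. ennreal (kernel_weight \<alpha> \<gamma> p q x * cmod (kernel \<alpha> \<beta> p q \<omega> m j x)) \<partial>lborel) =
    (\<integral>\<^sup>+y. ennreal ((1 + 2 powr (j * \<gamma>) * ?A y) * cmod (K y)) \<partial>lborel)"
  proof -
    have "(\<integral>\<^sup>+x. ennreal (kernel_weight \<alpha> \<gamma> p q x * cmod (kernel \<alpha> \<beta> p q \<omega> m j x)) \<partial>lborel) =
       ennreal a * (\<integral>\<^sup>+y. ennreal (kernel_weight \<alpha> \<gamma> p q (adil ?s j y) * cmod (kernel \<alpha> \<beta> p q \<omega> m j (adil ?s j y))) \<partial>lborel)"
      unfolding a_def dil_det_eq_prod[OF assms(2)]
      by (rule nn_integral_adil) (unfold ker kernel_weight_eq, measurable)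
    also have "\<dots> = (\<integral>\<^sup>+y. ennreal a * ennreal (kernel_weight \<alpha> \<gamma> p q (adil ?s j y) * cmod (kernel \<alpha> \<beta> p q \<omega> m j (adil ?s j y))) \<partial>lborel)"
      by (rule nn_integral_cmult[symmetric]) (unfold ker kernel_weight_eq, measurable)
    also have "\<dots> = (\<integral>\<^sup>+y. ennreal ((1 + 2 powr (j * \<gamma>) * ?A y) * cmod (K y)) \<partial>lborel)"
      using a assms(3)
      by (intro nn_integral_cong) (simp add: ker kernel_weight_eq aniso_modulus_adil norm_mult norm_divide ennreal_mult'[symmetric])
    finally show ?thesis .
  qed
  have "(\<integral>\<^sup>+y. ennreal (cmod (K y)) \<partial>lborel) \<le> (\<integral>\<^sup>+y. ennreal ((1 + 2 powr (j * \<gamma>) * ?A y) * cmod (K y)) \<partial>lborel)"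
    by (intro nn_integral_mono ennreal_leI) (simp add: distrib_right aniso_modulus_nonneg)
  also have "\<dots> < \<infinity>"
    using bound unfolding eq by (rule le_less_trans) simp
  finally show "integrable lborel K"
    by (intro integrableI_bounded) auto
  have "(\<integral>\<^sup>+y. ennreal (?A y * cmod (K y)) \<partial>lborel) \<le>
     (\<integral>\<^sup>+y. ennreal (2 powr (- (j * \<gamma>))) * ennreal ((1 + 2 powr (j * \<gamma>) * ?A y) * cmod (K y)) \<partial>lborel)"
  proof (rule nn_integral_mono)
    fix y
    have "?A y * cmod (K y) \<le> 2 powr (- (j * \<gamma>)) * ((1 + 2 powr (j * \<gamma>) * ?A y) * cmod (K y))"
      by (simp add: powr_minus field_simps)
    then show "ennreal (?A y * cmod (K y)) \<le> ennreal (2 powr (- (j * \<gamma>))) * ennreal ((1 + 2 powr (j * \<gamma>) * ?A y) * cmod (K y))"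
      by (simp add: ennreal_mult'[symmetric] ennreal_leI)
  qed
  also have "\<dots> = ennreal (2 powr (- (j * \<gamma>))) * (\<integral>\<^sup>+y. ennreal ((1 + 2 powr (j * \<gamma>) * ?A y) * cmod (K y)) \<partial>lborel)"
    by (rule nn_integral_cmult) measurable
  also have "\<dots> \<le> ennreal (2 powr (- (j * \<gamma>))) * ennreal \<mu>"
    using bound unfolding eq by (rule mult_left_mono) simp
  finally show "(\<integral>\<^sup>+y. ennreal (?A y * cmod (K y)) \<partial>lborel) \<le> ennreal (2 powr (- (j * \<gamma>)) * \<mu>)"
    by (simp add: ennreal_mult')
qed

section \<open>Increments of Hoelder functions\<close>

lemma holder_seminorm_diff_le:
  assumes "0 < l" "l < 1" and H: "holder_seminorm l i u \<le> ennreal H" "0 \<le> H"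
  shows "norm (u (x + h *\<^sub>R axis i 1) - u x) \<le> H * \<bar>h\<bar> powr l"
proof -
  have "\<lfloor>l\<rfloor> = 0" using assms by (simp add: floor_eq_iff)
  then have sup: "(SUP x. SUP h\<in>{0<..}. ennreal (cmod (u (x + h *\<^sub>R axis i 1) - u x) / h powr l)) \<le> ennreal H"
    using H by (simp add: holder_seminorm_def partially_differentiable_def)
  have pos: "norm (u (x + h *\<^sub>R axis i 1) - u x) \<le> H * h powr l" if "0 < h" for x h
  proof -
    have "ennreal (cmod (u (x + h *\<^sub>R axis i 1) - u x) / h powr l) \<le> ennreal H"
      using that by (intro order_trans[OF _ sup] SUP_upper2[of x] SUP_upper2[of h]) auto
    then show ?thesis using that H(2) by (simp add: field_simps)
  qed
  consider "0 < h" | "h = 0" | "h < 0" by linarith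
  then show ?thesis
  proof cases
    \<comment> \<open>The seminorm involves positive steps only; a negative step is measured from
      its other endpoint.\<close>
    case 3
    then show ?thesis
      using pos[of "- h" "x + h *\<^sub>R axis i 1"] by (simp add: norm_minus_commute)
  qed (use pos in auto)
qed

lemma holder_seminorm_sum_diff_le:
  assumes "finite I" and H: "\<And>i x h. i \<in> I \<Longrightarrow> norm (u (x + h *\<^sub>R axis i 1) - u x) \<le> H i * \<bar>h\<bar> powr l i"
  shows "norm (u (x + (\<Sum>i\<in>I. h i *\<^sub>R axis i 1)) - u x :: complex) \<le> (\<Sum>i\<in>I. H i * \<bar>h i\<bar> powr l i)"
  using assms
proof (induction I arbitrary: x rule: finite_induct)
  case (insert i I)
  let ?y = "x + h i *\<^sub>R axis i 1"
  have "u (x + (\<Sum>k\<in>insert i I. h k *\<^sub>R axis k 1)) - u x =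
     (u (?y + (\<Sum>k\<in>I. h k *\<^sub>R axis k 1)) - u ?y) + (u ?y - u x)"
    using insert by (simp add: add.assoc)
  also have "norm \<dots> \<le> (\<Sum>i\<in>I. H i * \<bar>h i\<bar> powr l i) + H i * \<bar>h i\<bar> powr l i"
    using insert by (intro norm_triangle_mono) auto
  finally show ?case using insert by simp
qed simp

text \<open>The path between the two points is made of segments parallel to the axes other than
  \<open>q\<close>, the only ones along which \<open>u\<close> has Hoelder bounds. Each coordinate
  increment is at most \<open>aniso_modulus\<close>, so the seminorms add up to
  \<open>U\<close>.\<close>

lemma holder_space_diff_le:
  fixes u :: "real ^ 'n::finite \<Rightarrow> complex"
  assumes pq: "p \<noteq> q" and "0 < \<alpha>" "\<alpha> \<le> 1" "0 < \<gamma>" "\<gamma> < 1"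
    and U: "holder_seminorm_dprime \<gamma> p q u + holder_seminorm (\<alpha> * \<gamma>) p u = ennreal U" "0 \<le> U"
  shows "norm (u (x - y) - u (x - (y $ q) *\<^sub>R axis q 1)) \<le> U * aniso_modulus \<alpha> \<gamma> p q y"
proof -
  define l where "l i = (if i = p then \<alpha> * \<gamma> else \<gamma>)" for i
  define H where "H i = enn2real (holder_seminorm (l i) i u)" for i
  have "\<alpha> * \<gamma> \<le> 1 * \<gamma>" by (rule mult_right_mono) (use assms in auto)
  then have "\<alpha> * \<gamma> < 1" using assms by linarith
  then have l: "0 < l i" "l i < 1" for i
    using assms by (auto simp: l_def)
  have U': "(\<Sum>i\<in>- {q}. holder_seminorm (l i) i u) = ennreal U"
  proof -
    have "- {q} = insert p (- {p, q})" using pq by auto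
    then have "(\<Sum>i\<in>- {q}. holder_seminorm (l i) i u) = holder_seminorm (l p) p u + (\<Sum>i\<in>- {p, q}. holder_seminorm (l i) i u)"
      by simp
    also have "(\<Sum>i\<in>- {p, q}. holder_seminorm (l i) i u) = holder_seminorm_dprime \<gamma> p q u"
      unfolding holder_seminorm_dprime_def by (intro sum.cong) (auto simp: l_def)
    finally show ?thesis using U by (simp add: l_def add.commute)
  qed
  have fin: "holder_seminorm (l i) i u = ennreal (H i)" if "i \<in> - {q}" for i
  proof -
    have "holder_seminorm (l i) i u \<le> (\<Sum>i\<in>- {q}. holder_seminorm (l i) i u)"
      using that by (intro member_le_sum) auto
    then show ?thesis unfolding U' H_def
      by (metis ennreal_enn2real ennreal_less_top le_less_trans)
  qed
  then have "(\<Sum>i\<in>- {q}. ennreal (H i)) = ennreal U"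
    using U' by simp
  then have sumH: "(\<Sum>i\<in>- {q}. H i) = U"
    using U(2) by (subst (asm) sum_ennreal) (auto simp: H_def sum_nonneg)
  let ?y = "x - (y $ q) *\<^sub>R axis q 1"
  have "(\<Sum>i\<in>- {q}. (- y $ i) *\<^sub>R axis i 1) + (- y $ q) *\<^sub>R axis q 1 = (\<Sum>i\<in>UNIV. (- y $ i) *\<^sub>R axis i 1)"
    by (subst sum.remove[of UNIV q]) (auto simp: Compl_eq_Diff_UNIV add.commute)
  also have "\<dots> = - y"
    by (simp add: vec_eq_iff axis_def if_distrib cong: if_cong)
  finally have eq: "x - y = ?y + (\<Sum>i\<in>- {q}. (- y $ i) *\<^sub>R axis i 1)"
    by (simp add: algebra_simps)
  have step: "norm (u (z + h *\<^sub>R axis i 1) - u z) \<le> H i * \<bar>h\<bar> powr l i" if "i \<in> - {q}" for i z h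
  proof (rule holder_seminorm_diff_le[OF l])
    show "holder_seminorm (l i) i u \<le> ennreal (H i)"
      unfolding fin[OF that] ..
  qed (simp add: H_def)
  have "norm (u (x - y) - u ?y) \<le> (\<Sum>i\<in>- {q}. H i * \<bar>- y $ i\<bar> powr l i)"
    unfolding eq by (rule holder_seminorm_sum_diff_le) (simp, rule step)
  also have "\<dots> \<le> (\<Sum>i\<in>- {q}. H i * aniso_modulus \<alpha> \<gamma> p q y)"
  proof (intro sum_mono mult_left_mono)
    fix i assume i: "i \<in> - {q}"
    show "\<bar>- y $ i\<bar> powr l i \<le> aniso_modulus \<alpha> \<gamma> p q y"
    proof (cases "i = p")
      case False
      have "(y $ i)\<^sup>2 \<le> (\<Sum>i\<in>- {p, q}. (y $ i)\<^sup>2)"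
        using False i by (intro member_le_sum) auto
      then have "\<bar>y $ i\<bar> \<le> sqrt (\<Sum>i\<in>- {p, q}. (y $ i)\<^sup>2)"
        using real_le_rsqrt by fastforce
      then have "\<bar>y $ i\<bar> powr \<gamma> \<le> sqrt (\<Sum>i\<in>- {p, q}. (y $ i)\<^sup>2) powr \<gamma>"
        using assms by (intro powr_mono2) auto
      then show ?thesis using False by (simp add: l_def aniso_modulus_def add_increasing2)
    qed (simp add: l_def aniso_modulus_def)
  qed (simp add: H_def)
  also have "\<dots> = U * aniso_modulus \<alpha> \<gamma> p q y"
    unfolding sumH[symmetric] sum_distrib_right ..
  finally show ?thesis .
qed

section \<open>Localised symbols: support, continuity and integrability\<close>

lemma integrable_continuous_compact_support:
  fixes f :: "'a::euclidean_space \<Rightarrow> complex"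
  assumes "continuous_on UNIV f" "compact K" "\<And>x. f x \<noteq> 0 \<Longrightarrow> x \<in> K"
  shows "integrable lborel f"
proof -
  have "integrable lborel (\<lambda>x. indicator K x *\<^sub>R f x)"
    by (intro borel_integrable_compact assms continuous_on_subset[OF assms(1)]) auto
  moreover have "(\<lambda>x. indicator K x *\<^sub>R f x) = f"
    using assms(3) by (auto simp: indicator_def fun_eq_iff)
  ultimately show ?thesis by simp
qed

lemma compact_adil_box:
  fixes s c :: "'n::finite \<Rightarrow> real"
  shows "compact {x. \<forall>i. \<bar>adil s j x $ i\<bar> \<le> c i}"
proof -
  have "\<bar>adil s j x $ i\<bar> \<le> c i \<longleftrightarrow> - (2 powr (- (j * s i)) * c i) \<le> x $ i \<and> x $ i \<le> 2 powr (- (j * s i)) * c i" for x i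
    unfolding abs_le_iff by (auto simp: powr_minus field_simps)
  then have "{x. \<forall>i. \<bar>adil s j x $ i\<bar> \<le> c i} =
      cbox (\<chi> i. - (2 powr (- (j * s i)) * c i)) (\<chi> i. 2 powr (- (j * s i)) * c i)"
    by (auto simp: mem_box_cart)
  then show ?thesis by simp
qed

lemma arho_coord_le:
  assumes s: "\<And>i. 0 < s i" and "arho s x \<le> r"
  shows "\<bar>x $ i\<bar> \<le> r powr s i"
proof -
  have "\<bar>x $ i\<bar> powr (1 / s i) \<le> arho s x"
    unfolding arho_def by (rule member_le_sum) auto
  then have "(\<bar>x $ i\<bar> powr (1 / s i)) powr s i \<le> r powr s i"
    using assms(2) s[of i] by (intro powr_mono2) auto
  then show ?thesis
    using s[of i] by (simp add: powr_powr)
qed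

lemma cutoff_continuous:
  assumes "cutoff \<omega>" shows "continuous_on {0..} \<omega>"
proof -
  obtain D where D: "\<And>t. t \<ge> 0 \<Longrightarrow> D 0 t = \<omega> t"
      "\<And>k t. t \<ge> 0 \<Longrightarrow> (D k has_real_derivative D (Suc k) t) (at t within {0..})"
    using assms unfolding cutoff_def smooth_halfline_def by blast
  have "continuous_on {0..} (D (0::nat))"
    unfolding continuous_on_eq_continuous_within using DERIV_continuous[OF D(2)] by auto
  then show ?thesis
    by (rule continuous_on_eq) (use D(1) in auto)
qed

lemma cutoff_bounds: "cutoff \<omega> \<Longrightarrow> 0 \<le> t \<Longrightarrow> 0 \<le> \<omega> t \<and> \<omega> t \<le> 1"
  by (simp add: cutoff_def)

lemma cutoff_eq_0: "cutoff \<omega> \<Longrightarrow> 0 \<le> t \<Longrightarrow> t \<le> 1 / 4 \<or> 4 \<le> t \<Longrightarrow> \<omega> t = 0"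
  unfolding cutoff_def by auto

lemma cutoff_eq_1: "cutoff \<omega> \<Longrightarrow> 1 / 2 \<le> t \<Longrightarrow> t \<le> 2 \<Longrightarrow> \<omega> t = 1"
  unfolding cutoff_def by auto

lemma symbol_piece_eq:
  "p \<noteq> q \<Longrightarrow> symbol_piece \<alpha> \<beta> p q \<omega> m j \<xi> =
     m \<xi> * complex_of_real (\<omega> (arho (dscale \<alpha> \<beta> p q) (adil (dscale \<alpha> \<beta> p q) (- j) \<xi>)))"
  by (simp add: symbol_piece_def dil_eq_adil rho_eq_arho)

lemma symbol_piece_support:
  assumes "p \<noteq> q" "0 < \<alpha>" "0 < \<beta>" and \<omega>: "cutoff \<omega>"
    and "symbol_piece \<alpha> \<beta> p q \<omega> m j \<xi> \<noteq> 0"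
  shows "\<bar>adil (dscale \<alpha> \<beta> p q) (- j) \<xi> $ i\<bar> \<le> 4 powr dscale \<alpha> \<beta> p q i"
proof (rule arho_coord_le)
  have "\<omega> (arho (dscale \<alpha> \<beta> p q) (adil (dscale \<alpha> \<beta> p q) (- j) \<xi>)) \<noteq> 0"
    using assms by (auto simp: symbol_piece_eq)
  then show "arho (dscale \<alpha> \<beta> p q) (adil (dscale \<alpha> \<beta> p q) (- j) \<xi>) \<le> 4"
    using cutoff_eq_0[OF \<omega> arho_nonneg] by (meson linear)
qed (use assms in \<open>simp add: dscale_pos\<close>)

text \<open>At the origin \<open>m\<close> may have any value, but the cut-off vanishes where the
  gauge is below 1/4. Continuity is glued from this open neighbourhood and the complement of the
  origin.\<close>

lemma symbol_piece_continuous: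
  fixes m :: "real ^ 'n::finite \<Rightarrow> complex"
  assumes pq: "p \<noteq> q" and pos: "0 < \<alpha>" "0 < \<beta>" and \<omega>: "cutoff \<omega>" and m: "continuous_on (- {0}) m"
  shows "continuous_on UNIV (symbol_piece \<alpha> \<beta> p q \<omega> m j)"
proof -
  let ?s = "dscale \<alpha> \<beta> p q" and ?S = "symbol_piece \<alpha> \<beta> p q \<omega> m j"
  let ?r = "\<lambda>\<xi>. arho ?s (adil ?s (- j) \<xi>)"
  have r: "continuous_on UNIV ?r"
    by (rule continuous_on_compose2[OF continuous_on_arho[of ?s UNIV] continuous_on_adil])
       (use pos in \<open>auto simp: dscale_pos\<close>)
  have "continuous_on (- {0}) ?S"
    unfolding symbol_piece_eq[OF pq]
    by (intro continuous_intros m continuous_on_compose2[OF cutoff_continuous[OF \<omega>]] continuous_on_subset[OF r])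
       (auto simp: arho_nonneg)
  moreover have "continuous_on {\<xi>. ?r \<xi> < 1 / 4} ?S"
  proof (rule continuous_on_eq[OF continuous_on_const])
    show "0 = ?S \<xi>" if "\<xi> \<in> {\<xi>. ?r \<xi> < 1 / 4}" for \<xi>
      using that cutoff_eq_0[OF \<omega> arho_nonneg[of ?s "adil ?s (- j) \<xi>"]] by (simp add: symbol_piece_eq[OF pq])
  qed
  moreover have "open {\<xi>. ?r \<xi> < 1 / 4}"
    by (intro open_Collect_less r continuous_on_const)
  ultimately have "continuous_on (- {0} \<union> {\<xi>. ?r \<xi> < 1 / 4}) ?S"
    by (intro continuous_on_open_Un) auto
  moreover have "?r 0 = 0"
    by (simp add: arho_def)
  then have "- {0} \<union> {\<xi>. ?r \<xi> < 1 / 4} = UNIV"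
    by auto
  ultimately show ?thesis by simp
qed

lemma symbol_piece_integrable:
  fixes m :: "real ^ 'n::finite \<Rightarrow> complex"
  assumes "p \<noteq> q" "0 < \<alpha>" "0 < \<beta>" "cutoff \<omega>" "continuous_on (- {0}) m"
  shows "integrable lborel (symbol_piece \<alpha> \<beta> p q \<omega> m j)"
proof (rule integrable_continuous_compact_support)
  show "compact {x. \<forall>i. \<bar>adil (dscale \<alpha> \<beta> p q) (- j) x $ i\<bar> \<le> 4 powr dscale \<alpha> \<beta> p q i}"
    by (rule compact_adil_box)
  show "x \<in> {x. \<forall>i. \<bar>adil (dscale \<alpha> \<beta> p q) (- j) x $ i\<bar> \<le> 4 powr dscale \<alpha> \<beta> p q i}"
    if "symbol_piece \<alpha> \<beta> p q \<omega> m j x \<noteq> 0" for x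
    using symbol_piece_support[OF assms(1-4) that] by simp
qed (rule symbol_piece_continuous[OF assms])

lemma symbol_piece_bounded:
  assumes "cutoff \<omega>" "p \<noteq> q" "\<And>\<xi>. \<xi> \<noteq> 0 \<Longrightarrow> norm (m \<xi>) \<le> M" "0 \<le> M"
  shows "norm (symbol_piece \<alpha> \<beta> p q \<omega> m j \<xi>) \<le> M"
proof (cases "\<xi> = 0")
  case True
  then have "symbol_piece \<alpha> \<beta> p q \<omega> m j \<xi> = 0"
    using cutoff_eq_0[OF assms(1)] assms(2) by (simp add: symbol_piece_eq arho_def)
  then show ?thesis using assms by simp
next
  case False
  let ?s = "dscale \<alpha> \<beta> p q"
  let ?w = "\<omega> (arho ?s (adil ?s (- j) \<xi>))"
  have "0 \<le> ?w \<and> ?w \<le> 1"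
    by (intro cutoff_bounds assms arho_nonneg)
  then have "norm (m \<xi>) * \<bar>?w\<bar> \<le> M * 1"
    using assms False by (intro mult_mono) auto
  then show ?thesis
    using assms by (simp add: symbol_piece_eq norm_mult)
qed

text \<open>The kernel integrates to zero over hyperplanes \<open>x $ q = const\<close>, so \<open>u (x - y)\<close> may be
  replaced by an increment of \<open>u\<close> in the remaining variables.\<close>

lemma localized_bound:
  fixes m u :: "real ^ 'n::finite \<Rightarrow> complex"
  assumes pq: "p \<noteq> q" and pos: "0 < \<alpha>" "\<alpha> \<le> 1" "0 < \<beta>" "0 < \<gamma>" "\<gamma> < 1" and \<omega>: "cutoff \<omega>"
    and m: "continuous_on (- {0}) m" "bounded (m ` (- {0}))" "\<And>t. t \<noteq> 0 \<Longrightarrow> m (axis q t) = 0"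
    and \<mu>: "0 < \<mu>"
      "(\<integral>\<^sup>+x. ennreal (kernel_weight \<alpha> \<gamma> p q x * cmod (kernel \<alpha> \<beta> p q \<omega> m j x)) \<partial>lborel) \<le> ennreal \<mu>"
    and u: "continuous_on UNIV u" "bounded (range u)" "compact (closure {x. u x \<noteq> 0})"
    and U: "holder_seminorm_dprime \<gamma> p q u + holder_seminorm (\<alpha> * \<gamma>) p u = ennreal U" "0 \<le> U"
  shows "norm (ft (\<lambda>\<xi>. symbol_piece \<alpha> \<beta> p q \<omega> m j \<xi> * fourier u \<xi>) x)
     \<le> (2 * pi) ^ CARD('n) * (2 powr (- (j * \<gamma>)) * \<mu> * U)"
proof -
  define S where "S = symbol_piece \<alpha> \<beta> p q \<omega> m j"
  define K where "K = inv_fourier S"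
  \<comment> \<open>This is the part of \<open>u (x - y)\<close> that depends on \<open>y\<close>
    through \<open>y $ q\<close> alone; pairing it with \<open>K\<close> tests a marginal of the
    kernel.\<close>
  define g where "g t = u (x - t *\<^sub>R axis q 1)" for t
  let ?c = "(2 * pi) ^ CARD('n)" and ?A = "aniso_modulus \<alpha> \<gamma> p q"
  obtain M where M: "norm (m \<xi>) \<le> M" if "\<xi> \<noteq> 0" for \<xi>
    using m(2) by (auto simp: bounded_iff)
  then have M': "norm (m \<xi>) \<le> \<bar>M\<bar>" if "\<xi> \<noteq> 0" for \<xi>
    using that by (meson abs_ge_self order_trans)
  have S: "integrable lborel S" "continuous_on UNIV S" "\<And>\<xi>. norm (S \<xi>) \<le> \<bar>M\<bar>"
    unfolding S_def
    by (rule symbol_piece_integrable symbol_piece_continuous symbol_piece_bounded; use pq pos \<omega> m M' in auto)+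
  have u_int: "integrable lborel u"
    by (rule integrable_continuous_compact_support[OF u(1,3)]) (use closure_subset[of "{x. u x \<noteq> 0}"] in auto)
  have ftS: "ft S y = ?c * K y" for y
    by (simp add: K_def inv_fourier_eq_ft)
  have K_eq: "K = (\<lambda>y. complex_of_real (1 / ?c) * ft S y)"
    by (simp add: K_def inv_fourier_eq_ft fun_eq_iff)
  have K_meas[measurable]: "K \<in> borel_measurable borel"
    using borel_measurable_ft[OF S(1)] unfolding K_eq by auto
  have K: "integrable lborel K"
      "(\<integral>\<^sup>+y. ennreal (?A y * cmod (K y)) \<partial>lborel) \<le> ennreal (2 powr (- (j * \<gamma>)) * \<mu>)"
    by (rule kernel_bound_rescaled[OF pq pos(1) K_meas[unfolded K_def S_def] \<mu>(2), folded S_def K_def])+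
  have ftS_int: "integrable lborel (ft S)"
    using K(1) unfolding ftS[abs_def] by simp
  \<comment> \<open>The hypothesis on \<open>m\<close> says nothing at t = 0; there the cut-off
    supplies the zero.\<close>
  have S0: "S (axis q t) = 0" for t
  proof (cases "t = 0")
    case True
    then show ?thesis
      using cutoff_eq_0[OF \<omega>] by (simp add: S_def symbol_piece_eq[OF pq] arho_def axis_def)
  qed (simp add: S_def symbol_piece_eq[OF pq] m)
  \<comment> \<open>Since \<open>K\<close> is a multiple of \<open>ft S\<close>, inversion returns
    the values of \<open>S\<close> on the \<open>q\<close>-axis. The integrability of
    \<open>ft S\<close> that inversion requires comes from the kernel bound.\<close>
  have ftK: "ft K (- (t *\<^sub>R axis q 1)) = 0" for t
  proof -
    have "t *\<^sub>R axis q 1 = (axis q t :: real ^ 'n)"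
      by (simp add: vec_eq_iff axis_def)
    moreover have "ft (ft S) (- (axis q t)) = (2 * pi) ^ DIM(real ^ 'n) * S (axis q t)"
      by (rule ft_inversion[OF S(2,3,1) ftS_int])
    ultimately show ?thesis
      unfolding K_eq ft_cmult by (simp add: S0)
  qed
  obtain B where B: "norm (u y) \<le> B" for y
    using u(2) by (auto simp: bounded_iff)
  have g_cont: "continuous_on UNIV g"
    unfolding g_def by (intro continuous_intros continuous_on_compose2[OF u(1)]) auto
  obtain R where R: "norm y \<le> R" if "u y \<noteq> 0" for y
    using compact_imp_bounded[OF u(3)] closure_subset[of "{x. u x \<noteq> 0}"] by (auto simp: bounded_iff)
  have g_int: "integrable lborel g"
  proof (rule integrable_continuous_compact_support[OF g_cont])
    show "compact {- (R + norm x)..R + norm x}" by simp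
    fix t assume "g t \<noteq> 0"
    then have "norm (x - t *\<^sub>R axis q 1) \<le> R" by (simp add: g_def R)
    then have "norm (t *\<^sub>R (axis q 1 :: real ^ 'n)) \<le> R + norm x"
      using norm_triangle_ineq2[of "t *\<^sub>R axis q 1" x] by (simp add: norm_minus_commute)
    then show "t \<in> {- (R + norm x)..R + norm x}" by auto
  qed
  have zero: "(LINT y|lborel. K y * g (y $ q)) = 0"
    using integral_marginal_eq_0[OF K(1) ftK g_cont g_int, of B] B by (simp add: g_def inner_axis)
  have [measurable]: "u \<in> borel_measurable borel" "g \<in> borel_measurable borel"
    using u_int g_int by auto
  have int1: "integrable lborel (\<lambda>y. K y * u (x - y))" and int2: "integrable lborel (\<lambda>y. K y * g (y $ q))"
  proof -
    have meas: "(\<lambda>y. y $ q) \<in> borel_measurable (borel :: (real ^ 'n) measure)"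
      by (intro borel_measurable_continuous_onI continuous_intros)
    show "integrable lborel (\<lambda>y. K y * u (x - y))"
      using integrable_bounded_mult[of "\<lambda>y. u (x - y)" K] B K(1) by (auto simp: bounded_iff mult.commute)
    show "integrable lborel (\<lambda>y. K y * g (y $ q))"
      using integrable_bounded_mult[of "\<lambda>y. g (y $ q)" K] B K(1) measurable_compose[OF meas, of g borel]
      by (auto simp: bounded_iff mult.commute g_def)
  qed
  have "ft (\<lambda>\<xi>. S \<xi> * fourier u \<xi>) x = ?c * (LINT y|lborel. K y * u (x - y))"
    unfolding ft_mult_fourier[OF S(1) u_int] ftS by (simp add: mult.assoc)
  also have "(LINT y|lborel. K y * u (x - y)) = (LINT y|lborel. K y * (u (x - y) - g (y $ q)))"
    using int1 int2 zero by (simp add: right_diff_distrib)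
  finally have eq: "ft (\<lambda>\<xi>. S \<xi> * fourier u \<xi>) x = ?c * (LINT y|lborel. K y * (u (x - y) - g (y $ q)))" .
  have "ennreal (norm (LINT y|lborel. K y * (u (x - y) - g (y $ q)))) \<le>
      (\<integral>\<^sup>+y. ennreal (norm (K y * (u (x - y) - g (y $ q)))) \<partial>lborel)"
    by (rule integral_norm_bound_nn_integral)
  also have "\<dots> \<le> (\<integral>\<^sup>+y. ennreal U * ennreal (?A y * cmod (K y)) \<partial>lborel)"
  proof (rule nn_integral_mono)
    fix y
    have "norm (K y) * norm (u (x - y) - g (y $ q)) \<le> norm (K y) * (U * ?A y)"
      unfolding g_def using holder_space_diff_le[OF pq pos(1,2,4,5) U] by (intro mult_left_mono) auto
    then show "ennreal (norm (K y * (u (x - y) - g (y $ q)))) \<le> ennreal U * ennreal (?A y * cmod (K y))"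
      using U(2) by (simp add: norm_mult ennreal_mult'[symmetric] mult_ac ennreal_leI)
  qed
  also have "\<dots> = ennreal U * (\<integral>\<^sup>+y. ennreal (?A y * cmod (K y)) \<partial>lborel)"
    by (rule nn_integral_cmult) measurable
  also have "\<dots> \<le> ennreal U * ennreal (2 powr (- (j * \<gamma>)) * \<mu>)"
    using K(2) by (rule mult_left_mono) simp
  finally have "norm (LINT y|lborel. K y * (u (x - y) - g (y $ q))) \<le> U * (2 powr (- (j * \<gamma>)) * \<mu>)"
    using U(2) \<mu>(1) by (simp add: ennreal_mult'[symmetric])
  then have "norm (ft (\<lambda>\<xi>. S \<xi> * fourier u \<xi>) x) \<le> ?c * (U * (2 powr (- (j * \<gamma>)) * \<mu>))"
    unfolding eq norm_mult by (simp add: norm_power norm_mult mult_left_mono)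
  then show ?thesis by (simp add: S_def mult_ac)
qed

subsection \<open>Summation of dyadic blocks\<close>

lemma sum_int_geometric_le:
  fixes y :: real
  assumes "0 \<le> y" "y < 1" "finite F"
  shows "(\<Sum>j\<in>F. y ^ nat \<bar>j\<bar>) \<le> 2 / (1 - y)"
proof -
  define n where "n = Max (insert 0 ((\<lambda>j. nat \<bar>j\<bar>) ` F))"
  have n: "nat \<bar>j\<bar> \<le> n" if "j \<in> F" for j
    unfolding n_def using assms(3) that by (intro Max_ge) auto
  have "F \<subseteq> int ` {..n} \<union> (\<lambda>k. - int k) ` {..n}"
  proof
    fix j assume "j \<in> F"
    from n[OF this] have "nat \<bar>j\<bar> \<in> {..n}" by simp
    moreover have "j = int (nat \<bar>j\<bar>) \<or> j = - int (nat \<bar>j\<bar>)" by linarith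
    ultimately show "j \<in> int ` {..n} \<union> (\<lambda>k. - int k) ` {..n}" by blast
  qed
  then have "(\<Sum>j\<in>F. y ^ nat \<bar>j\<bar>) \<le> (\<Sum>j\<in>int ` {..n} \<union> (\<lambda>k. - int k) ` {..n}. y ^ nat \<bar>j\<bar>)"
    using assms(1) by (intro sum_mono2) auto
  also have "\<dots> \<le> (\<Sum>j\<in>int ` {..n}. y ^ nat \<bar>j\<bar>) + (\<Sum>j\<in>(\<lambda>k. - int k) ` {..n}. y ^ nat \<bar>j\<bar>)"
    using assms(1) by (subst sum.union_inter[symmetric]) (auto intro: sum_nonneg)
  also have "\<dots> = 2 * (\<Sum>k\<le>n. y ^ k)"
    by (simp add: sum.reindex inj_on_def)
  also have "(\<Sum>k\<le>n. y ^ k) \<le> 1 / (1 - y)"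
  proof -
    have "(\<Sum>k\<le>n. y ^ k) = (\<Sum>k<Suc n. y ^ k)" by (simp only: lessThan_Suc_atMost)
    also have "\<dots> = (1 - y ^ Suc n) / (1 - y)"
      using assms by (subst sum_gp_strict) auto
    also have "\<dots> \<le> 1 / (1 - y)"
      using assms by (intro divide_right_mono) auto
    finally show ?thesis .
  qed
  finally show ?thesis by simp
qed

text \<open>The half-open range pairs n with -1 - n, which turns a two-sided sum into an ordinary
  series fit for the Weierstrass test.\<close>

lemma symmetric_sum_Suc:
  fixes f :: "int \<Rightarrow> 'a::comm_monoid_add"
  shows "(\<Sum>j\<in>{- int m..<int m}. f j) = (\<Sum>n<m. f (int n) + f (- 1 - int n))"
proof (induction m)
  case (Suc m)
  have "{- int (Suc m)..<int (Suc m)} = insert (- 1 - int m) (insert (int m) {- int m..<int m})"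
    by auto
  then show ?case using Suc by (simp add: add_ac)
qed simp

lemma symmetric_sum_uniform_limit:
  fixes f :: "int \<Rightarrow> 'a \<Rightarrow> complex"
  assumes bound: "\<And>j x. norm (f j x) \<le> E * y ^ nat \<bar>j\<bar>" and y: "0 \<le> y" "y < 1"
  shows "\<exists>V. uniform_limit UNIV (\<lambda>m x. \<Sum>j\<in>{- int m..<int m}. f j x) V sequentially"
proof
  show "uniform_limit UNIV (\<lambda>m x. \<Sum>j\<in>{- int m..<int m}. f j x)
     (\<lambda>x. suminf (\<lambda>n. f (int n) x + f (- 1 - int n) x)) sequentially"
    unfolding symmetric_sum_Suc
  proof (rule Weierstrass_m_test)
    fix n x
    have "norm (f (int n) x + f (- 1 - int n) x) \<le> E * y ^ n + E * y ^ Suc n"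
      using bound[of "int n" x] bound[of "- 1 - int n" x]
      by (intro norm_triangle_mono) (auto simp: nat_add_distrib abs_if)
    then show "norm (f (int n) x + f (- 1 - int n) x) \<le> (E + E * y) * y ^ n"
      by (simp add: algebra_simps)
  qed (use y in simp)
qed

text \<open>The first bound decays for j \<ge> 0 and the second for j < 0; taking the larger ratio
  merges them into one geometric bound in the modulus of j.\<close>

lemma dyadic_power_le:
  fixes \<tau> :: real
  assumes "\<tau> < 0" "0 < S" "a \<le> A * 2 powr (real_of_int j * \<tau>)" "a \<le> B * 2 powr (real_of_int j * S)" "0 \<le> A" "0 \<le> B"
  shows "a \<le> (A + B) * (max (2 powr \<tau>) (2 powr (- S))) ^ nat \<bar>j\<bar>"
proof -
  let ?y = "max (2 powr \<tau>) (2 powr (- S))"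
  have pow: "2 powr (real n * t) = (2 powr t) ^ n" for n t
    by (simp add: powr_powr[symmetric] powr_realpow[symmetric] mult.commute)
  show ?thesis
  proof (cases "0 \<le> j")
    case True
    then have "real_of_int j = real (nat \<bar>j\<bar>)" by simp
    then have "2 powr (j * \<tau>) = (2 powr \<tau>) ^ nat \<bar>j\<bar>"
      using pow by metis
    also have "\<dots> \<le> ?y ^ nat \<bar>j\<bar>" by (intro power_mono) auto
    finally have "A * 2 powr (j * \<tau>) \<le> (A + B) * ?y ^ nat \<bar>j\<bar>"
      using assms by (intro mult_mono) auto
    then show ?thesis using assms(3) by linarith
  next
    case False
    then have "real_of_int j * S = real (nat \<bar>j\<bar>) * (- S)" by simp
    then have "2 powr (j * S) = (2 powr (- S)) ^ nat \<bar>j\<bar>"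
      using pow by metis
    also have "\<dots> \<le> ?y ^ nat \<bar>j\<bar>" by (intro power_mono) auto
    finally have "B * 2 powr (j * S) \<le> (A + B) * ?y ^ nat \<bar>j\<bar>"
      using assms by (intro mult_mono) auto
    then show ?thesis using assms(4) by linarith
  qed
qed

text \<open>Both regimes of the minimum sum geometrically; they balance at \<open>2 powr (j * \<sigma>) = 1 / h\<close>.\<close>

lemma dyadic_min_sum_le:
  fixes \<sigma> \<theta> :: real
  assumes \<sigma>: "0 < \<sigma>" and \<theta>: "0 < \<theta>" "\<theta> < 1"
  shows "\<exists>K>0. \<forall>h>0. \<forall>F. finite F \<longrightarrow>
    (\<Sum>j\<in>F. min 1 (h * 2 powr (real_of_int j * \<sigma>)) * 2 powr (- (real_of_int j * \<sigma> * \<theta>))) \<le> K * h powr \<theta>"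
proof -
  let ?a = "2 powr \<sigma>" and ?y = "max (2 powr (- (\<sigma> * \<theta>))) (2 powr (- (\<sigma> * (1 - \<theta>))))"
  have y: "0 \<le> ?y" "?y < 1"
    using \<sigma> \<theta> by (auto simp: powr_less_one le_max_iff_disj)
  have a: "1 \<le> ?a" using \<sigma> by (simp add: ge_one_powr_ge_zero)
  define K where "K = ?a * (2 * (2 / (1 - ?y)))"
  have "0 < K" using y(2) by (simp add: K_def)
  moreover have "(\<Sum>j\<in>F. min 1 (h * 2 powr (real_of_int j * \<sigma>)) * 2 powr (- (real_of_int j * \<sigma> * \<theta>))) \<le> K * h powr \<theta>"
    if h: "0 < h" and F: "finite F" for h F
  proof -
    \<comment> \<open>The balancing index rounded up: \<open>c\<close> then lies between 1 and 2
      powr \<sigma>. Shifting the summation index by \<open>J\<close> turns h into its power h powr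
      \<theta> and leaves a sum independent of h.\<close>
    define J where "J = \<lceil>- log 2 h / \<sigma>\<rceil>"
    define c where "c = h * 2 powr (J * \<sigma>)"
    have hp: "h = 2 powr (log 2 h)" using h by simp
    have c_eq: "c = 2 powr (log 2 h + J * \<sigma>)"
      using hp by (simp add: c_def powr_add)
    have "- log 2 h / \<sigma> \<le> J" "J < - log 2 h / \<sigma> + 1"
      unfolding J_def by linarith+
    then have "- log 2 h \<le> J * \<sigma>" "J * \<sigma> \<le> - log 2 h + \<sigma>"
      using \<sigma> by (simp_all add: field_simps)
    then have c: "1 \<le> c" "c \<le> ?a"
      unfolding c_eq by (auto intro!: ge_one_powr_ge_zero powr_mono)
    have block: "min 1 (h * 2 powr (j * \<sigma>)) * 2 powr (- (j * \<sigma> * \<theta>)) \<le> ?a * h powr \<theta> * (2 * ?y ^ nat \<bar>j - J\<bar>)" for j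
    proof -
      define i where "i = j - J"
      have j: "real_of_int j = i + J" by (simp add: i_def)
      have "h * 2 powr (j * \<sigma>) = c * 2 powr (i * \<sigma>)"
        by (simp add: c_def j distrib_right powr_add)
      also have "min 1 \<dots> \<le> ?a * min 1 (2 powr (i * \<sigma>))"
      proof -
        have "min 1 A \<le> b * min 1 P" if "A \<le> b * P" "1 \<le> b" for A b P :: real
          using that by (auto simp: min_def)
        moreover have "c * 2 powr (i * \<sigma>) \<le> ?a * 2 powr (i * \<sigma>)" using c(2) by (rule mult_right_mono) simp
        ultimately show ?thesis using a by blast
      qed
      finally have 1: "min 1 (h * 2 powr (j * \<sigma>)) \<le> ?a * min 1 (2 powr (i * \<sigma>))" .
      have "2 powr (- (J * \<sigma> * \<theta>)) = (2 powr (- (J * \<sigma>))) powr \<theta>"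
        by (simp add: powr_powr)
      also have "\<dots> \<le> h powr \<theta>"
        using c(1) h \<theta> by (intro powr_mono2) (auto simp: c_def powr_minus field_simps)
      finally have "2 powr (- (i * \<sigma> * \<theta>)) * 2 powr (- (J * \<sigma> * \<theta>)) \<le> 2 powr (- (i * \<sigma> * \<theta>)) * h powr \<theta>"
        by (rule mult_left_mono) simp
      moreover have "- (j * \<sigma> * \<theta>) = - (i * \<sigma> * \<theta>) + - (J * \<sigma> * \<theta>)"
        by (simp add: j distrib_right)
      ultimately have "2 powr (- (j * \<sigma> * \<theta>)) \<le> 2 powr (- (i * \<sigma> * \<theta>)) * h powr \<theta>"
        by (simp only: powr_add)
      with 1 have "min 1 (h * 2 powr (j * \<sigma>)) * 2 powr (- (j * \<sigma> * \<theta>)) \<le>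
          (?a * min 1 (2 powr (i * \<sigma>))) * (2 powr (- (i * \<sigma> * \<theta>)) * h powr \<theta>)"
        using h by (intro mult_mono) auto
      also have "\<dots> = ?a * h powr \<theta> * (min 1 (2 powr (i * \<sigma>)) * 2 powr (- (i * \<sigma> * \<theta>)))"
        by simp
      also have "min 1 (2 powr (i * \<sigma>)) * 2 powr (- (i * \<sigma> * \<theta>)) \<le> (1 + 1) * ?y ^ nat \<bar>i\<bar>"
      proof -
        have "max (2 powr (- (\<sigma> * \<theta>))) (2 powr - (\<sigma> * (1 - \<theta>))) = ?y" by simp
        moreover have "min 1 (2 powr (i * \<sigma>)) * 2 powr (- (i * \<sigma> * \<theta>)) \<le> 1 * 2 powr (i * - (\<sigma> * \<theta>))"
          by (simp add: mult.assoc mult_left_le_one_le)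
        moreover have "min 1 (2 powr (i * \<sigma>)) * 2 powr (- (i * \<sigma> * \<theta>)) \<le> 2 powr (i * \<sigma>) * 2 powr (- (i * \<sigma> * \<theta>))"
          by (intro mult_right_mono) auto
        then have "min 1 (2 powr (i * \<sigma>)) * 2 powr (- (i * \<sigma> * \<theta>)) \<le> 1 * 2 powr (i * (\<sigma> * (1 - \<theta>)))"
          by (simp add: powr_add[symmetric] algebra_simps)
        ultimately show ?thesis
          using \<sigma> \<theta> by (intro dyadic_power_le) auto
      qed
      finally show ?thesis using h by (simp add: i_def mult_left_mono)
    qed
    have "(\<Sum>j\<in>F. min 1 (h * 2 powr (j * \<sigma>)) * 2 powr (- (j * \<sigma> * \<theta>))) \<le> (\<Sum>j\<in>F. ?a * h powr \<theta> * (2 * ?y ^ nat \<bar>j - J\<bar>))"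
      by (intro sum_mono block)
    also have "\<dots> = ?a * h powr \<theta> * (2 * (\<Sum>j\<in>F. ?y ^ nat \<bar>j - J\<bar>))"
      by (simp only: sum_distrib_left)
    also have "(\<Sum>j\<in>F. ?y ^ nat \<bar>j - J\<bar>) = (\<Sum>i\<in>(\<lambda>j. j - J) ` F. ?y ^ nat \<bar>i\<bar>)"
      by (subst sum.reindex) (auto simp: inj_on_def)
    also have "\<dots> \<le> 2 / (1 - ?y)"
      using F by (intro sum_int_geometric_le y) auto
    finally show ?thesis
      using h by (simp add: K_def mult_ac mult_left_mono)
  qed
  ultimately show ?thesis by blast
qed

lemma partial_deriv_limit:
  fixes P :: "nat \<Rightarrow> real ^ 'n::finite \<Rightarrow> complex"
  assumes der: "\<And>m x t. ((\<lambda>t. P m (x + t *\<^sub>R axis i 1)) has_vector_derivative P' m (x + t *\<^sub>R axis i 1)) (at t)"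
    and P: "\<And>x. (\<lambda>m. P m x) \<longlonglongrightarrow> V x" and P': "uniform_limit UNIV P' V' sequentially"
  shows "((\<lambda>t. V (x + t *\<^sub>R axis i 1)) has_vector_derivative V' (x + t *\<^sub>R axis i 1)) (at t)"
proof -
  let ?l = "\<lambda>t. x + t *\<^sub>R axis i 1"
  have "\<exists>g. \<forall>t\<in>UNIV. (\<lambda>m. P m (?l t)) \<longlonglongrightarrow> g t \<and> (g has_derivative (\<lambda>h. h *\<^sub>R V' (?l t))) (at t)"
  proof (rule has_derivative_sequence[where ?x0.0 = 0 and l = "V (?l 0)"])
    show "((\<lambda>t. P m (?l t)) has_derivative (\<lambda>h. h *\<^sub>R P' m (?l t))) (at t)" for m t
      using der unfolding has_vector_derivative_def .
    fix e :: real assume "0 < e"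
    with P' have "\<forall>\<^sub>F m in sequentially. \<forall>x\<in>UNIV. dist (P' m x) (V' x) < e"
      by (rule uniform_limitD)
    then show "\<forall>\<^sub>F m in sequentially. \<forall>t\<in>UNIV. \<forall>h. norm (h *\<^sub>R P' m (?l t) - h *\<^sub>R V' (?l t)) \<le> e * norm h"
    proof eventually_elim
      case (elim m)
      show ?case
      proof (intro ballI allI)
        fix t h
        have "norm (P' m (?l t) - V' (?l t)) \<le> e"
          using elim by (simp add: dist_norm less_imp_le)
        then have "\<bar>h\<bar> * norm (P' m (?l t) - V' (?l t)) \<le> \<bar>h\<bar> * e"
          by (rule mult_left_mono) simp
        then show "norm (h *\<^sub>R P' m (?l t) - h *\<^sub>R V' (?l t)) \<le> e * norm h"
          by (simp add: scaleR_diff_right[symmetric] mult.commute)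
      qed
    qed
  qed (use P in auto)
  then obtain g where g: "\<And>t. (\<lambda>m. P m (?l t)) \<longlonglongrightarrow> g t" "\<And>t. (g has_derivative (\<lambda>h. h *\<^sub>R V' (?l t))) (at t)"
    by auto
  have "g = (\<lambda>t. V (?l t))"
    using LIMSEQ_unique[OF g(1) P] by blast
  then show ?thesis
    using g(2) by (simp add: has_vector_derivative_def)
qed

lemma norm_diff_le_line_derivative:
  fixes f :: "real ^ 'n::finite \<Rightarrow> complex"
  assumes der: "\<And>t. ((\<lambda>t. f (x + t *\<^sub>R e)) has_vector_derivative f' (x + t *\<^sub>R e)) (at t)"
    and B: "\<And>x. norm (f' x) \<le> B" and "0 < h"
  shows "norm (f (x + h *\<^sub>R e) - f x) \<le> h * B"
proof -
  have "norm (f (x + h *\<^sub>R e) - f (x + 0 *\<^sub>R e)) \<le> h * B - 0 * B"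
  proof (rule differentiable_bound_general[OF \<open>0 < h\<close>])
    show "continuous_on {0..h} (\<lambda>t. f (x + t *\<^sub>R e))"
      using der has_vector_derivative_continuous by (blast intro: continuous_at_imp_continuous_on)
    show "((\<lambda>t. t * B) has_vector_derivative B) (at t)" for t
      by (auto intro!: derivative_eq_intros simp: has_real_derivative_iff_has_vector_derivative[symmetric])
  qed (use der B in \<open>auto intro!: continuous_intros\<close>)
  then show ?thesis by simp
qed

text \<open>\<open>f j r\<close> stands for the derivative of order \<open>r\<close> of block
  \<open>j\<close> in direction \<open>i\<close>. The 4 is the factor 2 R of Bernstein's inequality
  with R equal to twice 2 powr (j \<sigma>). The bound with \<open>D\<close> carries the estimate;
  the bound with \<open>D'\<close> secures convergence at low frequencies.\<close>

definition dyadic_blocks ::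
    "real \<Rightarrow> real \<Rightarrow> real \<Rightarrow> real \<Rightarrow> real \<Rightarrow> 'n \<Rightarrow> (int \<Rightarrow> nat \<Rightarrow> real ^ 'n::finite \<Rightarrow> complex) \<Rightarrow> bool" where
  "dyadic_blocks \<sigma> \<gamma> D D' S i f \<longleftrightarrow> 0 \<le> D \<and> 0 \<le> D' \<and> 0 < S \<and>
     (\<forall>j r x t. ((\<lambda>t. f j r (x + t *\<^sub>R axis i 1)) has_vector_derivative f j (Suc r) (x + t *\<^sub>R axis i 1)) (at t)) \<and>
     (\<forall>j r x. norm (f j r x) \<le> (4 * 2 powr (j * \<sigma>)) ^ r * (D * 2 powr (- (j * \<gamma>)))) \<and>
     (\<forall>j r x. norm (f j r x) \<le> (4 * 2 powr (j * \<sigma>)) ^ r * (D' * 2 powr (j * S)))"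

text \<open>Let k be the floor of \<gamma> / \<sigma>. Derivatives up to order k sum uniformly,
  because \<sigma> k < \<gamma>. An increment of the k-th derivative is estimated blockwise by the
  supremum or by the mean value theorem at order k + 1, whichever is smaller. Non-integrality puts
  the remaining exponent strictly between 0 and 1, where both regimes sum. The mean value bound
  handles low frequencies in the increments, so the constant involves \<open>D\<close>
  alone.\<close>

theorem dyadic_synthesis:
  fixes \<sigma> \<gamma> :: real
  assumes \<sigma>: "0 < \<sigma>" and \<gamma>: "0 < \<gamma>" and nonint: "\<gamma> / \<sigma> \<notin> \<int>"
  shows "\<exists>C>0. \<forall>(f :: int \<Rightarrow> nat \<Rightarrow> real ^ 'n::finite \<Rightarrow> complex) i D D' S v.
    dyadic_blocks \<sigma> \<gamma> D D' S i f \<longrightarrow>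
    (\<forall>x. (\<lambda>m. \<Sum>j\<in>{- int m..<int m}. f j 0 x) \<longlonglongrightarrow> v x) \<longrightarrow>
    holder_seminorm (\<gamma> / \<sigma>) i v \<le> ennreal (C * D)"
proof -
  define l where "l = \<gamma> / \<sigma>"
  define k where "k = nat \<lfloor>l\<rfloor>"
  define \<theta> where "\<theta> = l - k"
  have "0 < l" using \<sigma> \<gamma> by (simp add: l_def)
  then have kl: "real k = \<lfloor>l\<rfloor>" by (simp add: k_def)
  moreover have "real_of_int \<lfloor>l\<rfloor> \<noteq> l" using nonint by (metis Ints_of_int l_def)
  ultimately have \<theta>: "0 < \<theta>" "\<theta> < 1"
    unfolding \<theta>_def by linarith+
  have \<gamma>_eq: "\<gamma> = \<sigma> * k + \<sigma> * \<theta>"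
    using \<sigma> by (simp add: \<theta>_def l_def algebra_simps)
  obtain K where K: "0 < K" "\<And>h F. 0 < h \<Longrightarrow> finite F \<Longrightarrow>
    (\<Sum>j\<in>F. min 1 (h * 2 powr (real_of_int j * \<sigma>)) * 2 powr (- (real_of_int j * \<sigma> * \<theta>))) \<le> K * h powr \<theta>"
    using dyadic_min_sum_le[OF \<sigma> \<theta>] by blast
  have "holder_seminorm l i v \<le> ennreal (4 ^ Suc k * K * D)"
    if blocks: "dyadic_blocks \<sigma> \<gamma> D D' S i f"
    and v: "\<And>x. (\<lambda>m. \<Sum>j\<in>{- int m..<int m}. f j 0 x) \<longlonglongrightarrow> v x"
    for f :: "int \<Rightarrow> nat \<Rightarrow> real ^ 'n \<Rightarrow> complex" and i D D' S v
  proof -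
    have D: "0 \<le> D" "0 \<le> D'" and S: "0 < S"
      and der: "\<And>j r x t. ((\<lambda>t. f j r (x + t *\<^sub>R axis i 1)) has_vector_derivative f j (Suc r) (x + t *\<^sub>R axis i 1)) (at t)"
      and hi: "\<And>j r x. norm (f j r x) \<le> (4 * 2 powr (real_of_int j * \<sigma>)) ^ r * (D * 2 powr (- (j * \<gamma>)))"
      and lo: "\<And>j r x. norm (f j r x) \<le> (4 * 2 powr (real_of_int j * \<sigma>)) ^ r * (D' * 2 powr (j * S))"
      using blocks unfolding dyadic_blocks_def by blast+
    define P where "P r m x = (\<Sum>j\<in>{- int m..<int m}. f j r x)" for r m x
    have pw: "(4 * 2 powr (real_of_int j * \<sigma>)) ^ r * (d * 2 powr (real_of_int j * t)) = 4 ^ r * d * 2 powr (j * (\<sigma> * r + t))" for j r d t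
      by (simp add: power_mult_distrib powr_realpow[symmetric] powr_powr powr_add distrib_left mult_ac)
    have hi': "norm (f j r x) \<le> 4 ^ r * D * 2 powr (real_of_int j * (\<sigma> * r - \<gamma>))" for j r x
      by (rule ord_le_eq_trans[OF hi]) (use pw[of j r D "- \<gamma>"] in simp)
    have lo': "norm (f j r x) \<le> 4 ^ r * D' * 2 powr (real_of_int j * (\<sigma> * r + S))" for j r x
      by (rule ord_le_eq_trans[OF lo pw])
    have ex: "\<exists>V. uniform_limit UNIV (P r) V sequentially" if "r \<le> k" for r
    proof -
      let ?y = "max (2 powr (\<sigma> * r - \<gamma>)) (2 powr (- (\<sigma> * r + S)))"
      have neg: "\<sigma> * r - \<gamma> < 0"
      proof -
        have "\<sigma> * r \<le> \<sigma> * k" using that \<sigma> by simp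
        moreover have "0 < \<sigma> * \<theta>" using \<sigma> \<theta> by simp
        ultimately show ?thesis unfolding \<gamma>_eq by linarith
      qed
      have pos: "0 < \<sigma> * r + S" using \<sigma> S by (simp add: add_nonneg_pos)
      have "norm (f j r x) \<le> (4 ^ r * D + 4 ^ r * D') * ?y ^ nat \<bar>j\<bar>" for j x
        using hi'[of j r x] lo'[of j r x] D by (intro dyadic_power_le neg pos) simp_all
      then show ?thesis
        unfolding P_def
        by (rule symmetric_sum_uniform_limit) (use neg pos in \<open>auto simp: powr_less_one le_max_iff_disj\<close>)
    qed
    \<comment> \<open>At order 0 the limit has to be the given \<open>v\<close>, so that iterated
      partial derivatives of \<open>v\<close> itself are obtained. The other limits are chosen from
      \<open>ex\<close>.\<close>
    define V where "V r = (if r = 0 then v else SOME V. uniform_limit UNIV (P r) V sequentially)" for r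
    have V_tendsto: "(\<lambda>m. P r m x) \<longlonglongrightarrow> V r x" if "r \<le> k" for r x
    proof (cases "r = 0")
      case False
      then show ?thesis
        using someI_ex[OF ex[OF that]] by (auto simp: V_def intro: tendsto_uniform_limitI)
    qed (use v in \<open>simp add: V_def P_def\<close>)
    have V: "uniform_limit UNIV (P r) (V r) sequentially" if r: "r \<le> k" for r
    proof -
      obtain W where W: "uniform_limit UNIV (P r) W sequentially" using ex[OF r] ..
      moreover have "W = V r"
        using LIMSEQ_unique[OF tendsto_uniform_limitI[OF W] V_tendsto[OF r]] by blast
      ultimately show ?thesis by simp
    qed
    have P_der: "((\<lambda>t. P r m (x + t *\<^sub>R axis i 1)) has_vector_derivative P (Suc r) m (x + t *\<^sub>R axis i 1)) (at t)" for r m x t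
      unfolding P_def by (intro has_vector_derivative_sum der)
    have V_der: "((\<lambda>t. V r (x + t *\<^sub>R axis i 1)) has_vector_derivative V (Suc r) (x + t *\<^sub>R axis i 1)) (at t)"
      if "Suc r \<le> k" for r x t
      using that by (intro partial_deriv_limit[OF P_der V_tendsto V]) auto
    have pd: "(partial_deriv i ^^ r) v = V r" if "r \<le> k" for r
      using that
    proof (induction r)
      case (Suc r)
      then show ?case
        using vector_derivative_at[OF V_der[of r _ 0]] by (simp add: partial_deriv_def fun_eq_iff)
    qed (simp add: V_def)
    have "partially_differentiable k i v"
      unfolding partially_differentiable_def
    proof (intro allI impI)
      fix r x assume "r < k"
      then have "((\<lambda>t. V r (x + t *\<^sub>R axis i 1)) has_vector_derivative V (Suc r) (x + 0 *\<^sub>R axis i 1)) (at 0)"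
        by (intro V_der) auto
      then show "(\<lambda>t. (partial_deriv i ^^ r) v (x + t *\<^sub>R axis i 1)) differentiable at 0"
        using pd[of r] \<open>r < k\<close> by (auto intro: differentiableI_vector)
    qed
    then have norm_eq: "holder_seminorm l i v =
       (SUP x. SUP h\<in>{0<..}. ennreal (cmod (V k (x + h *\<^sub>R axis i 1) - V k x) / h powr \<theta>))"
      using pd[of k] by (simp add: holder_seminorm_def k_def[symmetric] \<theta>_def Let_def)
    have incr: "cmod (V k (x + h *\<^sub>R axis i 1) - V k x) \<le> 4 ^ Suc k * K * D * h powr \<theta>" if h: "0 < h" for x h
    proof (rule LIMSEQ_le_const2)
      show "(\<lambda>m. cmod (P k m (x + h *\<^sub>R axis i 1) - P k m x)) \<longlonglongrightarrow> cmod (V k (x + h *\<^sub>R axis i 1) - V k x)"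
        by (intro tendsto_intros V_tendsto) auto
      have "cmod (P k m (x + h *\<^sub>R axis i 1) - P k m x) \<le> 4 ^ Suc k * K * D * h powr \<theta>" for m
      proof -
        have "cmod (P k m (x + h *\<^sub>R axis i 1) - P k m x) = cmod (\<Sum>j\<in>{- int m..<int m}. f j k (x + h *\<^sub>R axis i 1) - f j k x)"
          by (simp add: P_def sum_subtractf)
        also have "\<dots> \<le> (\<Sum>j\<in>{- int m..<int m}. 4 ^ Suc k * D * (min 1 (h * 2 powr (real_of_int j * \<sigma>)) * 2 powr (- (real_of_int j * \<sigma> * \<theta>))))"
        proof (rule sum_norm_le)
          fix j
          let ?w = "4 ^ k * D * 2 powr (- (real_of_int j * \<sigma> * \<theta>))"
          have w0: "0 \<le> ?w" using D by simp
          have w: "cmod (f j k y) \<le> ?w" for y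
            using hi'[of j k y] by (simp add: \<gamma>_eq mult.assoc)
          have "real_of_int j * (\<sigma> * Suc k - \<gamma>) = real_of_int j * \<sigma> + - (real_of_int j * \<sigma> * \<theta>)"
            by (simp add: \<gamma>_eq algebra_simps)
          then have "2 powr (real_of_int j * (\<sigma> * Suc k - \<gamma>)) = 2 powr (j * \<sigma>) * 2 powr (- (real_of_int j * \<sigma> * \<theta>))"
            by (simp only: powr_add)
          then have "cmod (f j (Suc k) y) \<le> 4 * 2 powr (j * \<sigma>) * ?w" for y
            using hi'[of j "Suc k" y] by (simp add: mult_ac)
          then have "cmod (f j k (x + h *\<^sub>R axis i 1) - f j k x) \<le> h * (4 * 2 powr (j * \<sigma>) * ?w)"
            by (rule norm_diff_le_line_derivative[OF der _ h])
          moreover have "cmod (f j k (x + h *\<^sub>R axis i 1) - f j k x) \<le> ?w + ?w"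
            by (rule order_trans[OF norm_triangle_ineq4]) (intro add_mono w)
          \<comment> \<open>The common factor 4 covers both the 2 of the triangle inequality and the
            4 of the derivative bound.\<close>
          ultimately have "cmod (f j k (x + h *\<^sub>R axis i 1) - f j k x) \<le> 4 * ?w * min 1 (h * 2 powr (real_of_int j * \<sigma>))"
            using w0 by (auto simp: min_def mult_ac)
          then show "cmod (f j k (x + h *\<^sub>R axis i 1) - f j k x) \<le>
             4 ^ Suc k * D * (min 1 (h * 2 powr (real_of_int j * \<sigma>)) * 2 powr (- (real_of_int j * \<sigma> * \<theta>)))"
            by (simp add: mult_ac)
        qed
        also have "\<dots> \<le> 4 ^ Suc k * D * (K * h powr \<theta>)"
          unfolding sum_distrib_left[symmetric] using D h by (intro mult_left_mono K(2)) auto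
        finally show ?thesis by (simp add: mult_ac)
      qed
      then show "\<exists>N. \<forall>m\<ge>N. cmod (P k m (x + h *\<^sub>R axis i 1) - P k m x) \<le> 4 ^ Suc k * K * D * h powr \<theta>"
        by blast
    qed
    show ?thesis
      unfolding norm_eq
    proof (intro SUP_least)
      fix x and h :: real assume "h \<in> {0<..}"
      then show "ennreal (cmod (V k (x + h *\<^sub>R axis i 1) - V k x) / h powr \<theta>) \<le> ennreal (4 ^ Suc k * K * D)"
        using incr[of h x] by (intro ennreal_leI) (simp add: field_simps)
    qed
  qed
  moreover have "0 < 4 ^ Suc k * K" using K(1) by simp
  ultimately show ?thesis
    unfolding l_def by blast
qed

subsection \<open>Dyadic blocks of a multiplier\<close>

definition block :: "('n::finite \<Rightarrow> real) \<Rightarrow> (real ^ 'n \<Rightarrow> complex) \<Rightarrow> int \<Rightarrow> real ^ 'n \<Rightarrow> complex" where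
  "block s g j \<xi> = complex_of_real (annular s (adil s (- j) \<xi>)) * g \<xi>"

lemma block_support:
  assumes s: "\<And>i. 0 < s i" and "block s g j \<xi> \<noteq> 0"
  shows "\<bar>\<xi> $ i\<bar> \<le> 2 * 2 powr (real_of_int j * s i)"
proof -
  have "annular s (adil s (- j) \<xi>) \<noteq> 0"
    using assms(2) by (auto simp: block_def)
  then have "\<bar>adil s (- j) \<xi> $ i\<bar> \<le> 2"
    by (rule annular_neq_0(1)[of s, OF s])
  then show ?thesis
    by (simp add: abs_mult powr_minus field_simps)
qed

lemma borel_measurable_annular [measurable]:
  "annular s \<in> borel_measurable (borel :: (real ^ 'n::finite) measure)"
proof -
  have "continuous_on UNIV (low_pass :: real ^ 'n \<Rightarrow> real)"
    unfolding low_pass_def plateau_def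
    by (intro continuous_intros continuous_on_compose2[OF continuous_on_tent[of UNIV]]) auto
  then have [measurable]: "low_pass \<in> borel_measurable (borel :: (real ^ 'n) measure)"
    by (rule borel_measurable_continuous_onI)
  show ?thesis unfolding annular_def by measurable
qed

lemma annular_bound: "\<bar>annular s (x :: real ^ 'n::finite)\<bar> \<le> 2 * 3 ^ CARD('n)"
  using low_pass_bound[of x] low_pass_bound[of "adil s 1 x"] unfolding annular_def by linarith

lemma annular_sum_bound: "\<bar>\<Sum>j\<in>{- int n..<int n}. annular s (adil s (- j) (x :: real ^ 'n::finite))\<bar> \<le> 2 * 3 ^ CARD('n)"
  using low_pass_bound[of "adil s (1 - int n) x"] low_pass_bound[of "adil s (1 + int n) x"]
  unfolding annular_telescope by linarith

text \<open>Supremum times volume of the frequency box, whose sides are 4 times 2 powr (j s i). The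
  bound tends to 0 as j tends to minus infinity, where the one from the kernel hypothesis blows up.
  The base 8 absorbs the leading 2, as 2 is at most its power with exponent
  \<open>CARD('n)\<close>.\<close>

lemma block_integrable_lo:
  fixes g :: "real ^ 'n::finite \<Rightarrow> complex"
  assumes s: "\<And>i. 0 < s i" and g: "g \<in> borel_measurable borel" "\<And>\<xi>. \<xi> \<noteq> 0 \<Longrightarrow> norm (g \<xi>) \<le> B" "0 \<le> B"
  shows "integrable lborel (block s g j)"
    and "norm (ft (block s g j) x) \<le> 8 ^ CARD('n) * 3 ^ CARD('n) * B * 2 powr (real_of_int j * (\<Sum>i\<in>UNIV. s i))"
proof -
  let ?N = "CARD('n)"
  let ?b = "\<chi> i. 2 * 2 powr (real_of_int j * s i)"
  let ?Q = "cbox (- ?b) ?b :: (real ^ 'n) set"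
  have bound: "norm (block s g j \<xi>) \<le> 2 * 3 ^ ?N * B * indicator ?Q \<xi>" for \<xi>
  proof (cases "block s g j \<xi> = 0")
    case False
    then have "annular s (adil s (- j) \<xi>) \<noteq> 0" by (auto simp: block_def)
    \<comment> \<open>The bound on \<open>g\<close> is available off the origin only; at the origin
      the two low-pass values coincide, so the block vanishes there.\<close>
    moreover have "annular s (adil s (- j) 0 :: real ^ 'n) = 0"
    proof -
      have "adil s k 0 = 0" for k by (simp add: vec_eq_iff)
      then show ?thesis by (simp add: annular_def)
    qed
    ultimately have "\<xi> \<noteq> 0" by auto
    have "\<xi> \<in> ?Q"
      using block_support[of s, OF s False] by (simp add: mem_box_cart abs_le_iff minus_le_iff)
    moreover have "\<bar>annular s (adil s (- j) \<xi>)\<bar> * norm (g \<xi>) \<le> 2 * 3 ^ ?N * B"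
      using g(2)[OF \<open>\<xi> \<noteq> 0\<close>] by (intro mult_mono annular_bound) auto
    ultimately show ?thesis by (simp add: block_def norm_mult)
  qed (use g in simp)
  have int_Q: "integrable lborel (\<lambda>\<xi>. 2 * 3 ^ ?N * B * indicator ?Q \<xi> :: real)"
    by (intro integrable_mult_right integrable_real_indicator) (simp_all add: emeasure_lborel_cbox_finite[simplified])
  have meas: "block s g j \<in> borel_measurable lborel"
    unfolding block_def using g(1) by measurable
  show int: "integrable lborel (block s g j)"
  proof (rule Bochner_Integration.integrable_bound[OF int_Q meas])
    show "AE \<xi> in lborel. norm (block s g j \<xi>) \<le> norm (2 * 3 ^ ?N * B * indicator ?Q \<xi> :: real)"
      unfolding real_norm_def by (intro AE_I2 order_trans[OF bound abs_ge_self])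
  qed
  have ne: "?Q \<noteq> {}"
    by (simp add: interval_ne_empty_cart)
  have "norm (ft (block s g j) x) \<le> (LINT \<xi>|lborel. norm (block s g j \<xi>))"
    by (rule norm_ft_le)
  also have "\<dots> \<le> (LINT \<xi>|lborel. 2 * 3 ^ ?N * B * indicator ?Q \<xi>)"
    using bound int int_Q by (intro integral_mono) auto
  also have "\<dots> = 2 * 3 ^ ?N * B * (\<Prod>i\<in>UNIV. 4 * 2 powr (real_of_int j * s i))"
    using content_cbox_cart[OF ne] by (simp add: field_simps)
  also have "\<dots> = 2 * 3 ^ ?N * B * (4 ^ ?N * 2 powr (j * (\<Sum>i\<in>UNIV. s i)))"
    by (simp add: prod.distrib powr_sum sum_distrib_left)
  also have "\<dots> \<le> 8 ^ ?N * 3 ^ ?N * B * 2 powr (j * (\<Sum>i\<in>UNIV. s i))"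
  proof -
    have "2 * 4 ^ ?N \<le> (2 ^ ?N * 4 ^ ?N :: real)"
      using self_le_power[of "2 :: real" ?N] by simp
    also have "\<dots> = 8 ^ ?N" by (simp flip: power_mult_distrib)
    finally have "2 * 4 ^ ?N * (3 ^ ?N * B * 2 powr (j * (\<Sum>i\<in>UNIV. s i))) \<le> 8 ^ ?N * (3 ^ ?N * B * 2 powr (j * (\<Sum>i\<in>UNIV. s i)))"
      using g(3) by (intro mult_right_mono) auto
    then show ?thesis by (simp add: mult_ac)
  qed
  finally show "norm (ft (block s g j) x) \<le> 8 ^ ?N * 3 ^ ?N * B * 2 powr (j * (\<Sum>i\<in>UNIV. s i))" .
qed

text \<open>Where the annulus at scale j meets cell k, the gauge of \<xi> is within a factor 2 of 2
  powr (j + l k). The cut-off with index j + l k equals 1 there, so \<open>m\<close> may be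
  exchanged for the localised symbol; the cells sum to 1 on the annulus.\<close>

lemma block_decomposition:
  fixes p q :: "'n::finite" and m h :: "real ^ 'n \<Rightarrow> complex" and \<alpha> \<beta> :: real
  defines "s \<equiv> dscale \<alpha> \<beta> p q"
  assumes pq: "p \<noteq> q" and pos: "0 < \<alpha>" "0 < \<beta>" and \<omega>: "cutoff \<omega>" and M: "0 < M"
    and l: "\<And>k x. annular s x * cell M k x \<noteq> 0 \<Longrightarrow>
      2 powr (real_of_int (l k) - 1) \<le> arho s x \<and> arho s x \<le> 2 powr (real_of_int (l k) + 1)"
  shows "block s (\<lambda>\<xi>. m \<xi> * h \<xi>) j \<xi> =
    (\<Sum>k\<in>PiE UNIV (\<lambda>_. {- (2 * M)..2 * M}).
       (complex_of_real (annular s (adil s (- j) \<xi>)) * complex_of_real (cell M k (adil s (- j) \<xi>))) *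
       (symbol_piece \<alpha> \<beta> p q \<omega> m (j + l k) \<xi> * h \<xi>))"
    (is "_ = (\<Sum>k\<in>?I. ?A * ?c k * (?S k * h \<xi>))")
proof -
  have s: "0 < s i" for i unfolding s_def using pos by (rule dscale_pos)
  have eq: "?A * ?c k * (?S k * h \<xi>) = ?c k * (?A * (m \<xi> * h \<xi>))" for k
  proof (cases "annular s (adil s (- j) \<xi>) * cell M k (adil s (- j) \<xi>) = 0")
    case False
    let ?r = "arho s (adil s (- j) \<xi>)"
    have "arho s (adil s (- (j + l k)) \<xi>) = arho s (adil s (- l k) (adil s (- j) \<xi>))"
      by (simp add: add.commute)
    also have "\<dots> = 2 powr (- real_of_int (l k)) * ?r"
      by (subst arho_adil[of s, OF s]) simp
    finally have r: "arho s (adil s (- (j + l k)) \<xi>) = 2 powr (- real_of_int (l k)) * ?r" .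
    have "2 powr (- real_of_int (l k)) * 2 powr (real_of_int (l k) - 1) \<le> 2 powr (- real_of_int (l k)) * ?r"
      "2 powr (- real_of_int (l k)) * ?r \<le> 2 powr (- real_of_int (l k)) * 2 powr (real_of_int (l k) + 1)"
      using l[OF False] by (auto intro: mult_left_mono)
    moreover have "2 powr (- real_of_int (l k)) * 2 powr (real_of_int (l k) - 1) = 1 / 2"
      "2 powr (- real_of_int (l k)) * 2 powr (real_of_int (l k) + 1) = (2 :: real)"
      by (simp_all add: powr_add powr_diff powr_minus)
    ultimately have "\<omega> (arho s (adil s (- (j + l k)) \<xi>)) = 1"
      unfolding r by (intro cutoff_eq_1 \<omega>) auto
    then have "?S k = m \<xi>"
      by (simp add: symbol_piece_eq[OF pq] s_def)
    then show ?thesis by simp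
  qed auto
  show ?thesis
  proof (cases "annular s (adil s (- j) \<xi>) = 0")
    case False
    have "(\<Sum>k\<in>?I. cell M k (adil s (- j) \<xi>)) = 1"
      by (rule sum_cell[OF M annular_neq_0(1)[of s, OF s False]])
    then have "(\<Sum>k\<in>?I. ?c k) = 1"
      by (metis of_real_sum of_real_1)
    then show ?thesis
      unfolding eq sum_distrib_right[symmetric] by (simp add: block_def)
  qed (simp add: block_def)
qed

text \<open>Each cell contributes the multiplier norm of the annular factor times that of a product
  of tents, and the shift of scale contributes 2 powr (- (l k \<gamma>)). Cells and shifts are the
  same for all j, hence so is the constant.\<close>

lemma block_hi:
  fixes p q :: "'n::finite" and m h :: "real ^ 'n \<Rightarrow> complex" and \<alpha> \<beta> :: real
  defines "s \<equiv> dscale \<alpha> \<beta> p q"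
  assumes pq: "p \<noteq> q" and pos: "0 < \<alpha>" "0 < \<beta>" and \<omega>: "cutoff \<omega>" and M: "0 < M"
    and l: "\<And>k x. annular s x * cell M k x \<noteq> 0 \<Longrightarrow>
      2 powr (real_of_int (l k) - 1) \<le> arho s x \<and> arho s x \<le> 2 powr (real_of_int (l k) + 1)"
    and int: "\<And>j. integrable lborel (\<lambda>\<xi>. symbol_piece \<alpha> \<beta> p q \<omega> m j \<xi> * h \<xi>)"
    and bound: "\<And>j x. norm (ft (\<lambda>\<xi>. symbol_piece \<alpha> \<beta> p q \<omega> m j \<xi> * h \<xi>) x) \<le> B * 2 powr (- (real_of_int j * \<gamma>))"
  shows "norm (ft (block s (\<lambda>\<xi>. m \<xi> * h \<xi>) j) x) \<le>
    (\<Sum>k\<in>PiE (UNIV :: 'n set) (\<lambda>_. {- (2 * M)..2 * M}). 2 * 3 ^ CARD('n) * 2 powr (- (real_of_int (l k) * \<gamma>)))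
      * (B * 2 powr (- (real_of_int j * \<gamma>)))"
proof -
  let ?I = "PiE (UNIV :: 'n set) (\<lambda>_. {- (2 * M)..2 * M})"
  let ?P = "\<lambda>k \<xi>. complex_of_real (annular s (adil s (- j) \<xi>)) * complex_of_real (cell M k (adil s (- j) \<xi>))"
  let ?W = "\<lambda>k \<xi>. symbol_piece \<alpha> \<beta> p q \<omega> m (j + l k) \<xi> * h \<xi>"
  have P: "ft_mult (2 * 3 ^ CARD('n) * 1) (?P k)" for k
    by (intro ft_mult_mult ft_mult_annular ft_mult_cell)
  have "ft (block s (\<lambda>\<xi>. m \<xi> * h \<xi>) j) x = ft (\<lambda>\<xi>. \<Sum>k\<in>?I. ?P k \<xi> * ?W k \<xi>) x"
    unfolding s_def by (intro ft_cong block_decomposition assms(2-6) l[unfolded s_def])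
  also have "\<dots> = (\<Sum>k\<in>?I. ft (\<lambda>\<xi>. ?P k \<xi> * ?W k \<xi>) x)"
    by (intro ft_sum ft_mult_integrable[OF P] int)
  finally have eq: "ft (block s (\<lambda>\<xi>. m \<xi> * h \<xi>) j) x = (\<Sum>k\<in>?I. ft (\<lambda>\<xi>. ?P k \<xi> * ?W k \<xi>) x)" .
  show ?thesis
    unfolding eq sum_distrib_right
  proof (rule sum_norm_le)
    fix k
    have "norm (ft (\<lambda>\<xi>. ?P k \<xi> * ?W k \<xi>) x) \<le> 2 * 3 ^ CARD('n) * 1 * (B * 2 powr (- (real_of_int (j + l k) * \<gamma>)))"
      by (rule ft_multD[OF P int bound])
    then show "norm (ft (\<lambda>\<xi>. ?P k \<xi> * ?W k \<xi>) x) \<le>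
       (2 * 3 ^ CARD('n) * 2 powr (- (real_of_int (l k) * \<gamma>))) * (B * 2 powr (- (real_of_int j * \<gamma>)))"
      by (simp add: distrib_right powr_add[symmetric] powr_diff powr_minus field_simps)
  qed
qed

section \<open>Identification of the sum of blocks with the \<open>L\<^sub>2\<close>
  transform\<close>

lemma nn_integral_lborel_uminus:
  fixes f :: "'a::euclidean_space \<Rightarrow> ennreal"
  assumes [measurable]: "f \<in> borel_measurable borel"
  shows "(\<integral>\<^sup>+x. f (- x) \<partial>lborel) = (\<integral>\<^sup>+x. f x \<partial>lborel)"
proof -
  have "(\<integral>\<^sup>+x. f x \<partial>lborel) = (\<integral>\<^sup>+x. f x \<partial>density (distr lborel borel (\<lambda>x. 0 + (- 1) *\<^sub>R x)) (\<lambda>_. ennreal (\<bar>- 1\<bar> ^ DIM('a))))"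
    using lborel_affine[of "- 1" "0 :: 'a"] by simp
  also have "\<dots> = (\<integral>\<^sup>+x. f (- x) \<partial>lborel)"
    by (simp add: nn_integral_density nn_integral_distr)
  finally show ?thesis by simp
qed

lemma fourier_bounds:
  fixes u :: "real ^ 'n::finite \<Rightarrow> complex"
  assumes u: "integrable lborel u"
  shows "fourier u \<in> borel_measurable borel"
    and "norm (fourier u \<xi>) \<le> (LINT x|lborel. norm (u x))"
    and "(\<integral>\<^sup>+\<xi>. ennreal ((norm (fourier u \<xi>))\<^sup>2) \<partial>lborel)
      \<le> ennreal ((2 * pi) ^ CARD('n)) * (\<integral>\<^sup>+x. ennreal ((norm (u x))\<^sup>2) \<partial>lborel)"
proof -
  have [measurable]: "ft u \<in> borel_measurable borel" by (rule borel_measurable_ft[OF u])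
  have eq: "fourier u = (\<lambda>\<xi>. ft u (- \<xi>))" by (rule ext) (rule fourier_eq_ft)
  show "fourier u \<in> borel_measurable borel" unfolding eq by measurable
  show "norm (fourier u \<xi>) \<le> (LINT x|lborel. norm (u x))"
    unfolding eq by (rule norm_ft_le)
  show "(\<integral>\<^sup>+\<xi>. ennreal ((norm (fourier u \<xi>))\<^sup>2) \<partial>lborel)
      \<le> ennreal ((2 * pi) ^ CARD('n)) * (\<integral>\<^sup>+x. ennreal ((norm (u x))\<^sup>2) \<partial>lborel)"
    unfolding eq using nn_integral_lborel_uminus[of "\<lambda>\<xi>. ennreal ((norm (ft u \<xi>))\<^sup>2)"] Plancherel_le[OF u]
    by simp
qed

text \<open>A single approximating sequence with pointwise convergent transforms decides for all:
  \<open>ft_L2_limit\<close> compares any other integrable approximation with \<open>v\<close>. The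
  same estimate at \<open>G = 0\<close> shows that \<open>v\<close> is square integrable.\<close>

lemma inv_fourier_L2_I:
  fixes g v :: "real ^ 'n::finite \<Rightarrow> complex"
  assumes g: "in_L2 g" and v: "v \<in> borel_measurable borel"
    and F: "\<And>n. integrable lborel (F n)"
    and lim: "(\<lambda>n. \<integral>\<^sup>+x. ennreal ((norm (g x - F n x))\<^sup>2) \<partial>lborel) \<longlonglongrightarrow> 0"
    and Fv: "\<And>x. (\<lambda>n. inv_fourier (F n) x) \<longlonglongrightarrow> v x"
  shows "inv_fourier_L2 g v"
proof -
  let ?c = "(2 * pi) ^ CARD('n) :: real"
  define w where "w x = complex_of_real ?c * v x" for x
  have w: "(\<lambda>n. ft (F n) x) \<longlonglongrightarrow> w x" for x
  proof -
    have "(\<lambda>n. complex_of_real ?c * inv_fourier (F n) x) \<longlonglongrightarrow> w x"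
      unfolding w_def by (intro tendsto_mult_left Fv)
    moreover have "complex_of_real ?c * inv_fourier (F n) x = ft (F n) x" for n
      by (simp add: inv_fourier_eq_ft)
    ultimately show ?thesis by simp
  qed
  have g': "g \<in> borel_measurable borel" "integrable lborel (\<lambda>x. (cmod (g x))\<^sup>2)"
    using g by (auto simp: in_L2_def)
  have key: "(\<integral>\<^sup>+x. ennreal ((norm (inv_fourier G x - v x))\<^sup>2) \<partial>lborel)
     \<le> ennreal (2 / ?c) * (\<integral>\<^sup>+x. ennreal ((norm (G x - g x))\<^sup>2) \<partial>lborel)"
    if G: "integrable lborel G" for G
  proof -
    have [measurable]: "ft G \<in> borel_measurable borel" "v \<in> borel_measurable borel"
      using borel_measurable_ft[OF G] v by auto
    have [measurable]: "w \<in> borel_measurable borel" unfolding w_def by measurable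
    have "norm (inv_fourier G x - v x) = 1 / ?c * norm (ft G x - w x)" for x
    proof -
      have "inv_fourier G x - v x = complex_of_real (1 / ?c) * (ft G x - w x)"
        by (simp add: inv_fourier_eq_ft w_def right_diff_distrib)
      then show ?thesis by (simp only: norm_mult norm_of_real) simp
    qed
    then have "(\<integral>\<^sup>+x. ennreal ((norm (inv_fourier G x - v x))\<^sup>2) \<partial>lborel) =
       (\<integral>\<^sup>+x. ennreal ((1 / ?c)\<^sup>2) * ennreal ((norm (ft G x - w x))\<^sup>2) \<partial>lborel)"
      by (simp only: power_mult_distrib ennreal_mult' zero_le_power2)
    also have "\<dots> = ennreal ((1 / ?c)\<^sup>2) * (\<integral>\<^sup>+x. ennreal ((norm (ft G x - w x))\<^sup>2) \<partial>lborel)"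
      by (rule nn_integral_cmult) measurable
    also have "\<dots> \<le> ennreal ((1 / ?c)\<^sup>2) * (ennreal ?c * (2 * (\<integral>\<^sup>+x. ennreal ((norm (G x - g x))\<^sup>2) \<partial>lborel)))"
      using ft_L2_limit[OF G g'(1) F lim w] by (intro mult_left_mono) auto
    also have "\<dots> = (ennreal ((1 / ?c)\<^sup>2) * ennreal ?c * ennreal 2) * (\<integral>\<^sup>+x. ennreal ((norm (G x - g x))\<^sup>2) \<partial>lborel)"
      by (simp add: mult.assoc)
    also have "ennreal ((1 / ?c)\<^sup>2) * ennreal ?c * ennreal 2 = ennreal (2 / ?c)"
    proof -
      have "(1 / ?c)\<^sup>2 * ?c * 2 = 2 / ?c" by (simp add: power2_eq_square)
      then show ?thesis by (metis ennreal_mult' zero_le_power2 mult_nonneg_nonneg zero_le_power pi_ge_zero zero_le_numeral)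
    qed
    finally show ?thesis .
  qed
  have "in_L2 v"
    unfolding in_L2_def
  proof
    show "v \<in> borel_measurable lborel" using v by simp
    have "(\<integral>\<^sup>+x. ennreal ((norm (v x))\<^sup>2) \<partial>lborel) \<le> ennreal (2 / ?c) * (\<integral>\<^sup>+x. ennreal ((norm (g x))\<^sup>2) \<partial>lborel)"
      using key[of "\<lambda>_. 0"] by (simp add: inv_fourier_def)
    also have "\<dots> < \<infinity>"
      using g'(2) by (subst nn_integral_eq_integral) (auto simp: ennreal_mult_less_top)
    finally show "integrable lborel (\<lambda>x. (cmod (v x))\<^sup>2)"
      using v by (intro integrableI_nonneg) auto
  qed
  moreover have "tendsto_L2 (\<lambda>k. inv_fourier (G k)) v"
    if G: "\<And>k. integrable lborel (G k)" and Gg: "tendsto_L2 G g" for G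
  proof -
    have "(\<lambda>k. ennreal (2 / ?c) * (\<integral>\<^sup>+x. ennreal ((norm (G k x - g x))\<^sup>2) \<partial>lborel)) \<longlonglongrightarrow> ennreal (2 / ?c) * 0"
      using Gg unfolding tendsto_L2_def by (intro ennreal_tendsto_cmult) auto
    then have "(\<lambda>k. ennreal (2 / ?c) * (\<integral>\<^sup>+x. ennreal ((norm (G k x - g x))\<^sup>2) \<partial>lborel)) \<longlonglongrightarrow> 0"
      by simp
    then show ?thesis
      unfolding tendsto_L2_def
      by (rule tendsto_sandwich[OF always_eventually always_eventually tendsto_const, rotated 2]) (use key[OF G] in auto)
  qed
  ultimately show ?thesis
    using g unfolding inv_fourier_L2_def by blast
qed

lemma dyadic_blocks_limit:
  assumes f: "dyadic_blocks \<sigma> \<gamma> D D' S i f" and "0 < \<gamma>" and cont: "\<And>j. continuous_on UNIV (f j 0)"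
  shows "\<exists>v. continuous_on UNIV v \<and> (\<forall>x. (\<lambda>m. \<Sum>j\<in>{- int m..<int m}. f j 0 x) \<longlonglongrightarrow> v x)"
proof -
  let ?y = "max (2 powr (- \<gamma>)) (2 powr (- S))"
  have D: "0 \<le> D" "0 \<le> D'" "0 < S"
    and hi: "\<And>j r x. norm (f j r x) \<le> (4 * 2 powr (real_of_int j * \<sigma>)) ^ r * (D * 2 powr (- (j * \<gamma>)))"
    and lo: "\<And>j r x. norm (f j r x) \<le> (4 * 2 powr (real_of_int j * \<sigma>)) ^ r * (D' * 2 powr (j * S))"
    using f unfolding dyadic_blocks_def by blast+
  have "norm (f j 0 x) \<le> (D + D') * ?y ^ nat \<bar>j\<bar>" for j x
    using hi[of j 0 x] lo[of j 0 x] D assms(2) by (intro dyadic_power_le) auto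
  then have "\<exists>V. uniform_limit UNIV (\<lambda>m x. \<Sum>j\<in>{- int m..<int m}. f j 0 x) V sequentially"
    by (rule symmetric_sum_uniform_limit) (use D assms(2) in \<open>auto simp: powr_less_one le_max_iff_disj\<close>)
  then obtain V where V: "uniform_limit UNIV (\<lambda>m x. \<Sum>j\<in>{- int m..<int m}. f j 0 x) V sequentially" ..
  have "continuous_on UNIV V"
    by (rule uniform_limit_theorem[OF _ V]) (auto intro!: always_eventually continuous_on_sum cont)
  then show ?thesis
    using tendsto_uniform_limitI[OF V] by blast
qed

text \<open>Differentiation in direction \<open>i\<close> multiplies the symbol by the linear form,
  and Bernstein's inequality bounds the result. The normalising power of 2 \<pi> cancels against the
  one in \<open>hi\<close>; in the crude bound it is at least 1 and is dropped.\<close>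

lemma blocks_are_dyadic:
  fixes g :: "real ^ 'n::finite \<Rightarrow> complex"
  assumes s: "\<And>i. 0 < s i" and g: "g \<in> borel_measurable borel" "\<And>\<xi>. \<xi> \<noteq> 0 \<Longrightarrow> norm (g \<xi>) \<le> B" "0 \<le> B"
    and hi: "\<And>j x. norm (ft (block s g j) x) \<le> (2 * pi) ^ CARD('n) * (D * 2 powr (- (real_of_int j * \<gamma>)))" and D: "0 \<le> D"
  shows "dyadic_blocks (s i) \<gamma> D (8 ^ CARD('n) * 3 ^ CARD('n) * B) (\<Sum>i\<in>UNIV. s i) i
    (\<lambda>j r x. inv_fourier (\<lambda>\<xi>. (\<i> * (\<xi> \<bullet> axis i 1)) ^ r * block s g j \<xi>) x)"
proof -
  let ?c = "(2 * pi) ^ CARD('n) :: real" and ?D' = "8 ^ CARD('n) * 3 ^ CARD('n) * B" and ?S = "\<Sum>i\<in>UNIV. s i"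
  let ?V = "\<lambda>j r \<xi>. (\<i> * complex_of_real (\<xi> \<bullet> axis i 1)) ^ r * block s g j \<xi>"
  have R: "0 < 2 * 2 powr (real_of_int j * s i)" for j by simp
  have supp: "\<bar>\<xi> \<bullet> axis i 1\<bar> \<le> 2 * 2 powr (real_of_int j * s i)" if "?V j r \<xi> \<noteq> 0" for j r \<xi>
    using that block_support[of s, OF s, of g j \<xi> i] by (auto simp: inner_axis)
  have supp0: "\<bar>\<xi> \<bullet> axis i 1\<bar> \<le> 2 * 2 powr (real_of_int j * s i)" if "block s g j \<xi> \<noteq> 0" for j \<xi>
    using block_support[of s, OF s that] by (simp add: inner_axis)
  note int = block_integrable_lo(1)[of s, OF s g] and lo = block_integrable_lo(2)[of s, OF s g]
  have V_int: "integrable lborel (?V j r)" for j r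
    using Bernstein[OF R int supp0] by blast
  have Bern: "norm (ft (?V j r) x) \<le> (2 * (2 * 2 powr (real_of_int j * s i))) ^ r * E"
    if "\<And>x. norm (ft (block s g j) x) \<le> E" for j r x E
    using Bernstein[OF R int supp0] that by blast
  have norm_inv: "norm (inv_fourier h x) = norm (ft h x) / ?c" for h :: "real ^ 'n \<Rightarrow> complex" and x
    by (simp add: inv_fourier_eq_ft norm_divide norm_mult norm_power)
  have c1: "1 \<le> ?c"
    using pi_gt3 by (intro one_le_power) simp
  have der: "((\<lambda>t. inv_fourier (?V j r) (x + t *\<^sub>R axis i 1)) has_vector_derivative
      inv_fourier (?V j (Suc r)) (x + t *\<^sub>R axis i 1)) (at t)" for j r x t
  proof -
    have "((\<lambda>t. ft (?V j r) (x + t *\<^sub>R axis i 1)) has_vector_derivative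
        ft (\<lambda>\<xi>. (\<i> * (\<xi> \<bullet> axis i 1)) * ?V j r \<xi>) (x + t *\<^sub>R axis i 1)) (at t)"
      by (intro ft_has_vector_derivative[OF R V_int supp])
    then have "((\<lambda>t. complex_of_real (1 / ?c) * ft (?V j r) (x + t *\<^sub>R axis i 1)) has_vector_derivative
        complex_of_real (1 / ?c) * ft (\<lambda>\<xi>. (\<i> * (\<xi> \<bullet> axis i 1)) * ?V j r \<xi>) (x + t *\<^sub>R axis i 1)) (at t)"
      by (rule has_vector_derivative_mult_right)
    then show ?thesis
      by (simp only: inv_fourier_eq_ft power_Suc mult.assoc)
  qed
  have "norm (inv_fourier (?V j r) x) \<le> (4 * 2 powr (j * s i)) ^ r * (D * 2 powr (- (j * \<gamma>)))" for j r x
  proof -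
    have "norm (ft (?V j r) x) \<le> (2 * (2 * 2 powr (j * s i))) ^ r * (?c * (D * 2 powr (- (j * \<gamma>))))"
      by (rule Bern[OF hi])
    then show ?thesis
      unfolding norm_inv using c1 by (simp add: divide_le_eq mult_ac)
  qed
  moreover have "norm (inv_fourier (?V j r) x) \<le> (4 * 2 powr (j * s i)) ^ r * (?D' * 2 powr (j * ?S))" for j r x
  proof -
    have "norm (ft (?V j r) x) \<le> (2 * (2 * 2 powr (j * s i))) ^ r * (?D' * 2 powr (j * ?S))"
      by (rule Bern[OF lo])
    moreover have "norm (ft (?V j r) x) / ?c \<le> norm (ft (?V j r) x)"
      using c1 by (simp add: divide_le_eq mult_le_cancel_left1)
    ultimately show ?thesis
      unfolding norm_inv by simp
  qed
  moreover have "0 < ?S" by (intro sum_pos s) auto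
  ultimately show ?thesis
    unfolding dyadic_blocks_def using D g(3) der by auto
qed

text \<open>Dominated convergence: telescoping bounds the partial sums of the partition uniformly,
  and at every nonzero frequency they are eventually equal to 1.\<close>

lemma sum_blocks_tendsto_L2:
  fixes g :: "real ^ 'n::finite \<Rightarrow> complex"
  assumes s: "\<And>i. 0 < s i" and g: "in_L2 g"
  shows "(\<lambda>n. \<integral>\<^sup>+\<xi>. ennreal ((norm (g \<xi> - (\<Sum>j\<in>{- int n..<int n}. block s g j \<xi>)))\<^sup>2) \<partial>lborel) \<longlonglongrightarrow> 0"
proof -
  let ?a = "\<lambda>n \<xi>. \<Sum>j\<in>{- int n..<int n}. annular s (adil s (- j) \<xi>)"
  let ?K = "(1 + 2 * 3 ^ CARD('n))\<^sup>2 :: real"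
  have [measurable]: "g \<in> borel_measurable borel" and g2: "integrable lborel (\<lambda>x. (cmod (g x))\<^sup>2)"
    using g by (auto simp: in_L2_def)
  have eq: "g \<xi> - (\<Sum>j\<in>{- int n..<int n}. block s g j \<xi>) = (1 - complex_of_real (?a n \<xi>)) * g \<xi>" for n \<xi>
    by (simp add: block_def sum_distrib_right[symmetric] left_diff_distrib)
  have "(\<lambda>n. \<integral>\<^sup>+\<xi>. ennreal ((norm ((1 - complex_of_real (?a n \<xi>)) * g \<xi>))\<^sup>2) \<partial>lborel) \<longlonglongrightarrow> (\<integral>\<^sup>+\<xi>. (0::ennreal) \<partial>(lborel :: (real ^ 'n) measure))"
  proof (rule nn_integral_dominated_convergence[where w = "\<lambda>\<xi>. ennreal (?K * (norm (g \<xi>))\<^sup>2)"])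
    show "AE \<xi> in lborel. ennreal ((norm ((1 - complex_of_real (?a n \<xi>)) * g \<xi>))\<^sup>2) \<le> ennreal (?K * (norm (g \<xi>))\<^sup>2)" for n
    proof (intro AE_I2 ennreal_leI)
      fix \<xi>
      have "norm (1 - complex_of_real (?a n \<xi>)) = \<bar>1 - ?a n \<xi>\<bar>"
        by (metis norm_of_real of_real_1 of_real_diff)
      also have "\<dots> \<le> 1 + 2 * 3 ^ CARD('n)"
        using annular_sum_bound[of s \<xi> n] by linarith
      finally have "(norm (1 - complex_of_real (?a n \<xi>)))\<^sup>2 \<le> ?K"
        by (rule power_mono) simp
      then show "(norm ((1 - complex_of_real (?a n \<xi>)) * g \<xi>))\<^sup>2 \<le> ?K * (norm (g \<xi>))\<^sup>2"
        unfolding norm_mult power_mult_distrib by (rule mult_right_mono) simp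
    qed
    have "integrable lborel (\<lambda>\<xi>. ?K * (norm (g \<xi>))\<^sup>2)" using g2 by simp
    then show "(\<integral>\<^sup>+\<xi>. ennreal (?K * (norm (g \<xi>))\<^sup>2) \<partial>lborel) < \<infinity>"
      by (subst nn_integral_eq_integral) auto
    have "AE \<xi> in lborel. (\<xi> :: real ^ 'n) \<noteq> 0"
      by (rule AE_lborel_singleton)
    then show "AE \<xi> in lborel. (\<lambda>n. ennreal ((norm ((1 - complex_of_real (?a n \<xi>)) * g \<xi>))\<^sup>2)) \<longlonglongrightarrow> 0"
    proof eventually_elim
      case (elim \<xi>)
      show ?case
        by (rule tendsto_eventually, rule eventually_mono[OF annular_sum_eventually[of s, OF s elim]]) simp
    qed
  qed measurable
  then show ?thesis unfolding eq by simp
qed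

text \<open>\<open>inv_fourier_L2\<close> determines \<open>v\<close> almost everywhere only,
  whereas the seminorms are pointwise; the conclusion therefore concerns the continuous
  representative.\<close>

theorem theorem2:
  fixes \<alpha> \<beta> \<gamma> :: real and \<omega> :: "real \<Rightarrow> real" and p q :: "'n::finite"
  assumes "p \<noteq> q"
    and "0 < \<alpha>" and "\<alpha> \<le> 1"
    and "0 < \<beta>"
    and "0 < \<gamma>" and "\<gamma> < 1"
    and "\<beta> * \<gamma> \<notin> \<int>"
    and "cutoff \<omega>"
  shows "\<exists>C>0. \<forall>(m :: real ^ 'n \<Rightarrow> complex) (\<mu> :: real) (u :: real ^ 'n \<Rightarrow> complex).
    continuous_on (- {0}) m \<longrightarrow> bounded (m ` (- {0})) \<longrightarrow>
    (\<forall>t. t \<noteq> 0 \<longrightarrow> m (axis q t) = 0) \<longrightarrow>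
    0 < \<mu> \<longrightarrow>
    (\<forall>j. (\<integral>\<^sup>+x. ennreal (kernel_weight \<alpha> \<gamma> p q x * cmod (kernel \<alpha> \<beta> p q \<omega> m j x)) \<partial>lborel)
           \<le> ennreal \<mu>) \<longrightarrow>
    u \<in> holder_space \<alpha> \<gamma> p q \<longrightarrow> compact (closure {x. u x \<noteq> 0}) \<longrightarrow>
    (\<exists>v. inv_fourier_L2 (\<lambda>\<xi>. m \<xi> * fourier u \<xi>) v \<and>
         continuous_on UNIV v \<and>
         holder_seminorm_dprime \<gamma> p q v + holder_seminorm (\<alpha> * \<gamma>) p v
           + holder_seminorm (\<beta> * \<gamma>) q v
         \<le> ennreal (C * \<mu>) *
             (holder_seminorm_dprime \<gamma> p q u + holder_seminorm (\<alpha> * \<gamma>) p u))"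
proof -
  define s where "s = dscale \<alpha> \<beta> p q"
  have s: "0 < s i" for i unfolding s_def using assms by (intro dscale_pos)
  have sp: "\<gamma> / s p = \<alpha> * \<gamma>" and sq: "\<gamma> / s q = \<beta> * \<gamma>" and si: "i \<in> - {p, q} \<Longrightarrow> \<gamma> / s i = \<gamma>" for i
    using assms(1) by (auto simp: s_def dscale_def)
  have frac: "t \<notin> \<int>" if "0 < t" "t < 1" for t :: real
    using that by (auto elim!: Ints_cases)
  have "\<alpha> * \<gamma> \<le> 1 * \<gamma>" by (rule mult_right_mono) (use assms in auto)
  then have "\<alpha> * \<gamma> < 1" using assms by linarith
  then have "\<alpha> * \<gamma> \<notin> \<int>" using assms by (intro frac) auto
  \<comment> \<open>Off \<open>q\<close> the quotient is \<gamma> or \<alpha> * \<gamma>, both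
    strictly between 0 and 1; at \<open>q\<close> it is \<beta> * \<gamma>.\<close>
  then have nonint: "\<gamma> / s i \<notin> \<int>" for i
    using sp sq si[of i] frac[of \<gamma>] assms by (cases "i \<in> - {p, q}") auto
  obtain M l where M: "0 < M" and l: "\<And>k x. annular s x * cell M k x \<noteq> 0 \<Longrightarrow>
      2 powr (real_of_int (l k) - 1) \<le> arho s x \<and> arho s x \<le> 2 powr (real_of_int (l k) + 1)"
    using cell_localized[of s, OF s] by blast
  define C1 where "C1 = (\<Sum>k\<in>PiE (UNIV :: 'n set) (\<lambda>_. {- (2 * M)..2 * M}).
      2 * 3 ^ CARD('n) * 2 powr (- (real_of_int (l k) * \<gamma>)))"
  have C1: "0 \<le> C1" unfolding C1_def by (intro sum_nonneg) auto
  \<comment> \<open>The conclusion of \<open>dyadic_synthesis\<close> is named so that one constant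
    per coordinate can be chosen before \<open>m\<close>, \<open>u\<close> and \<mu> appear.\<close>
  define good where "good i C \<longleftrightarrow> (\<forall>(f :: int \<Rightarrow> nat \<Rightarrow> real ^ 'n \<Rightarrow> complex) k D D' S v.
      dyadic_blocks (s i) \<gamma> D D' S k f \<longrightarrow>
      (\<forall>x. (\<lambda>m. \<Sum>j\<in>{- int m..<int m}. f j 0 x) \<longlonglongrightarrow> v x) \<longrightarrow>
      holder_seminorm (\<gamma> / s i) k v \<le> ennreal (C * D))" for i C
  have "\<exists>C>0. good i C" for i
    unfolding good_def by (rule dyadic_synthesis) (use s assms nonint in auto)
  then obtain C where C: "\<And>i. 0 < C i" "\<And>i. good i (C i)"
    by metis
  \<comment> \<open>The added 1 makes the constant positive without an evaluation of the sum over
    cells.\<close>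
  define C' where "C' = (\<Sum>i\<in>UNIV. C i) * (C1 + 1)"
  have sumC: "0 < (\<Sum>i\<in>UNIV. C i)" by (intro sum_pos C(1)) auto
  have "0 < C'" unfolding C'_def using sumC C1 by simp
  moreover have "\<exists>v. inv_fourier_L2 (\<lambda>\<xi>. m \<xi> * fourier u \<xi>) v \<and> continuous_on UNIV v \<and>
         holder_seminorm_dprime \<gamma> p q v + holder_seminorm (\<alpha> * \<gamma>) p v + holder_seminorm (\<beta> * \<gamma>) q v
         \<le> ennreal (C' * \<mu>) * (holder_seminorm_dprime \<gamma> p q u + holder_seminorm (\<alpha> * \<gamma>) p u)"
    if m: "continuous_on (- {0}) m" "bounded (m ` (- {0}))" "\<And>t. t \<noteq> 0 \<Longrightarrow> m (axis q t) = 0"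
      and \<mu>: "0 < \<mu>" "\<And>j. (\<integral>\<^sup>+x. ennreal (kernel_weight \<alpha> \<gamma> p q x * cmod (kernel \<alpha> \<beta> p q \<omega> m j x)) \<partial>lborel) \<le> ennreal \<mu>"
      and u: "u \<in> holder_space \<alpha> \<gamma> p q" and supp: "compact (closure {x. u x \<noteq> 0})"
    for m u :: "real ^ 'n \<Rightarrow> complex" and \<mu> :: real
  proof -
    let ?N = "holder_seminorm_dprime \<gamma> p q u + holder_seminorm (\<alpha> * \<gamma>) p u"
    define U where "U = enn2real ?N"
    have u': "continuous_on UNIV u" "bounded (range u)" "?N < \<infinity>"
      using u by (auto simp: holder_space_def)
    have U: "?N = ennreal U" "0 \<le> U"
      using u'(3) by (auto simp: U_def)
    have u_int: "integrable lborel u"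
      by (rule integrable_continuous_compact_support[OF u'(1) supp]) (use closure_subset[of "{x. u x \<noteq> 0}"] in auto)
    have u_int2: "integrable lborel (\<lambda>x. u x * u x)"
      by (rule integrable_continuous_compact_support[OF _ supp])
         (use closure_subset[of "{x. u x \<noteq> 0}"] u'(1) in \<open>auto intro!: continuous_intros\<close>)
    define g where "g \<xi> = m \<xi> * fourier u \<xi>" for \<xi>
    obtain A where "0 < A" "\<forall>z\<in>m ` (- {0}). norm z \<le> A"
      using m(2) unfolding bounded_pos by blast
    then have A: "\<And>\<xi>. \<xi> \<noteq> 0 \<Longrightarrow> norm (m \<xi>) \<le> A" "0 \<le> A"
      by auto
    let ?L = "LINT x|lborel. norm (u x)"
    have m_meas: "m \<in> borel_measurable borel"
    proof -
      have "(\<lambda>\<xi>. if \<xi> \<in> - {0} then m \<xi> else m 0) \<in> borel_measurable borel"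
        by (rule borel_measurable_continuous_on_if) (use m(1) in auto)
      also have "(\<lambda>\<xi>. if \<xi> \<in> - {0} then m \<xi> else m 0) = m" by auto
      finally show ?thesis .
    qed
    have g_meas: "g \<in> borel_measurable borel"
      unfolding g_def using m_meas fourier_bounds(1)[OF u_int] by measurable
    have g_le: "norm (g \<xi>) \<le> A * norm (fourier u \<xi>)" if "\<xi> \<noteq> 0" for \<xi>
      unfolding g_def norm_mult using A(1)[OF that] by (rule mult_right_mono) simp
    have g_bound: "norm (g \<xi>) \<le> A * ?L" if "\<xi> \<noteq> 0" for \<xi>
      using g_le[OF that] mult_left_mono[OF fourier_bounds(2)[OF u_int, of \<xi>] A(2)] by linarith
    have AL: "0 \<le> A * ?L" using A(2) by simp
    have g_L2: "in_L2 g"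
      unfolding in_L2_def
    proof
      show "g \<in> borel_measurable lborel" using g_meas by simp
      have [measurable]: "fourier u \<in> borel_measurable borel" by (rule fourier_bounds(1)[OF u_int])
      have "AE \<xi> in lborel. (\<xi> :: real ^ 'n) \<noteq> 0"
        by (rule AE_lborel_singleton)
      then have "AE \<xi> in lborel. ennreal ((norm (g \<xi>))\<^sup>2) \<le> ennreal (A\<^sup>2) * ennreal ((norm (fourier u \<xi>))\<^sup>2)"
      proof eventually_elim
        case (elim \<xi>)
        have "(norm (g \<xi>))\<^sup>2 \<le> (A * norm (fourier u \<xi>))\<^sup>2"
          by (rule power_mono[OF g_le[OF elim]]) simp
        then show ?case
          by (simp add: power_mult_distrib ennreal_mult'[symmetric] ennreal_leI)
      qed
      then have "(\<integral>\<^sup>+\<xi>. ennreal ((norm (g \<xi>))\<^sup>2) \<partial>lborel) \<le> (\<integral>\<^sup>+\<xi>. ennreal (A\<^sup>2) * ennreal ((norm (fourier u \<xi>))\<^sup>2) \<partial>lborel)"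
        by (rule nn_integral_mono_AE)
      also have "\<dots> = ennreal (A\<^sup>2) * (\<integral>\<^sup>+\<xi>. ennreal ((norm (fourier u \<xi>))\<^sup>2) \<partial>lborel)"
        by (rule nn_integral_cmult) measurable
      also have "\<dots> \<le> ennreal (A\<^sup>2) * (ennreal ((2 * pi) ^ CARD('n)) * (\<integral>\<^sup>+x. ennreal ((norm (u x))\<^sup>2) \<partial>lborel))"
        by (intro mult_left_mono fourier_bounds(3)[OF u_int]) simp
      also have "\<dots> < \<infinity>"
      proof -
        have "integrable lborel (\<lambda>x. (norm (u x))\<^sup>2)"
          using integrable_norm[OF u_int2] by (simp add: norm_mult power2_eq_square)
        then show ?thesis
          by (subst nn_integral_eq_integral) (auto simp: ennreal_mult_less_top)
      qed
      finally show "integrable lborel (\<lambda>\<xi>. (cmod (g \<xi>))\<^sup>2)"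
        using g_meas by (intro integrableI_nonneg) auto
    qed
    define D where "D = (C1 + 1) * (\<mu> * U)"
    have D: "0 \<le> D" unfolding D_def using C1 \<mu>(1) U(2) by simp
    have hi: "norm (ft (block s g j) x) \<le> (2 * pi) ^ CARD('n) * (D * 2 powr (- (real_of_int j * \<gamma>)))" for j x
    proof -
      have int: "integrable lborel (\<lambda>\<xi>. symbol_piece \<alpha> \<beta> p q \<omega> m j \<xi> * fourier u \<xi>)" for j
        using integrable_bounded_mult[of "fourier u" "symbol_piece \<alpha> \<beta> p q \<omega> m j"] fourier_bounds(1,2)[OF u_int]
          symbol_piece_integrable[OF assms(1,2,4,8) m(1), of j]
        by (auto simp: bounded_iff mult.commute)
      have "norm (ft (block s g j) x) \<le> C1 * ((2 * pi) ^ CARD('n) * (\<mu> * U) * 2 powr (- (real_of_int j * \<gamma>)))"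
        unfolding g_def C1_def s_def
      proof (rule block_hi)
        show "norm (ft (\<lambda>\<xi>. symbol_piece \<alpha> \<beta> p q \<omega> m j \<xi> * fourier u \<xi>) x) \<le>
            (2 * pi) ^ CARD('n) * (\<mu> * U) * 2 powr (- (real_of_int j * \<gamma>))" for j x
          using localized_bound[OF assms(1-6) assms(8) m \<mu>(1) \<mu>(2) u'(1,2) supp U, of j x]
          by (simp add: mult_ac)
      qed (use assms M l int in \<open>auto simp: s_def\<close>)
      also have "\<dots> \<le> (C1 + 1) * ((2 * pi) ^ CARD('n) * (\<mu> * U) * 2 powr (- (real_of_int j * \<gamma>)))"
        using \<mu>(1) U(2) by (intro mult_right_mono) auto
      finally show ?thesis by (simp add: D_def mult_ac)
    qed
    define f where "f i j r x = inv_fourier (\<lambda>\<xi>. (\<i> * (\<xi> \<bullet> axis i 1)) ^ r * block s g j \<xi>) x" for i j r x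
    have blocks: "dyadic_blocks (s i) \<gamma> D (8 ^ CARD('n) * 3 ^ CARD('n) * (A * ?L)) (\<Sum>i\<in>UNIV. s i) i (f i)" for i
      unfolding f_def[abs_def] by (rule blocks_are_dyadic[of s, OF s g_meas g_bound AL hi D])
    \<comment> \<open>At order 0 the family does not depend on the direction, so the limit
      \<open>v\<close> obtained for \<open>q\<close> serves every coordinate.\<close>
    have f0: "f i j 0 = inv_fourier (block s g j)" for i j
      by (simp add: f_def fun_eq_iff)
    have block_int: "integrable lborel (block s g j)" for j
      by (rule block_integrable_lo(1)[of s, OF s g_meas g_bound AL])
    have "continuous_on UNIV (f q j 0)" for j
      unfolding f0 inv_fourier_eq_ft[abs_def] by (intro continuous_intros continuous_ft block_int)
    then obtain v where v: "continuous_on UNIV v" "\<And>x. (\<lambda>n. \<Sum>j\<in>{- int n..<int n}. inv_fourier (block s g j) x) \<longlonglongrightarrow> v x"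
      using dyadic_blocks_limit[OF blocks[of q] assms(5)] unfolding f0 by blast
    have L2: "inv_fourier_L2 g v"
    proof (rule inv_fourier_L2_I[OF g_L2 _ _ sum_blocks_tendsto_L2[of s, OF s g_L2]])
      show "v \<in> borel_measurable borel" by (rule borel_measurable_continuous_onI[OF v(1)])
      show "integrable lborel (\<lambda>\<xi>. \<Sum>j\<in>{- int n..<int n}. block s g j \<xi>)" for n
        by (intro Bochner_Integration.integrable_sum block_int)
      show "(\<lambda>n. inv_fourier (\<lambda>\<xi>. \<Sum>j\<in>{- int n..<int n}. block s g j \<xi>) x) \<longlonglongrightarrow> v x" for x
        using v(2)[of x] unfolding inv_fourier_eq_ft by (simp add: ft_sum block_int sum_distrib_left sum_divide_distrib)
    qed
    have H: "holder_seminorm (\<gamma> / s i) i v \<le> ennreal (C i * D)" for i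
    proof -
      have "\<forall>x. (\<lambda>n. \<Sum>j\<in>{- int n..<int n}. f i j 0 x) \<longlonglongrightarrow> v x"
        unfolding f0 using v(2) by blast
      then show ?thesis
        using C(2)[of i] blocks[of i] unfolding good_def by blast
    qed
    have "holder_seminorm_dprime \<gamma> p q v = (\<Sum>i\<in>- {p, q}. holder_seminorm (\<gamma> / s i) i v)"
      unfolding holder_seminorm_dprime_def by (intro sum.cong) (simp_all add: si)
    then have "holder_seminorm_dprime \<gamma> p q v + holder_seminorm (\<alpha> * \<gamma>) p v + holder_seminorm (\<beta> * \<gamma>) q v =
        (\<Sum>i\<in>UNIV. holder_seminorm (\<gamma> / s i) i v)"
      by (simp add: sum_UNIV_split_pq[OF assms(1)] sp sq add_ac)
    also have "\<dots> \<le> (\<Sum>i\<in>UNIV. ennreal (C i * D))"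
      by (intro sum_mono H)
    also have "\<dots> = ennreal ((\<Sum>i\<in>UNIV. C i) * D)"
      using C(1) D by (subst sum_ennreal) (auto simp: sum_distrib_right less_imp_le)
    also have "(\<Sum>i\<in>UNIV. C i) * D = C' * \<mu> * U"
      by (simp add: C'_def D_def mult_ac)
    also have "ennreal \<dots> = ennreal (C' * \<mu>) * ?N"
      unfolding U(1) using U(2) by (rule ennreal_mult'')
    finally have "holder_seminorm_dprime \<gamma> p q v + holder_seminorm (\<alpha> * \<gamma>) p v + holder_seminorm (\<beta> * \<gamma>) q v
      \<le> ennreal (C' * \<mu>) * ?N" .
    then show ?thesis
      using L2 v(1) unfolding g_def[abs_def] by blast
  qed
  ultimately show ?thesis by blast
qed

end
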